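(* Let $R$ be a ring. The following are equivalent. (1) $R$ is quasi-Frobenius (QF). (2) $R$ is a small dual and left perfect ring. (3) $R$ is a small dual ring with the ascending chain condition (ACC) on right annihilators in which $S_r\subseteq_{ess} R_R$. (4) $R$ is a small dual and semilocal ring with ACC on right annihilators. (5) $R$ is a small dual and semilocal ring with ACC on essential right ideals.
   Context: Rings are associative with identity (not necessarily commutative). For a subset $X\subseteq R$, $\mathbf{l}(X)=\{r\in R: rx=0 \text{ for all } x\in X\}$ and $\mathbf{r}(X)=\{r\in R: xr=0\text{ for all }x\in X\}$. A right annihilator is a right ideal of the form $\mathbf{r}(X)$ for some $X\subseteq R$; a right ideal $I$ is one if and only if $\mathbf{r}(\mathbf{l}(I))=I$. Left annihilators are defined symmetrically. A right ideal $I$ is small if $I+K\neq R$ for every proper right ideal $K$ of $R$; small left ideals are symmetric. $R$ is right dual (resp. right small dual) if every right ideal (resp. every small right ideal) is a right annihilator; left versions are symmetric; $R$ is small dual if it is both left and right small dual. $R$ is quasi-Frobenius if it is right artinian and both left and right dual. $S_r$ is the right socle of $R$ (the socle of $R_R$), and $N\subseteq_{ess}M$ means that $N$ is an essential submodule of $M$. $R$ is semilocal if $R/J$ is semisimple artinian, where $J$ is the Jacobson radical. *)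

theory Defs
  imports "HOL-Algebra.QuotRing" "HOL-Algebra.Generated_Groups"
begin

text \<open>
  The ambient structure is a \<^locale>\<open>ring\<close>: associative and unital, but not assumed commutative
  or nonzero. The library ideals are two-sided, so one-sided ideals are introduced here.
\<close>

section \<open>One-sided ideals and annihilators\<close>

definition right_ideal :: "('a, 'b) ring_scheme \<Rightarrow> 'a set \<Rightarrow> bool" where
  "right_ideal R I \<longleftrightarrow>
     additive_subgroup I R \<and> (\<forall>x\<in>I. \<forall>r\<in>carrier R. x \<otimes>\<^bsub>R\<^esub> r \<in> I)"

definition left_ideal :: "('a, 'b) ring_scheme \<Rightarrow> 'a set \<Rightarrow> bool" where
  "left_ideal R I \<longleftrightarrow>
     additive_subgroup I R \<and> (\<forall>x\<in>I. \<forall>r\<in>carrier R. r \<otimes>\<^bsub>R\<^esub> x \<in> I)"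

definition left_ann :: "('a, 'b) ring_scheme \<Rightarrow> 'a set \<Rightarrow> 'a set" where
  "left_ann R X = {r \<in> carrier R. \<forall>x\<in>X. r \<otimes>\<^bsub>R\<^esub> x = \<zero>\<^bsub>R\<^esub>}"

definition right_ann :: "('a, 'b) ring_scheme \<Rightarrow> 'a set \<Rightarrow> 'a set" where
  "right_ann R X = {r \<in> carrier R. \<forall>x\<in>X. x \<otimes>\<^bsub>R\<^esub> r = \<zero>\<^bsub>R\<^esub>}"

definition right_annihilator :: "('a, 'b) ring_scheme \<Rightarrow> 'a set \<Rightarrow> bool" where
  "right_annihilator R I \<longleftrightarrow> (\<exists>X \<subseteq> carrier R. I = right_ann R X)"

definition left_annihilator :: "('a, 'b) ring_scheme \<Rightarrow> 'a set \<Rightarrow> bool" where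
  "left_annihilator R I \<longleftrightarrow> (\<exists>X \<subseteq> carrier R. I = left_ann R X)"

section \<open>Dual and small dual rings\<close>

definition small_right_ideal :: "('a, 'b) ring_scheme \<Rightarrow> 'a set \<Rightarrow> bool" where
  "small_right_ideal R I \<longleftrightarrow> right_ideal R I \<and>
     (\<forall>K. right_ideal R K \<and> K \<noteq> carrier R \<longrightarrow> I <+>\<^bsub>R\<^esub> K \<noteq> carrier R)"

definition small_left_ideal :: "('a, 'b) ring_scheme \<Rightarrow> 'a set \<Rightarrow> bool" where
  "small_left_ideal R I \<longleftrightarrow> left_ideal R I \<and>
     (\<forall>K. left_ideal R K \<and> K \<noteq> carrier R \<longrightarrow> I <+>\<^bsub>R\<^esub> K \<noteq> carrier R)"

definition right_dual :: "('a, 'b) ring_scheme \<Rightarrow> bool" where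
  "right_dual R \<longleftrightarrow> (\<forall>I. right_ideal R I \<longrightarrow> right_annihilator R I)"

definition left_dual :: "('a, 'b) ring_scheme \<Rightarrow> bool" where
  "left_dual R \<longleftrightarrow> (\<forall>I. left_ideal R I \<longrightarrow> left_annihilator R I)"

definition right_small_dual :: "('a, 'b) ring_scheme \<Rightarrow> bool" where
  "right_small_dual R \<longleftrightarrow> (\<forall>I. small_right_ideal R I \<longrightarrow> right_annihilator R I)"

definition left_small_dual :: "('a, 'b) ring_scheme \<Rightarrow> bool" where
  "left_small_dual R \<longleftrightarrow> (\<forall>I. small_left_ideal R I \<longrightarrow> left_annihilator R I)"

definition small_dual :: "('a, 'b) ring_scheme \<Rightarrow> bool" where
  "small_dual R \<longleftrightarrow> left_small_dual R \<and> right_small_dual R"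

section \<open>Chain conditions\<close>

definition acc_on :: "('a set \<Rightarrow> bool) \<Rightarrow> bool" where
  "acc_on P \<longleftrightarrow> (\<forall>C :: nat \<Rightarrow> 'a set.
     (\<forall>n. P (C n)) \<and> (\<forall>n. C n \<subseteq> C (Suc n)) \<longrightarrow> (\<exists>N. \<forall>n\<ge>N. C n = C N))"

definition dcc_on :: "('a set \<Rightarrow> bool) \<Rightarrow> bool" where
  "dcc_on P \<longleftrightarrow> (\<forall>C :: nat \<Rightarrow> 'a set.
     (\<forall>n. P (C n)) \<and> (\<forall>n. C (Suc n) \<subseteq> C n) \<longrightarrow> (\<exists>N. \<forall>n\<ge>N. C n = C N))"

definition right_artinian :: "('a, 'b) ring_scheme \<Rightarrow> bool" where
  "right_artinian R \<longleftrightarrow> dcc_on (right_ideal R)"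

definition quasi_Frobenius :: "('a, 'b) ring_scheme \<Rightarrow> bool" where
  "quasi_Frobenius R \<longleftrightarrow> right_artinian R \<and> left_dual R \<and> right_dual R"

section \<open>Socle, essential submodules and Jacobson radical\<close>

definition minimal_right_ideal :: "('a, 'b) ring_scheme \<Rightarrow> 'a set \<Rightarrow> bool" where
  "minimal_right_ideal R I \<longleftrightarrow> right_ideal R I \<and> I \<noteq> {\<zero>\<^bsub>R\<^esub>} \<and>
     (\<forall>K. right_ideal R K \<and> K \<subseteq> I \<longrightarrow> K = {\<zero>\<^bsub>R\<^esub>} \<or> K = I)"

text \<open>
  The sum of a (possibly empty) family of right ideals is the additive subgroup generated by their
  union, so \<^term>\<open>right_socle R\<close> is the sum of the simple submodules of $R_R$, and it is
  \<^term>\<open>{\<zero>\<^bsub>R\<^esub>}\<close> if there are none.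
\<close>

definition right_socle :: "('a, 'b) ring_scheme \<Rightarrow> 'a set" where
  "right_socle R = generate (add_monoid R) (\<Union>{I. minimal_right_ideal R I})"

definition essential_right :: "('a, 'b) ring_scheme \<Rightarrow> 'a set \<Rightarrow> 'a set \<Rightarrow> bool" where
  "essential_right R N M \<longleftrightarrow> right_ideal R N \<and> right_ideal R M \<and> N \<subseteq> M \<and>
     (\<forall>K. right_ideal R K \<and> K \<subseteq> M \<and> K \<noteq> {\<zero>\<^bsub>R\<^esub>} \<longrightarrow> N \<inter> K \<noteq> {\<zero>\<^bsub>R\<^esub>})"

definition maximal_right_ideal :: "('a, 'b) ring_scheme \<Rightarrow> 'a set \<Rightarrow> bool" where
  "maximal_right_ideal R M \<longleftrightarrow> right_ideal R M \<and> M \<noteq> carrier R \<and>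
     (\<forall>K. right_ideal R K \<and> M \<subseteq> K \<longrightarrow> K = M \<or> K = carrier R)"

text \<open>For the zero ring the radical is the whole ring, the empty intersection inside the carrier.\<close>

definition jacobson_radical :: "('a, 'b) ring_scheme \<Rightarrow> 'a set" where
  "jacobson_radical R = {x \<in> carrier R. \<forall>M. maximal_right_ideal R M \<longrightarrow> x \<in> M}"

section \<open>Semilocal and left perfect rings\<close>

text \<open>
  A ring is semisimple if its right regular module is a sum of simple submodules. Such a ring is
  automatically right artinian; that conjunct is kept because it is part of the name.
\<close>

definition semisimple_artinian :: "('a, 'b) ring_scheme \<Rightarrow> bool" where
  "semisimple_artinian R \<longleftrightarrow> right_socle R = carrier R \<and> right_artinian R"

definition semilocal :: "('a, 'b) ring_scheme \<Rightarrow> bool" where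
  "semilocal R \<longleftrightarrow> semisimple_artinian (R Quot jacobson_radical R)"

primrec seq_prod :: "('a, 'b) ring_scheme \<Rightarrow> (nat \<Rightarrow> 'a) \<Rightarrow> nat \<Rightarrow> 'a" where
  "seq_prod R a 0 = a 0"
| "seq_prod R a (Suc n) = seq_prod R a n \<otimes>\<^bsub>R\<^esub> a (Suc n)"

text \<open>
  Left T-nilpotency is about products $a_0 a_1 \cdots a_n$ whose new factors are appended on the
  right (the right-hand version would use $a_n \cdots a_1 a_0$).
\<close>

definition left_T_nilpotent :: "('a, 'b) ring_scheme \<Rightarrow> 'a set \<Rightarrow> bool" where
  "left_T_nilpotent R A \<longleftrightarrow>
     (\<forall>a. (\<forall>n. a n \<in> A) \<longrightarrow> (\<exists>n. seq_prod R a n = \<zero>\<^bsub>R\<^esub>))"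

text \<open>
  The standard ring-theoretic definition, as in Lam's \<^emph>\<open>A First Course in Noncommutative Rings\<close>.
  By Bass it is equivalent to every left module having a projective cover.
\<close>

definition left_perfect :: "('a, 'b) ring_scheme \<Rightarrow> bool" where
  "left_perfect R \<longleftrightarrow> semilocal R \<and> left_T_nilpotent R (jacobson_radical R)"

end

theory Submission
  imports Defs "HOL-Algebra.Ideal_Product"
begin

text \<open>
  For right ideals $A \subseteq B$ of a ring whose small left ideals are annihilators, the interval
  from the left annihilator of $B$ to that of $A$ is at most as long as $[A, B]$, because simple
  right ideals satisfy a double annihilator condition (mininjectivity). Hence a small dual ring of
  finite length on one side has finite length on the other, and comparing lengths after applying
  both annihilators shows that it is dual, that is, quasi-Frobenius. It remains to bound the length.

  A semilocal ring has finite length as soon as $J$ is nilpotent and the layers $J^k/J^{k+1}$ are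
  finitely generated. If $R$ is small dual, the chain condition on right annihilators is the ascending
  one on right ideals and the descending one on left ideals inside $J$, which yields both.
  An essential right socle makes $R$ semilocal, since $J$ is the left annihilator of the socle.
  For the chain condition on essential right ideals, the socle turns out to be essential and of
  finite length.

  In the perfect case the annihilators give a duality between right and left ideals
  above $S \cap J$ and below $J$, where $S$ is the socle. A semisimple module with infinitely
  many isomorphic summands admits no such duality, so $J$ is finitely generated modulo
  $J^2 + S \cap J$, hence finitely generated by the Nakayama lemma for T-nilpotent ideals, and
  therefore nilpotent by Koenig's lemma.
\<close>

text \<open>Small duality speaks only about ideals inside \<open>J\<close>. In a semilocal ring it
  also reaches the ideals above \<open>J\<close>, because these have complements modulo
  \<open>J\<close>. Nothing is known at the outset about ideals in other positions; the perfect case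
  therefore works with \<open>K <+> S\<close>, for \<open>K\<close> between
  \<open>S \<inter> J\<close> and \<open>J\<close>.

  The failure of duality is made concrete as follows. For independent isomorphic simple modules
  generated modulo \<open>B\<close> by a sequence \<open>x\<close>, let \<open>K\<close> consist of
  the combinations whose coefficients sum to zero. An element of \<open>J\<close> annihilating
  \<open>K\<close> takes the same value on all \<open>x i\<close>. It also annihilates a tail of the
  sequence, because the tails intersect in \<open>B\<close> and an ascending union of annihilators
  inside \<open>J\<close> is again an annihilator. So it annihilates \<open>x 0\<close>, and double
  annihilators force \<open>x 0\<close> into \<open>K\<close>.

  Left and right lengths are exchanged through annihilators throughout. This includes the symmetry
  of semilocality: the quotient by \<open>J\<close> has zero radical, hence is small dual for
  trivial reasons.\<close>

no_notation Sum_Type.Plus (infixr \<open><+>\<close> 65)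

section \<open>The opposite ring\<close>

text \<open>Only the multiplication field changes, so \<open>opp (opp R) = R\<close> holds as
  records and each right-sided lemma yields its left-sided twin by simplification.\<close>

definition opp :: "('a, 'b) ring_scheme \<Rightarrow> ('a, 'b) ring_scheme" where
  "opp R = R\<lparr>mult := \<lambda>x y. y \<otimes>\<^bsub>R\<^esub> x\<rparr>"

lemma opp_simps [simp]:
  "carrier (opp R) = carrier R" "x \<otimes>\<^bsub>opp R\<^esub> y = y \<otimes>\<^bsub>R\<^esub> x" "one (opp R) = one R"
  "zero (opp R) = zero R" "add (opp R) = add R" "opp (opp R) = R"
  by (simp_all add: opp_def)

lemma a_inv_opp [simp]: "a_inv (opp R) = a_inv R"
  by (simp add: a_inv_def)

lemma a_minus_opp [simp]: "a_minus (opp R) = a_minus R"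
  by (intro ext) (simp add: a_minus_def)

lemma set_add_opp [simp]: "set_add (opp R) = set_add R"
  by (intro ext) (simp add: set_add_def)

lemma ring_opp:
  assumes "ring R"
  shows "ring (opp R)"
proof -
  interpret ring R by fact
  have "abelian_group (opp R)"
  proof (rule abelian_groupI)
    show "\<exists>y\<in>carrier (opp R). y \<oplus>\<^bsub>opp R\<^esub> x = \<zero>\<^bsub>opp R\<^esub>" if "x \<in> carrier (opp R)" for x
      using that by (auto intro!: bexI[of _ "\<ominus>\<^bsub>R\<^esub> x"] simp: l_neg)
  qed (auto simp: a_ac)
  moreover have "Group.monoid (opp R)"
    by (rule monoidI) (auto simp: m_assoc)
  ultimately show ?thesis
    by (rule ringI) (auto simp: l_distr r_distr)
qed

lemma additive_subgroup_opp [simp]: "additive_subgroup I (opp R) = additive_subgroup I R"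
  by (simp add: additive_subgroup_def)

lemma ideal_notions_opp [simp]:
  "right_ideal (opp R) = left_ideal R" "left_ideal (opp R) = right_ideal R"
  "right_ann (opp R) = left_ann R" "left_ann (opp R) = right_ann R"
  "right_annihilator (opp R) = left_annihilator R" "left_annihilator (opp R) = right_annihilator R"
  "small_right_ideal (opp R) = small_left_ideal R" "small_left_ideal (opp R) = small_right_ideal R"
  by (intro ext; simp add: right_ideal_def left_ideal_def right_ann_def left_ann_def
        right_annihilator_def left_annihilator_def small_right_ideal_def small_left_ideal_def)+

lemma dual_opp [simp]:
  "right_small_dual (opp R) = left_small_dual R" "left_small_dual (opp R) = right_small_dual R"
  "right_dual (opp R) = left_dual R" "left_dual (opp R) = right_dual R"
  "small_dual (opp R) = small_dual R"
  by (auto simp: right_small_dual_def left_small_dual_def right_dual_def left_dual_def small_dual_def)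

section \<open>Right ideals\<close>

context ring
begin

lemma ring_opp' [simp, intro]: "ring (opp R)"
  by (rule ring_opp) (rule ring_axioms)

lemma add_minus_cancel:
  assumes "a \<in> carrier R" "b \<in> carrier R"
  shows "(a \<oplus> b) \<ominus> b = a" "(a \<oplus> b) \<ominus> a = b" "(a \<ominus> b) \<oplus> b = a" "(a \<ominus> b = \<zero>) = (a = b)"
proof -
  show "(a \<oplus> b) \<ominus> b = a" "(a \<ominus> b) \<oplus> b = a"
    using assms by (simp_all add: a_minus_def a_assoc r_neg l_neg)
  show "(a \<oplus> b) \<ominus> a = b"
    using assms by (simp add: a_minus_def a_comm[of a b] a_assoc r_neg)
  show "(a \<ominus> b = \<zero>) = (a = b)"
    using \<open>(a \<ominus> b) \<oplus> b = a\<close> assms by (auto simp: a_minus_def r_neg)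
qed

lemma add_subgroup_iff:
  "additive_subgroup I R \<longleftrightarrow> I \<subseteq> carrier R \<and> \<zero> \<in> I \<and>
     (\<forall>x\<in>I. \<forall>y\<in>I. x \<oplus> y \<in> I) \<and> (\<forall>x\<in>I. \<ominus> x \<in> I)"
proof
  assume *: "additive_subgroup I R"
  then interpret additive_subgroup I R .
  show "I \<subseteq> carrier R \<and> \<zero> \<in> I \<and> (\<forall>x\<in>I. \<forall>y\<in>I. x \<oplus> y \<in> I) \<and> (\<forall>x\<in>I. \<ominus> x \<in> I)"
    using a_subset zero_closed a_closed subgroup.m_inv_closed[OF a_subgroup]
    by (auto simp: a_inv_def)
next
  assume *: "I \<subseteq> carrier R \<and> \<zero> \<in> I \<and> (\<forall>x\<in>I. \<forall>y\<in>I. x \<oplus> y \<in> I) \<and> (\<forall>x\<in>I. \<ominus> x \<in> I)"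
  show "additive_subgroup I R"
    unfolding additive_subgroup_def
    by (rule add.subgroupI) (use * in \<open>auto simp: a_inv_def\<close>)
qed

text \<open>Negation is right multiplication by \<open>\<ominus> \<one>\<close>, so absorption on
  the right already makes \<open>I\<close> closed under it.\<close>

lemma right_ideal_iff:
  "right_ideal R I \<longleftrightarrow> I \<subseteq> carrier R \<and> \<zero> \<in> I \<and>
     (\<forall>x\<in>I. \<forall>y\<in>I. x \<oplus> y \<in> I) \<and> (\<forall>x\<in>I. \<forall>r\<in>carrier R. x \<otimes> r \<in> I)"
proof -
  have "\<ominus> x \<in> I" if "x \<in> I" "I \<subseteq> carrier R" "\<forall>x\<in>I. \<forall>r\<in>carrier R. x \<otimes> r \<in> I" for x
  proof -
    have "x \<otimes> (\<ominus> \<one>) \<in> I" using that by simp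
    moreover have "x \<otimes> (\<ominus> \<one>) = \<ominus> x" using that(1,2) by (simp add: r_minus subset_iff)
    ultimately show ?thesis by simp
  qed
  then show ?thesis
    unfolding right_ideal_def add_subgroup_iff by blast
qed

lemma right_idealI:
  assumes "I \<subseteq> carrier R" "\<zero> \<in> I" "\<And>x y. x \<in> I \<Longrightarrow> y \<in> I \<Longrightarrow> x \<oplus> y \<in> I"
    "\<And>x r. x \<in> I \<Longrightarrow> r \<in> carrier R \<Longrightarrow> x \<otimes> r \<in> I"
  shows "right_ideal R I"
  using assms by (auto simp: right_ideal_iff)

lemma right_idealD:
  assumes "right_ideal R I"
  shows "I \<subseteq> carrier R" "\<And>x. x \<in> I \<Longrightarrow> x \<in> carrier R" "\<zero> \<in> I"
    "\<And>x y. x \<in> I \<Longrightarrow> y \<in> I \<Longrightarrow> x \<oplus> y \<in> I"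
    "\<And>x r. x \<in> I \<Longrightarrow> r \<in> carrier R \<Longrightarrow> x \<otimes> r \<in> I"
    "\<And>x. x \<in> I \<Longrightarrow> \<ominus> x \<in> I"
    "\<And>x y. x \<in> I \<Longrightarrow> y \<in> I \<Longrightarrow> x \<ominus> y \<in> I"
  using assms unfolding right_ideal_def add_subgroup_iff by (auto simp: a_minus_def)

lemma left_ideal_iff:
  "left_ideal R I \<longleftrightarrow> I \<subseteq> carrier R \<and> \<zero> \<in> I \<and>
     (\<forall>x\<in>I. \<forall>y\<in>I. x \<oplus> y \<in> I) \<and> (\<forall>x\<in>I. \<forall>r\<in>carrier R. r \<otimes> x \<in> I)"
  using ring.right_ideal_iff[OF ring_opp'] by simp

lemma left_idealI:
  assumes "I \<subseteq> carrier R" "\<zero> \<in> I" "\<And>x y. x \<in> I \<Longrightarrow> y \<in> I \<Longrightarrow> x \<oplus> y \<in> I"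
    "\<And>x r. x \<in> I \<Longrightarrow> r \<in> carrier R \<Longrightarrow> r \<otimes> x \<in> I"
  shows "left_ideal R I"
  using assms by (auto simp: left_ideal_iff)

lemma left_idealD:
  assumes "left_ideal R I"
  shows "I \<subseteq> carrier R" "\<And>x. x \<in> I \<Longrightarrow> x \<in> carrier R" "\<zero> \<in> I"
    "\<And>x y. x \<in> I \<Longrightarrow> y \<in> I \<Longrightarrow> x \<oplus> y \<in> I"
    "\<And>x r. x \<in> I \<Longrightarrow> r \<in> carrier R \<Longrightarrow> r \<otimes> x \<in> I"
    "\<And>x. x \<in> I \<Longrightarrow> \<ominus> x \<in> I"
    "\<And>x y. x \<in> I \<Longrightarrow> y \<in> I \<Longrightarrow> x \<ominus> y \<in> I"
  using assms unfolding left_ideal_def add_subgroup_iff by (auto simp: a_minus_def)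

lemma left_ideal_carrier [simp, intro]: "left_ideal R (carrier R)"
  by (auto simp: left_ideal_iff)

lemma ideal_iff: "ideal I R \<longleftrightarrow> right_ideal R I \<and> left_ideal R I"
  unfolding right_ideal_def left_ideal_def ideal_def ideal_axioms_def
  using ring_axioms by (auto simp: additive_subgroup_def)

lemma right_ideal_carrier [simp, intro]: "right_ideal R (carrier R)"
  by (auto simp: right_ideal_iff)

lemma right_ideal_zero [simp, intro]: "right_ideal R {\<zero>}"
  by (auto simp: right_ideal_iff)

lemma right_ideal_Int: "right_ideal R I \<Longrightarrow> right_ideal R K \<Longrightarrow> right_ideal R (I \<inter> K)"
  by (auto simp: right_ideal_iff)

lemma mem_set_add: "x \<in> I <+> K \<longleftrightarrow> (\<exists>a\<in>I. \<exists>b\<in>K. x = a \<oplus> b)"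
  by (auto simp: set_add_def')

lemma right_ideal_set_add:
  assumes "right_ideal R I" "right_ideal R K"
  shows "right_ideal R (I <+> K)"
proof (rule right_idealI)
  note I = right_idealD[OF assms(1)] and K = right_idealD[OF assms(2)]
  show "I <+> K \<subseteq> carrier R" using I(2) K(2) by (auto simp: mem_set_add)
  show "\<zero> \<in> I <+> K" using I(3) K(3) by (force simp: mem_set_add)
  show "x \<oplus> y \<in> I <+> K" if xy: "x \<in> I <+> K" "y \<in> I <+> K" for x y :: 'a
  proof -
    obtain a b where ab: "a \<in> I" "b \<in> K" "x = a \<oplus> b" using xy by (auto simp: mem_set_add)
    obtain c d where cd: "c \<in> I" "d \<in> K" "y = c \<oplus> d" using xy by (auto simp: mem_set_add)
    have "x \<oplus> y = (a \<oplus> c) \<oplus> (b \<oplus> d)"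
      using ab cd I(2) K(2) by (simp add: a_ac)
    then show ?thesis using ab cd I(4) K(4) unfolding mem_set_add by blast
  qed
  show "x \<otimes> r \<in> I <+> K" if "x \<in> I <+> K" "r \<in> carrier R" for x r :: 'a
    using that I(2,5) K(2,5) by (force simp: mem_set_add l_distr)
qed

lemma set_add_upper1:
  assumes "right_ideal R I" "right_ideal R K"
  shows "I \<subseteq> I <+> K"
proof
  fix x assume "x \<in> I"
  then have "x = x \<oplus> \<zero>" using right_idealD(2)[OF assms(1)] by simp
  then show "x \<in> I <+> K" using \<open>x \<in> I\<close> right_idealD(3)[OF assms(2)] unfolding mem_set_add by blast
qed

lemma set_add_upper2:
  assumes "right_ideal R I" "right_ideal R K"
  shows "K \<subseteq> I <+> K"
proof
  fix x assume "x \<in> K"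
  then have "x = \<zero> \<oplus> x" using right_idealD(2)[OF assms(2)] by simp
  then show "x \<in> I <+> K" using \<open>x \<in> K\<close> right_idealD(3)[OF assms(1)] unfolding mem_set_add by blast
qed

lemma set_add_least:
  "right_ideal R L \<Longrightarrow> I \<subseteq> L \<Longrightarrow> K \<subseteq> L \<Longrightarrow> I <+> K \<subseteq> L"
  by (auto simp: mem_set_add right_ideal_iff subset_iff)

lemma set_add_mono: "I \<subseteq> I' \<Longrightarrow> K \<subseteq> K' \<Longrightarrow> I <+> K \<subseteq> (I' <+> K' :: 'a set)"
  unfolding subset_iff mem_set_add by blast

lemma modular_law:
  assumes "right_ideal R I" "right_ideal R K" "right_ideal R L" "I \<subseteq> L"
  shows "(I <+> K) \<inter> L = I <+> (K \<inter> L)"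
proof
  note I = right_idealD[OF assms(1)] and K = right_idealD[OF assms(2)] and L = right_idealD[OF assms(3)]
  show "(I <+> K) \<inter> L \<subseteq> I <+> (K \<inter> L)"
  proof
    fix x assume x: "x \<in> (I <+> K) \<inter> L"
    then obtain a b where ab: "a \<in> I" "b \<in> K" "x = a \<oplus> b" by (auto simp: mem_set_add)
    have "x \<ominus> a \<in> L" using L(7)[of x a] x ab assms(4) by blast
    moreover have "x \<ominus> a = b"
      using ab I(2)[of a] K(2)[of b] by (simp add: a_minus_def a_comm[of a b] a_assoc r_neg)
    ultimately show "x \<in> I <+> (K \<inter> L)" using ab by (auto simp: mem_set_add)
  qed
  show "I <+> (K \<inter> L) \<subseteq> (I <+> K) \<inter> L"
    using assms(4) L(4) unfolding subset_iff mem_set_add Int_iff by blast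
qed

text \<open>The right ideal generated by \<open>X\<close>. Unless \<open>X\<close> lies in the
  carrier the family is empty and its intersection is \<open>UNIV\<close>, hence the carrier
  hypotheses below.\<close>

definition rhull :: "'a set \<Rightarrow> 'a set" where
  "rhull X = \<Inter>{I. right_ideal R I \<and> X \<subseteq> I}"

lemma rhull_least: "right_ideal R I \<Longrightarrow> X \<subseteq> I \<Longrightarrow> rhull X \<subseteq> I"
  by (auto simp: rhull_def)

lemma rhull_upper: "X \<subseteq> rhull X"
  by (auto simp: rhull_def)

lemma rhull_mono: "X \<subseteq> Y \<Longrightarrow> rhull X \<subseteq> rhull Y"
  by (auto simp: rhull_def)

lemma right_ideal_rhull:
  assumes "X \<subseteq> carrier R"
  shows "right_ideal R (rhull X)"
proof (rule right_idealI)
  show "rhull X \<subseteq> carrier R" using assms by (intro rhull_least) auto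
qed (auto simp: rhull_def dest: right_idealD)

lemma rhull_ideal: "right_ideal R I \<Longrightarrow> rhull I = I"
  using rhull_least rhull_upper by blast

lemma right_ideal_add_mult:
  assumes "right_ideal R A" "x \<in> carrier R"
  shows "right_ideal R {a \<oplus> x \<otimes> r | a r. a \<in> A \<and> r \<in> carrier R}"
proof (rule right_idealI)
  note A = right_idealD[OF assms(1)]
  let ?I = "{a \<oplus> x \<otimes> r | a r. a \<in> A \<and> r \<in> carrier R}"
  show "?I \<subseteq> carrier R" using A(2) assms by auto
  have "\<zero> = \<zero> \<oplus> x \<otimes> \<zero>" using assms by simp
  then show "\<zero> \<in> ?I" using A(3) by blast
  show "u \<oplus> v \<in> ?I" if uv: "u \<in> ?I" "v \<in> ?I" for u v
  proof -
    obtain a r b s where *: "a \<in> A" "r \<in> carrier R" "u = a \<oplus> x \<otimes> r"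
        "b \<in> A" "s \<in> carrier R" "v = b \<oplus> x \<otimes> s"
      using uv by blast
    have "u \<oplus> v = (a \<oplus> b) \<oplus> x \<otimes> (r \<oplus> s)"
      using * A(2) assms by (simp add: r_distr a_ac)
    then show ?thesis using * A(4) by blast
  qed
  show "u \<otimes> s \<in> ?I" if u: "u \<in> ?I" and s: "s \<in> carrier R" for u s
  proof -
    obtain a r where *: "a \<in> A" "r \<in> carrier R" "u = a \<oplus> x \<otimes> r" using u by blast
    have "u \<otimes> s = a \<otimes> s \<oplus> x \<otimes> (r \<otimes> s)"
      using * A(2) assms s by (simp add: l_distr m_assoc)
    then show ?thesis using * A(5) s by blast
  qed
qed

lemma rhull_insert:
  assumes "right_ideal R A" "x \<in> carrier R"
  shows "rhull (insert x A) = {a \<oplus> x \<otimes> r | a r. a \<in> A \<and> r \<in> carrier R}" (is "_ = ?I")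
proof
  note A = right_idealD[OF assms(1)]
  have "x = \<zero> \<oplus> x \<otimes> \<one>" using assms by simp
  then have "x \<in> ?I" using A(3) by blast
  moreover have "a \<in> ?I" if "a \<in> A" for a
  proof -
    have "a = a \<oplus> x \<otimes> \<zero>" using assms that A(2) by simp
    then show ?thesis using that by blast
  qed
  ultimately show "rhull (insert x A) \<subseteq> ?I"
    by (intro rhull_least right_ideal_add_mult assms) auto
  have R: "right_ideal R (rhull (insert x A))" using A(1) assms by (intro right_ideal_rhull) auto
  show "?I \<subseteq> rhull (insert x A)"
    using rhull_upper[of "insert x A"] right_idealD(4,5)[OF R] by auto
qed

lemma rhull_union: 
  assumes "X \<subseteq> carrier R" "Y \<subseteq> carrier R"
  shows "rhull (rhull X \<union> Y) = rhull (X \<union> Y)"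
proof
  have "right_ideal R (rhull (X \<union> Y))" using assms by (intro right_ideal_rhull) auto
  then show "rhull (rhull X \<union> Y) \<subseteq> rhull (X \<union> Y)"
    using rhull_upper[of "X \<union> Y"] by (intro rhull_least) (auto intro: rhull_mono[THEN subsetD])
  show "rhull (X \<union> Y) \<subseteq> rhull (rhull X \<union> Y)"
    using rhull_upper[of X] by (intro rhull_mono) auto
qed

text \<open>Left multiplication by \<open>x\<close> is a homomorphism of right modules. Through this
  preimage, a claim about \<open>x \<otimes> r\<close> for all \<open>r\<close> of a right ideal has
  to be checked only on generators.\<close>

lemma right_ideal_left_mult_preimage:
  assumes "right_ideal R I" "x \<in> carrier R"
  shows "right_ideal R {r \<in> carrier R. x \<otimes> r \<in> I}"
  using assms right_idealD[OF assms(1)]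
  by (intro right_idealI) (auto simp: r_distr m_assoc[symmetric])

lemma right_ideal_image:
  assumes "right_ideal R I" "x \<in> carrier R"
  shows "right_ideal R ((\<otimes>) x ` I)"
proof (rule right_idealI)
  note I = right_idealD[OF assms(1)]
  show "(\<otimes>) x ` I \<subseteq> carrier R" using I(2) assms by auto
  show "\<zero> \<in> (\<otimes>) x ` I" using I(3) assms by (force intro: image_eqI[of _ _ \<zero>])
  show "u \<oplus> v \<in> (\<otimes>) x ` I" if "u \<in> (\<otimes>) x ` I" "v \<in> (\<otimes>) x ` I" for u v
    using that I(2,4) assms by (force simp: r_distr[symmetric])
  show "u \<otimes> v \<in> (\<otimes>) x ` I" if "u \<in> (\<otimes>) x ` I" "v \<in> carrier R" for u v
    using that I(2,5) assms by (force simp: m_assoc)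
qed

lemma left_ideal_left_ann: "X \<subseteq> carrier R \<Longrightarrow> left_ideal R (left_ann R X)"
  by (intro left_idealI) (auto simp: left_ann_def l_distr m_assoc subset_iff)

lemma right_ideal_left_ann: "left_ideal R X \<Longrightarrow> right_ideal R (left_ann R X)"
  by (intro right_idealI) (auto simp: left_ann_def l_distr m_assoc subset_iff left_ideal_iff)

lemma right_ideal_right_ann: "X \<subseteq> carrier R \<Longrightarrow> right_ideal R (right_ann R X)"
  using ring.left_ideal_left_ann[OF ring_opp', of X] by simp

lemma left_ann_antimono: "X \<subseteq> Y \<Longrightarrow> left_ann R Y \<subseteq> left_ann R X"
  by (auto simp: left_ann_def)

lemma right_ann_antimono: "X \<subseteq> Y \<Longrightarrow> right_ann R Y \<subseteq> right_ann R X"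
  by (auto simp: right_ann_def)

lemma subset_right_left_ann: "X \<subseteq> carrier R \<Longrightarrow> X \<subseteq> right_ann R (left_ann R X)"
  by (auto simp: left_ann_def right_ann_def)

lemma subset_left_right_ann: "X \<subseteq> carrier R \<Longrightarrow> X \<subseteq> left_ann R (right_ann R X)"
  by (auto simp: left_ann_def right_ann_def)

lemma left_ann_subset: "left_ann R X \<subseteq> carrier R"
  by (auto simp: left_ann_def)

lemma right_ann_subset: "right_ann R X \<subseteq> carrier R"
  by (auto simp: right_ann_def)

lemma right_annihilator_iff:
  "X \<subseteq> carrier R \<Longrightarrow> right_annihilator R X \<longleftrightarrow> right_ann R (left_ann R X) = X"
  unfolding right_annihilator_def
  using subset_right_left_ann subset_left_right_ann right_ann_antimono left_ann_subset
  by (metis subset_antisym)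

lemma left_annihilator_iff:
  "X \<subseteq> carrier R \<Longrightarrow> left_annihilator R X \<longleftrightarrow> left_ann R (right_ann R X) = X"
  using ring.right_annihilator_iff[OF ring_opp', of X] by simp

lemma right_left_right_ann: "X \<subseteq> carrier R \<Longrightarrow> right_ann R (left_ann R (right_ann R X)) = right_ann R X"
  using subset_right_left_ann[OF right_ann_subset] subset_left_right_ann right_ann_antimono
  by (metis subset_antisym)

lemma left_ann_carrier: "left_ann R (carrier R) = {\<zero>}"
proof -
  have "r = \<zero>" if "r \<in> carrier R" "\<forall>x\<in>carrier R. r \<otimes> x = \<zero>" for r
    using that r_one[of r] one_closed by metis
  then show ?thesis by (auto simp: left_ann_def)
qed

lemma left_ann_zero: "left_ann R {\<zero>} = carrier R"
  by (auto simp: left_ann_def)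

lemma right_ann_carrier: "right_ann R (carrier R) = {\<zero>}"
  using ring.left_ann_carrier[OF ring_opp'] by simp

lemma left_ann_Un: "left_ann R (X \<union> Y) = left_ann R X \<inter> left_ann R Y"
  by (auto simp: left_ann_def)

lemma left_ann_set_add:
  assumes "right_ideal R X" "right_ideal R Y"
  shows "left_ann R (X <+> Y) = left_ann R X \<inter> left_ann R Y"
proof
  show "left_ann R (X <+> Y) \<subseteq> left_ann R X \<inter> left_ann R Y"
    using set_add_upper1[OF assms] set_add_upper2[OF assms] left_ann_antimono by blast
  show "left_ann R X \<inter> left_ann R Y \<subseteq> left_ann R (X <+> Y)"
    using assms[THEN right_idealD(1)] by (auto simp: left_ann_def mem_set_add r_distr subset_iff)
qed

lemma right_ann_set_add:
  assumes "left_ideal R X" "left_ideal R Y"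
  shows "right_ann R (X <+> Y) = right_ann R X \<inter> right_ann R Y"
  using ring.left_ann_set_add[OF ring_opp', of X Y] assms by simp

end

section \<open>Maximal and minimal condition\<close>

text \<open>Otherwise dependent choice produces a strictly ascending chain. The separate predicate
  \<open>Q\<close> lets a chain condition on all ideals of an interval serve a smaller family, such
  as those of finite length.\<close>

lemma acc_on_maximal:
  assumes acc: "acc_on P" and Q: "Q X" and QP: "\<And>X. Q X \<Longrightarrow> P X"
  shows "\<exists>Y. Q Y \<and> (\<forall>Z. Q Z \<longrightarrow> Y \<subseteq> Z \<longrightarrow> Z = Y)"
proof (rule ccontr)
    assume "\<not> ?thesis"
    then have step: "\<exists>Z. Q Z \<and> Y \<subset> Z" if "Q Y" for Y using that by blast
    obtain C where C: "\<And>n. Q (C n)" "\<And>n. C n \<subset> C (Suc n)"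
      using dependent_nat_choice[of "\<lambda>_. Q" "\<lambda>_ Y Z. Y \<subset> Z"] Q step by metis
    obtain N where "\<forall>n\<ge>N. C n = C N"
      using acc C QP unfolding acc_on_def by (metis psubset_imp_subset)
    then show False using C(2)[of N] by (metis le_Suc_eq order_refl psubset_eq)
qed

lemma dcc_on_minimal:
  assumes dcc: "dcc_on P" and Q: "Q X" and QP: "\<And>X. Q X \<Longrightarrow> P X"
  shows "\<exists>Y. Q Y \<and> (\<forall>Z. Q Z \<longrightarrow> Z \<subseteq> Y \<longrightarrow> Z = Y)"
proof (rule ccontr)
    assume "\<not> ?thesis"
    then have step: "\<exists>Z. Q Z \<and> Z \<subset> Y" if "Q Y" for Y using that by blast
    obtain C where C: "\<And>n. Q (C n)" "\<And>n. C (Suc n) \<subset> C n"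
      using dependent_nat_choice[of "\<lambda>_. Q" "\<lambda>_ Y Z. Z \<subset> Y"] Q step by metis
    obtain N where "\<forall>n\<ge>N. C n = C N"
      using dcc C QP unfolding dcc_on_def by (metis psubset_imp_subset)
    then show False using C(2)[of N] by (metis le_Suc_eq order_refl psubset_eq)
qed

lemma acc_on_mono: "acc_on P \<Longrightarrow> (\<And>X. Q X \<Longrightarrow> P X) \<Longrightarrow> acc_on Q"
  unfolding acc_on_def by blast

lemma dcc_on_mono: "dcc_on P \<Longrightarrow> (\<And>X. Q X \<Longrightarrow> P X) \<Longrightarrow> dcc_on Q"
  unfolding dcc_on_def by blast

text \<open>In applications \<open>f\<close> is an annihilator map and \<open>g\<close> the one on
  the other side, so that the last premise is a double annihilator condition.\<close>

lemma acc_on_antitone: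
  assumes "dcc_on P" "\<And>X. Q X \<Longrightarrow> P (f X)" "\<And>X Y. Q X \<Longrightarrow> Q Y \<Longrightarrow> X \<subseteq> Y \<Longrightarrow> f Y \<subseteq> f X"
    "\<And>X. Q X \<Longrightarrow> g (f X) = X"
  shows "acc_on Q"
  unfolding acc_on_def
proof (intro allI impI)
  fix C assume C: "(\<forall>n. Q (C n)) \<and> (\<forall>n. C n \<subseteq> C (Suc n))"
  then obtain N where "\<forall>n\<ge>N. f (C n) = f (C N)"
    using assms(1)[unfolded dcc_on_def, rule_format, of "\<lambda>n. f (C n)"] assms(2,3) by blast
  then show "\<exists>N. \<forall>n\<ge>N. C n = C N" using assms(4) C by metis
qed

lemma dcc_on_antitone:
  assumes "acc_on P" "\<And>X. Q X \<Longrightarrow> P (f X)" "\<And>X Y. Q X \<Longrightarrow> Q Y \<Longrightarrow> X \<subseteq> Y \<Longrightarrow> f Y \<subseteq> f X"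
    "\<And>X. Q X \<Longrightarrow> g (f X) = X"
  shows "dcc_on Q"
  unfolding dcc_on_def
proof (intro allI impI)
  fix C assume C: "(\<forall>n. Q (C n)) \<and> (\<forall>n. C (Suc n) \<subseteq> C n)"
  then obtain N where "\<forall>n\<ge>N. f (C n) = f (C N)"
    using assms(1)[unfolded acc_on_def, rule_format, of "\<lambda>n. f (C n)"] assms(2,3) by blast
  then show "\<exists>N. \<forall>n\<ge>N. C n = C N" using assms(4) C by metis
qed

section \<open>Finite length\<close>

text \<open>
  A strictly monotone rank function with values at most $n$ replaces a composition series:
  it exists exactly if the interval $[A, B]$ contains no strict chain with more than $n$ steps.
\<close>

definition rank_fun :: "('a set \<Rightarrow> bool) \<Rightarrow> 'a set \<Rightarrow> 'a set \<Rightarrow> nat \<Rightarrow> ('a set \<Rightarrow> nat) \<Rightarrow> bool" where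
  "rank_fun P A B n f \<longleftrightarrow> (\<forall>D. P D \<and> A \<subseteq> D \<and> D \<subseteq> B \<longrightarrow> f D \<le> n) \<and>
     (\<forall>D E. P D \<and> P E \<and> A \<subseteq> D \<and> D \<subset> E \<and> E \<subseteq> B \<longrightarrow> f D < f E)"

definition len_le :: "('a set \<Rightarrow> bool) \<Rightarrow> 'a set \<Rightarrow> 'a set \<Rightarrow> nat \<Rightarrow> bool" where
  "len_le P A B n \<longleftrightarrow> (\<exists>f. rank_fun P A B n f)"

lemma rank_funD:
  assumes "rank_fun P A B n f"
  shows "P D \<Longrightarrow> A \<subseteq> D \<Longrightarrow> D \<subseteq> B \<Longrightarrow> f D \<le> n"
    "P D \<Longrightarrow> P E \<Longrightarrow> A \<subseteq> D \<Longrightarrow> D \<subset> E \<Longrightarrow> E \<subseteq> B \<Longrightarrow> f D < f E"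
  using assms unfolding rank_fun_def by blast+

lemma len_leI:
  assumes "\<And>D. P D \<Longrightarrow> A \<subseteq> D \<Longrightarrow> D \<subseteq> B \<Longrightarrow> f D \<le> n"
    "\<And>D E. P D \<Longrightarrow> P E \<Longrightarrow> A \<subseteq> D \<Longrightarrow> D \<subset> E \<Longrightarrow> E \<subseteq> B \<Longrightarrow> f D < f E"
  shows "len_le P A B n"
  unfolding len_le_def rank_fun_def using assms by (intro exI[of _ f]) blast

lemma len_le_subinterval: "len_le P A B n \<Longrightarrow> A \<subseteq> A' \<Longrightarrow> B' \<subseteq> B \<Longrightarrow> len_le P A' B' n"
  unfolding len_le_def rank_fun_def by (meson order_trans)

lemma len_le_trivial: "B \<subseteq> A \<Longrightarrow> len_le P A B n"
  by (rule len_leI[where f = "\<lambda>_. 0"]) auto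

lemma len_le_cover:
  assumes "\<And>D. P D \<Longrightarrow> A \<subseteq> D \<Longrightarrow> D \<subseteq> B \<Longrightarrow> D = A \<or> D = B"
  shows "len_le P A B 1"
proof (rule len_leI[where f = "\<lambda>D. if D = A then 0 else 1"])
  fix D E assume "P D" "P E" "A \<subseteq> D" "D \<subset> E" "E \<subseteq> B"
  moreover from this have "D = A \<or> D = B" using assms by blast
  ultimately show "(if D = A then 0 else 1) < (if E = A then 0 else 1 :: nat)" by auto
qed auto

lemma len_le_embed:
  assumes "len_le P' A' B' n"
    and "\<And>D. P D \<Longrightarrow> A \<subseteq> D \<Longrightarrow> D \<subseteq> B \<Longrightarrow> P' (g D) \<and> A' \<subseteq> g D \<and> g D \<subseteq> B'"
    and "\<And>D E. P D \<Longrightarrow> P E \<Longrightarrow> A \<subseteq> D \<Longrightarrow> D \<subset> E \<Longrightarrow> E \<subseteq> B \<Longrightarrow> g D \<subset> g E"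
  shows "len_le P A B n"
proof -
  obtain f where "rank_fun P' A' B' n f"
    using assms(1) by (auto simp: len_le_def)
  note f = rank_funD[OF this]
  show ?thesis
  proof (rule len_leI[where f = "\<lambda>D. f (g D)"])
    show "f (g D) \<le> n" if "P D" "A \<subseteq> D" "D \<subseteq> B" for D
      using f(1) assms(2)[OF that] by blast
    show "f (g D) < f (g E)" if *: "P D" "P E" "A \<subseteq> D" "D \<subset> E" "E \<subseteq> B" for D E
    proof -
      have "D \<subseteq> B" "A \<subseteq> E" using * by auto
      then show ?thesis using f(2) assms(2)[of D] assms(2)[of E] assms(3)[OF *] * by blast
    qed
  qed
qed

lemma len_le_acc:
  assumes "len_le P A B n"
  shows "acc_on (\<lambda>D. P D \<and> A \<subseteq> D \<and> D \<subseteq> B)"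
  unfolding acc_on_def
proof (intro allI impI)
  fix C assume C: "(\<forall>n. P (C n) \<and> A \<subseteq> C n \<and> C n \<subseteq> B) \<and> (\<forall>n. C n \<subseteq> C (Suc n))"
  obtain f where "rank_fun P A B n f"
    using assms by (auto simp: len_le_def)
  note f = rank_funD[OF this]
  have "\<exists>N. \<forall>m. f (C m) \<le> f (C N)"
    using ex_has_greatest_nat[of "\<lambda>_. True" 0 "\<lambda>m. f (C m)" "Suc n"] f(1) C by (simp add: less_Suc_eq_le)
  then obtain N where N: "\<And>m. f (C m) \<le> f (C N)" by blast
  have "C m = C N" if "m \<ge> N" for m
  proof (rule ccontr)
    assume "C m \<noteq> C N"
    moreover have "C N \<subseteq> C m" using lift_Suc_mono_le[of C] C that by blast
    ultimately have "f (C N) < f (C m)" using f(2) C by blast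
    then show False using N[of m] by simp
  qed
  then show "\<exists>N. \<forall>n\<ge>N. C n = C N" by blast
qed

lemma len_le_dcc:
  assumes "len_le P A B n"
  shows "dcc_on (\<lambda>D. P D \<and> A \<subseteq> D \<and> D \<subseteq> B)"
  unfolding dcc_on_def
proof (intro allI impI)
  fix C assume C: "(\<forall>n. P (C n) \<and> A \<subseteq> C n \<and> C n \<subseteq> B) \<and> (\<forall>n. C (Suc n) \<subseteq> C n)"
  obtain f where "rank_fun P A B n f"
    using assms by (auto simp: len_le_def)
  note f = rank_funD[OF this]
  obtain N where N: "\<And>m. f (C N) \<le> f (C m)"
    using ex_has_least_nat[of "\<lambda>_. True" _ "\<lambda>m. f (C m)"] by blast
  have "C m = C N" if "m \<ge> N" for m
  proof (rule ccontr)
    assume "C m \<noteq> C N"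
    moreover have "C m \<subseteq> C N" using lift_Suc_antimono_le[of C] C that by blast
    ultimately have "f (C m) < f (C N)" using f(2) C by blast
    then show False using N[of m] by simp
  qed
  then show "\<exists>N. \<forall>n\<ge>N. C n = C N" by blast
qed

context ring
begin

text \<open>An ideal is ranked by its trace on \<open>B\<close> plus its sum with \<open>B\<close>.
  If neither grew from \<open>D\<close> to \<open>E\<close>, the modular law would give
  \<open>D = E\<close>.\<close>

lemma len_le_add:
  assumes B: "right_ideal R B" and AB: "A \<subseteq> B" "B \<subseteq> C"
    and mn: "len_le (right_ideal R) A B m" "len_le (right_ideal R) B C n"
    and C: "right_ideal R C"
  shows "len_le (right_ideal R) A C (m + n)"
proof -
  obtain f where "rank_fun (right_ideal R) A B m f"
    using mn(1) by (auto simp: len_le_def)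
  note f = rank_funD[OF this]
  obtain g where "rank_fun (right_ideal R) B C n g"
    using mn(2) by (auto simp: len_le_def)
  note g = rank_funD[OF this]
  have fle: "f (D \<inter> B) \<le> m" if "right_ideal R D" "A \<subseteq> D" for D
    using f(1)[of "D \<inter> B"] that AB B right_ideal_Int by blast
  have add: "right_ideal R (D <+> B)" "B \<subseteq> D <+> B" "D <+> B \<subseteq> C" if "right_ideal R D" "D \<subseteq> C" for D :: "'a set"
    using that AB B right_ideal_set_add set_add_upper2 set_add_least[OF C] by auto
  show ?thesis
  proof (rule len_leI[where f = "\<lambda>D. f (D \<inter> B) + g (D <+> B)"])
    show "f (D \<inter> B) + g (D <+> B) \<le> m + n" if "right_ideal R D" "A \<subseteq> D" "D \<subseteq> C" for D
      using fle[of D] g(1)[OF add[of D]] that by simp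
    show "f (D \<inter> B) + g (D <+> B) < f (E \<inter> B) + g (E <+> B)"
      if D: "right_ideal R D" and E: "right_ideal R E" and DE: "A \<subseteq> D" "D \<subset> E" "E \<subseteq> C" for D E
    proof -
      have sub: "D \<inter> B \<subseteq> E \<inter> B" "D <+> B \<subseteq> E <+> B" using DE set_add_mono[of D E B B] by auto
      have DC: "D \<subseteq> C" using DE by auto
      have "D \<inter> B \<noteq> E \<inter> B \<or> D <+> B \<noteq> E <+> B"
      proof (rule ccontr)
        assume "\<not> ?thesis"
        then have eq: "D \<inter> B = E \<inter> B" "D <+> B = E <+> B" by auto
        have "E = (E <+> B) \<inter> E" using set_add_upper1[OF E B] by auto
        also have "\<dots> = D <+> (B \<inter> E)" using eq(2) modular_law[OF D B E] DE by auto
        also have "\<dots> \<subseteq> D" using eq(1) by (intro set_add_least D) auto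
        finally show False using DE by auto
      qed
      moreover have "f (D \<inter> B) < f (E \<inter> B)" if "D \<inter> B \<noteq> E \<inter> B"
        using f(2)[of "D \<inter> B" "E \<inter> B"] D E B DE AB sub that right_ideal_Int by blast
      moreover have "g (D <+> B) < g (E <+> B)" if "D <+> B \<noteq> E <+> B"
        using g(2)[OF add(1)[OF D DC] add(1)[OF E DE(3)] add(2)[OF D DC] _ add(3)[OF E DE(3)]] sub that by blast
      ultimately show ?thesis
        using sub by (metis add_less_le_mono add_le_less_mono less_imp_le order_refl)
    qed
  qed
qed

text \<open>Adding \<open>M\<close> is strictly monotone on this interval: by the modular law
  \<open>D\<close> is recovered as the trace of \<open>D <+> M\<close> on \<open>K\<close>.\<close>

lemma len_le_second_iso:
  assumes "right_ideal R M" "right_ideal R K" "len_le (right_ideal R) M (K <+> M) n"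
  shows "len_le (right_ideal R) (K \<inter> M) K n"
proof (rule len_le_embed[OF assms(3), where g = "\<lambda>D. D <+> M :: 'a set"])
  fix D assume D: "right_ideal R D" "K \<inter> M \<subseteq> D" "D \<subseteq> K"
  show "right_ideal R (D <+> M) \<and> M \<subseteq> D <+> M \<and> D <+> M \<subseteq> K <+> M"
    using D assms right_ideal_set_add set_add_upper2 set_add_mono[of D K M M] by auto
next
  fix D E assume D: "right_ideal R D" "right_ideal R E" "K \<inter> M \<subseteq> D" "D \<subset> E" "E \<subseteq> K"
  have "D <+> M \<noteq> E <+> M"
  proof
    assume eq: "D <+> M = E <+> M"
    have "E = (E <+> M) \<inter> E" using set_add_upper1[OF D(2) assms(1)] by auto
    also have "\<dots> = D <+> (M \<inter> E)" using eq modular_law[OF D(1) assms(1) D(2)] D by auto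
    also have "\<dots> \<subseteq> D" using D by (intro set_add_least) auto
    finally show False using D by auto
  qed
  then show "D <+> M \<subset> E <+> M" using set_add_mono[of D E M M] D by auto
qed

lemma len_le_Int:
  assumes "right_ideal R M" "right_ideal R K" "len_le (right_ideal R) M (carrier R) m"
    "len_le (right_ideal R) K (carrier R) n"
  shows "len_le (right_ideal R) (K \<inter> M) (carrier R) (m + n)"
proof (rule len_le_add[OF assms(2) _ _ _ assms(4)])
  have "K <+> M \<subseteq> carrier R"
    using right_ideal_set_add[OF assms(2,1)] right_idealD by auto
  then show "len_le (right_ideal R) (K \<inter> M) K m"
    using assms by (intro len_le_second_iso len_le_subinterval[OF assms(3)]) auto
qed (use assms right_idealD in auto)

section \<open>Maximal right ideals and the Jacobson radical\<close>

lemma maximal_right_idealD: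
  assumes "maximal_right_ideal R M"
  shows "right_ideal R M" "M \<noteq> carrier R" "\<one> \<notin> M"
    "\<And>K. right_ideal R K \<Longrightarrow> \<not> K \<subseteq> M \<Longrightarrow> K <+> M = carrier R"
proof -
  show M: "right_ideal R M" "M \<noteq> carrier R" using assms by (auto simp: maximal_right_ideal_def)
  show "\<one> \<notin> M" using right_idealD(1,5)[OF M(1)] M(2) by fastforce
  fix K assume K: "right_ideal R K" "\<not> K \<subseteq> M"
  show "K <+> M = carrier R"
    using assms K set_add_upper1[OF K(1) M(1)] set_add_upper2[OF K(1) M(1)]
      right_ideal_set_add[OF K(1) M(1)]
    unfolding maximal_right_ideal_def by blast
qed

text \<open>Properness in the form \<open>\<one> \<notin> I\<close> passes to unions of chains,
  which is what Zorn's lemma needs.\<close>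

lemma exists_maximal_right_ideal:
  assumes I: "right_ideal R I" "\<one> \<notin> I"
  obtains M where "maximal_right_ideal R M" "I \<subseteq> M"
proof -
  let ?A = "{K. right_ideal R K \<and> I \<subseteq> K \<and> \<one> \<notin> K}"
  have "\<exists>M\<in>?A. \<forall>K\<in>?A. M \<subseteq> K \<longrightarrow> K = M"
  proof (rule subset_Zorn_nonempty)
    show "?A \<noteq> {}" using I by auto
    fix C assume C: "C \<noteq> {}" "subset.chain ?A C"
    have sub: "K \<in> C \<Longrightarrow> right_ideal R K \<and> I \<subseteq> K \<and> \<one> \<notin> K" for K
      using C unfolding subset_chain_def by auto
    have "right_ideal R (\<Union>C)"
    proof (rule right_idealI)
      show "\<Union>C \<subseteq> carrier R" using sub right_idealD by blast
      show "\<zero> \<in> \<Union>C" using C sub right_idealD by blast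
      show "x \<oplus> y \<in> \<Union>C" if xy: "x \<in> \<Union>C" "y \<in> \<Union>C" for x y
      proof -
        obtain K L where "K \<in> C" "L \<in> C" "x \<in> K" "y \<in> L" using xy by blast
        moreover from this have "K \<subseteq> L \<or> L \<subseteq> K" using C unfolding subset_chain_def by auto
        ultimately obtain N where "N \<in> C" "x \<in> N" "y \<in> N" by blast
        then show ?thesis using sub right_idealD(4) by blast
      qed
      show "x \<otimes> r \<in> \<Union>C" if "x \<in> \<Union>C" "r \<in> carrier R" for x r
        using that sub right_idealD(5) by blast
    qed
    then show "\<Union>C \<in> ?A" using sub C by blast
  qed
  then obtain M where MA: "M \<in> ?A" and Mmax: "\<forall>K\<in>?A. M \<subseteq> K \<longrightarrow> K = M" by (elim bexE)
  then have M: "right_ideal R M" "I \<subseteq> M" "\<one> \<notin> M" by auto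
  have "K = M \<or> K = carrier R" if K: "right_ideal R K" "M \<subseteq> K" for K
  proof (cases "\<one> \<in> K")
    case True
    then have "carrier R \<subseteq> K" using right_idealD(5)[OF K(1), of \<one>] by auto
    then show ?thesis using right_idealD(1)[OF K(1)] by auto
  next
    case False
    then have "K \<in> ?A" using M K by auto
    then show ?thesis using Mmax K(2) by blast
  qed
  moreover have "M \<noteq> carrier R" using M(3) by auto
  ultimately have "maximal_right_ideal R M" using M by (auto simp: maximal_right_ideal_def)
  then show thesis using that M by blast
qed

abbreviation J :: "'a set" where "J \<equiv> jacobson_radical R"

lemma right_ideal_J: "right_ideal R J"
proof (rule right_idealI)
  show "J \<subseteq> carrier R" by (auto simp: jacobson_radical_def)
qed (auto simp: jacobson_radical_def dest: maximal_right_idealD(1) intro: right_idealD)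

lemma J_subset_maximal: "maximal_right_ideal R M \<Longrightarrow> J \<subseteq> M"
  by (auto simp: jacobson_radical_def)

text \<open>A right inverse exists because \<open>\<one> \<ominus> y\<close> lies in no maximal
  right ideal. The right inverse \<open>z\<close> is itself one minus a radical element, so it is
  right invertible too, and its right inverse can only be \<open>\<one> \<ominus> x\<close>.\<close>

lemma J_one_minus_inverse:
  assumes x: "x \<in> J"
  obtains z where "z \<in> carrier R" "(\<one> \<ominus> x) \<otimes> z = \<one>" "z \<otimes> (\<one> \<ominus> x) = \<one>"
proof -
  have right_inv: "\<exists>z\<in>carrier R. (\<one> \<ominus> y) \<otimes> z = \<one>" if y: "y \<in> J" for y
  proof (rule ccontr)
    assume *: "\<not> ?thesis"
    have yc: "y \<in> carrier R" using y by (auto simp: jacobson_radical_def)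
    let ?I = "(\<otimes>) (\<one> \<ominus> y) ` carrier R"
    have I: "right_ideal R ?I" using yc by (intro right_ideal_image) auto
    have "\<one> \<notin> ?I" using * by auto
    then obtain M where M: "maximal_right_ideal R M" "?I \<subseteq> M"
      using exists_maximal_right_ideal I by blast
    note MD = right_idealD[OF maximal_right_idealD(1)[OF M(1)]]
    have "(\<one> \<ominus> y) \<otimes> \<one> \<in> M" using M(2) by blast
    then have "(\<one> \<ominus> y) \<oplus> y \<in> M" using MD(4) J_subset_maximal[OF M(1)] y yc by auto
    then have "\<one> \<in> M" using yc by (simp add: a_minus_def a_assoc l_neg)
    then show False using maximal_right_idealD(3)[OF M(1)] by blast
  qed
  have xc: "x \<in> carrier R" using x by (auto simp: jacobson_radical_def)
  obtain z where z: "z \<in> carrier R" "(\<one> \<ominus> x) \<otimes> z = \<one>" using right_inv x by blast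
  have "\<ominus> (x \<otimes> z) \<in> J" using right_idealD(5,6)[OF right_ideal_J] x z by blast
  then obtain w where w: "w \<in> carrier R" "(\<one> \<ominus> (\<ominus> (x \<otimes> z))) \<otimes> w = \<one>" using right_inv by blast
  have "z = \<one> \<oplus> x \<otimes> z"
  proof -
    have "z \<ominus> x \<otimes> z = \<one>" using z xc by (simp add: a_minus_def l_distr l_minus)
    then show ?thesis using z xc by (metis a_minus_def a_assoc a_inv_closed l_neg m_closed r_zero)
  qed
  then have zw: "z \<otimes> w = \<one>" using w xc z by (simp add: a_minus_def)
  have "w = ((\<one> \<ominus> x) \<otimes> z) \<otimes> w" using z w by simp
  also have "\<dots> = (\<one> \<ominus> x) \<otimes> (z \<otimes> w)" using z(1) w(1) xc by (intro m_assoc) auto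
  also have "\<dots> = \<one> \<ominus> x" using zw xc by simp
  finally show thesis using that[of z] z zw by simp
qed

text \<open>For \<open>s\<close> outside a maximal \<open>M\<close>, the elements \<open>r\<close>
  with \<open>s \<otimes> r \<in> M\<close> form another maximal right ideal, which contains
  \<open>x\<close>.\<close>

lemma J_left_mult:
  assumes x: "x \<in> J" and s: "s \<in> carrier R"
  shows "s \<otimes> x \<in> J"
proof -
  have xc: "x \<in> carrier R" using x by (auto simp: jacobson_radical_def)
  have "s \<otimes> x \<in> M" if M: "maximal_right_ideal R M" for M
  proof (cases "s \<in> M")
    case True
    then show ?thesis using right_idealD(5)[OF maximal_right_idealD(1)[OF M]] xc by blast
  next
    case False
    note MD = right_idealD[OF maximal_right_idealD(1)[OF M]]
    let ?N = "{r \<in> carrier R. s \<otimes> r \<in> M}"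
    have N: "right_ideal R ?N"
      using right_ideal_left_mult_preimage[OF maximal_right_idealD(1)[OF M] s] .
    have "K = carrier R" if K: "right_ideal R K" "?N \<subset> K" for K
    proof -
      note KD = right_idealD[OF K(1)]
      have "\<not> (\<otimes>) s ` K \<subseteq> M" using K KD(1) by auto
      then have "((\<otimes>) s ` K) <+> M = carrier R"
        by (intro maximal_right_idealD(4)[OF M] right_ideal_image K(1) s)
      then obtain k m where km: "k \<in> K" "m \<in> M" "s = s \<otimes> k \<oplus> m"
        using s unfolding set_eq_iff mem_set_add by blast
      have "s \<otimes> (\<one> \<ominus> k) = m"
      proof -
        have "s \<otimes> (\<one> \<ominus> k) = s \<ominus> s \<otimes> k" using s km KD(2) by (simp add: a_minus_def r_distr r_minus)
        also have "\<dots> = (s \<otimes> k \<oplus> m) \<ominus> s \<otimes> k" using km(3) by simp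
        also have "\<dots> = m" using s km(1,2) KD(2) MD(2) by (simp add: a_minus_def a_comm[of "s \<otimes> k" m] a_assoc r_neg)
        finally show ?thesis .
      qed
      then have "\<one> \<ominus> k \<in> ?N" using km KD(2) by simp
      then have "\<one> \<ominus> k \<in> K" using K(2) by blast
      then have "(\<one> \<ominus> k) \<oplus> k \<in> K" using KD(4) km by blast
      then have "\<one> \<in> K" using KD(2)[OF km(1)] by (simp add: a_minus_def a_assoc l_neg)
      then show ?thesis using KD(1,5) by fastforce
    qed
    moreover have "\<one> \<notin> ?N" using False s by auto
    ultimately have "maximal_right_ideal R ?N"
      unfolding maximal_right_ideal_def using N by auto
    then show ?thesis using J_subset_maximal x by blast
  qed
  then show ?thesis using xc s unfolding jacobson_radical_def by simp
qed

lemma J_closed [simp]: "x \<in> J \<Longrightarrow> x \<in> carrier R"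
  by (auto simp: jacobson_radical_def)

lemma J_subset_carrier: "J \<subseteq> carrier R"
  by auto

lemma left_ideal_J: "left_ideal R J"
  using right_idealD[OF right_ideal_J] J_left_mult by (intro left_idealI) auto

lemma ideal_J: "ideal J R"
  using right_ideal_J left_ideal_J by (simp add: ideal_iff)

text \<open>If \<open>x\<close> avoids a maximal left ideal, then
  \<open>\<one> = r \<otimes> x \<oplus> m\<close> with \<open>m\<close> in it; but
  \<open>m = \<one> \<ominus> r \<otimes> x\<close> is invertible. Applied to both rings, this makes
  the radical left-right symmetric.\<close>

lemma J_subset_J_opp: "J \<subseteq> jacobson_radical (opp R)"
proof
  fix x assume x: "x \<in> J"
  interpret O: ring "opp R" by simp
  have "x \<in> M" if M: "maximal_right_ideal (opp R) M" for M
  proof (rule ccontr)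
    assume "x \<notin> M"
    let ?L = "(\<otimes>\<^bsub>opp R\<^esub>) x ` carrier (opp R)"
    have L: "right_ideal (opp R) ?L" using x by (intro O.right_ideal_image) auto
    have "x \<otimes>\<^bsub>opp R\<^esub> \<one> \<in> ?L" by (intro imageI) simp
    then have "x \<in> ?L" using x by simp
    then have "?L <+>\<^bsub>opp R\<^esub> M = carrier (opp R)"
      using \<open>x \<notin> M\<close> by (intro O.maximal_right_idealD(4)[OF M] L) auto
    then have "\<one> \<in> ?L <+> M" by simp
    then obtain r m where rm: "r \<in> carrier R" "m \<in> M" "\<one> = r \<otimes> x \<oplus> m"
      unfolding mem_set_add image_def opp_simps by blast
    have mc: "m \<in> carrier R" using O.right_idealD(2)[OF O.maximal_right_idealD(1)[OF M]] rm by auto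
    have "r \<otimes> x \<in> J" using J_left_mult x rm by blast
    then obtain z where z: "z \<in> carrier R" "z \<otimes> (\<one> \<ominus> r \<otimes> x) = \<one>" using J_one_minus_inverse by blast
    have "\<one> \<ominus> r \<otimes> x = (r \<otimes> x \<oplus> m) \<ominus> r \<otimes> x" using rm(3) by simp
    also have "\<dots> = m" using rm(1) mc x by (simp add: a_minus_def a_comm[of "r \<otimes> x" m] a_assoc r_neg)
    finally have "z \<otimes> m = \<one>" using z by simp
    then have "\<one> \<in> M" using O.right_idealD(5)[OF O.maximal_right_idealD(1)[OF M], of m z] rm z by simp
    then show False using O.maximal_right_idealD(3)[OF M] by simp
  qed
  then show "x \<in> jacobson_radical (opp R)"
    using x unfolding jacobson_radical_def opp_simps by simp
qed

lemma J_opp [simp]: "jacobson_radical (opp R) = J"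
  using J_subset_J_opp ring.J_subset_J_opp[OF ring_opp'] by auto

text \<open>A maximal right ideal not containing \<open>I\<close> would complete it to the whole
  ring; conversely \<open>I <+> K\<close> stays inside any maximal right ideal above
  \<open>K\<close>.\<close>

lemma small_right_ideal_iff: "small_right_ideal R I \<longleftrightarrow> right_ideal R I \<and> I \<subseteq> J"
proof
  assume I: "small_right_ideal R I"
  then have Ir: "right_ideal R I" by (simp add: small_right_ideal_def)
  have "I \<subseteq> M" if M: "maximal_right_ideal R M" for M
    using I M maximal_right_idealD(1,2,4)[OF M] unfolding small_right_ideal_def by blast
  then show "right_ideal R I \<and> I \<subseteq> J"
    using Ir right_idealD(1)[OF Ir] unfolding jacobson_radical_def by blast
next
  assume I: "right_ideal R I \<and> I \<subseteq> J"
  have "I <+> K \<noteq> carrier R" if K: "right_ideal R K" "K \<noteq> carrier R" for K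
  proof -
    have "\<one> \<notin> K" using right_idealD(1,5)[OF K(1)] K(2) by fastforce
    then obtain M where M: "maximal_right_ideal R M" "K \<subseteq> M" using exists_maximal_right_ideal K by blast
    then have "I <+> K \<subseteq> M"
      using I J_subset_maximal[OF M(1)] maximal_right_idealD(1)[OF M(1)] by (intro set_add_least) auto
    then show ?thesis using maximal_right_idealD(3)[OF M(1)] by auto
  qed
  then show "small_right_ideal R I" using I by (simp add: small_right_ideal_def)
qed

lemma right_small_dualD:
  "right_small_dual R \<Longrightarrow> right_ideal R I \<Longrightarrow> I \<subseteq> J \<Longrightarrow> right_ann R (left_ann R I) = I"
  using right_annihilator_iff[of I] right_idealD(1)[of I]
  by (auto simp: right_small_dual_def small_right_ideal_iff)

lemma left_small_dualD:
  "left_small_dual R \<Longrightarrow> left_ideal R I \<Longrightarrow> I \<subseteq> J \<Longrightarrow> left_ann R (right_ann R I) = I"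
  using ring.right_small_dualD[OF ring_opp', of I] by simp

end

section \<open>Simple elements and finite length of annihilators\<close>

context ring
begin

text \<open>The element \<open>k\<close> generates a simple submodule of $R/A$.\<close>

definition simple_mod :: "'a set \<Rightarrow> 'a \<Rightarrow> bool" where
  "simple_mod A k \<longleftrightarrow> k \<in> carrier R \<and> k \<notin> A \<and>
     (\<forall>r\<in>carrier R. k \<otimes> r \<notin> A \<longrightarrow> (\<exists>s\<in>carrier R. k \<ominus> k \<otimes> r \<otimes> s \<in> A))"

lemma simple_mod_cover:
  assumes A: "right_ideal R A" and C: "right_ideal R C" and c: "c \<in> C" "c \<notin> A"
    and cover: "\<And>D. right_ideal R D \<Longrightarrow> A \<subseteq> D \<Longrightarrow> D \<subseteq> C \<Longrightarrow> D = A \<or> D = C"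
    and AC: "A \<subseteq> C" and x: "x \<in> C"
  obtains a r where "a \<in> A" "r \<in> carrier R" "x = a \<oplus> c \<otimes> r"
proof -
  have cc: "c \<in> carrier R" using right_idealD(2)[OF C] c by blast
  have hull: "right_ideal R (rhull (insert c A))"
    using cc right_idealD(1)[OF A] by (intro right_ideal_rhull) auto
  have "rhull (insert c A) \<subseteq> C" using c AC by (intro rhull_least C) auto
  then have "rhull (insert c A) = C"
    using cover[OF hull] rhull_upper[of "insert c A"] c by blast
  then show thesis using x that rhull_insert[OF A cc] by auto
qed

lemma simple_modI_cover:
  assumes A: "right_ideal R A" and C: "right_ideal R C" and c: "c \<in> C" "c \<notin> A"
    and cover: "\<And>D. right_ideal R D \<Longrightarrow> A \<subseteq> D \<Longrightarrow> D \<subseteq> C \<Longrightarrow> D = A \<or> D = C"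
    and AC: "A \<subseteq> C"
  shows "simple_mod A c"
  unfolding simple_mod_def
proof (intro conjI ballI impI)
  note AD = right_idealD[OF A] and CD = right_idealD[OF C]
  show cc: "c \<in> carrier R" using CD c by blast
  show "c \<notin> A" by fact
  fix r assume r: "r \<in> carrier R" "c \<otimes> r \<notin> A"
  have "c \<otimes> r \<in> C" using CD c r by blast
  then obtain a s where as: "a \<in> A" "s \<in> carrier R" "c = a \<oplus> c \<otimes> r \<otimes> s"
    using simple_mod_cover[OF A C _ r(2) cover AC c(1)] by blast
  have "c \<ominus> c \<otimes> r \<otimes> s = (a \<oplus> c \<otimes> r \<otimes> s) \<ominus> c \<otimes> r \<otimes> s" using as(3) by simp
  also have "\<dots> = a" using as(1,2) r cc AD(2) by (intro add_minus_cancel) auto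
  finally show "\<exists>s\<in>carrier R. c \<ominus> c \<otimes> r \<otimes> s \<in> A" using as by auto
qed

lemma simple_mod_zero_iff:
  "simple_mod {\<zero>} k \<longleftrightarrow> k \<in> carrier R \<and> k \<noteq> \<zero> \<and>
     (\<forall>r\<in>carrier R. k \<otimes> r \<noteq> \<zero> \<longrightarrow> (\<exists>s\<in>carrier R. k = k \<otimes> r \<otimes> s))"
  unfolding simple_mod_def by (auto simp: add_minus_cancel)

lemma simple_mod_zeroD:
  assumes "simple_mod {\<zero>} k"
  shows "k \<in> carrier R" "k \<noteq> \<zero>"
    "\<And>r. r \<in> carrier R \<Longrightarrow> k \<otimes> r \<noteq> \<zero> \<Longrightarrow> \<exists>s\<in>carrier R. k = k \<otimes> r \<otimes> s"
  using assms unfolding simple_mod_zero_iff by blast+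

lemma minimal_right_ideal_simple_mod:
  assumes "minimal_right_ideal R I" "k \<in> I" "k \<noteq> \<zero>"
  shows "simple_mod {\<zero>} k"
  using assms right_idealD(3)
  by (intro simple_modI_cover[of _ I]) (auto simp: minimal_right_ideal_def)

lemma simple_mod_minimal_right_ideal:
  assumes k: "simple_mod {\<zero>} k"
  shows "minimal_right_ideal R ((\<otimes>) k ` carrier R)" (is "minimal_right_ideal R ?I")
proof -
  note kc = simple_mod_zeroD[OF k]
  have I: "right_ideal R ?I" using kc by (intro right_ideal_image) auto
  have "k \<otimes> \<one> \<in> ?I" by blast
  then have kI: "k \<in> ?I" using kc by simp
  have "K = {\<zero>} \<or> K = ?I" if K: "right_ideal R K" "K \<subseteq> ?I" for K
  proof (cases "K = {\<zero>}")
    case False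
    then obtain y where y: "y \<in> K" "y \<noteq> \<zero>" using right_idealD(3)[OF K(1)] by blast
    then obtain r where r: "r \<in> carrier R" "y = k \<otimes> r" using K by blast
    then obtain s where "s \<in> carrier R" "k = y \<otimes> s" using kc(3)[of r] y by blast
    then have "k \<in> K" using right_idealD(5)[OF K(1)] y by blast
    then have "?I \<subseteq> K" using right_idealD(5)[OF K(1)] by blast
    then show ?thesis using K by blast
  qed simp
  then show ?thesis using I kI kc unfolding minimal_right_ideal_def by blast
qed

text \<open>
  This is right mininjectivity. A simple element outside the radical is von Neumann regular, and
  one inside the radical generates a small left ideal, which is an annihilator.
\<close>

lemma left_small_dual_mininjective:
  assumes dual: "left_small_dual R" and k: "simple_mod {\<zero>} k"
    and x: "x \<in> carrier R" "\<And>r. r \<in> carrier R \<Longrightarrow> k \<otimes> r = \<zero> \<Longrightarrow> x \<otimes> r = \<zero>"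
  obtains s where "s \<in> carrier R" "x = s \<otimes> k"
proof (cases "k \<in> J")
  case True
  have kc: "k \<in> carrier R" using True by simp
  let ?L = "{s \<otimes> k | s. s \<in> carrier R}"
  have L: "left_ideal R ?L"
  proof (rule left_idealI)
    show "?L \<subseteq> carrier R" using kc by auto
    have "\<zero> = \<zero> \<otimes> k" using kc by simp
    then show "\<zero> \<in> ?L" by blast
    show "u \<oplus> v \<in> ?L" if uv: "u \<in> ?L" "v \<in> ?L" for u v
    proof -
      obtain s t where "s \<in> carrier R" "t \<in> carrier R" "u = s \<otimes> k" "v = t \<otimes> k" using uv by blast
      moreover from this have "u \<oplus> v = (s \<oplus> t) \<otimes> k" using kc by (simp add: l_distr)
      ultimately show ?thesis by blast
    qed
    show "r \<otimes> u \<in> ?L" if u: "u \<in> ?L" and r: "r \<in> carrier R" for u r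
    proof -
      obtain s where "s \<in> carrier R" "u = s \<otimes> k" using u by blast
      moreover from this have "r \<otimes> u = (r \<otimes> s) \<otimes> k" using kc r by (simp add: m_assoc)
      ultimately show ?thesis using r by blast
    qed
  qed
  have "k = \<one> \<otimes> k" using kc by simp
  then have kL: "k \<in> ?L" by blast
  have "?L \<subseteq> J" using True J_left_mult by auto
  then have "left_ann R (right_ann R ?L) = ?L" using left_small_dualD dual L by blast
  moreover have "x \<in> left_ann R (right_ann R ?L)"
  proof -
    have "x \<otimes> r = \<zero>" if "r \<in> right_ann R ?L" for r
      using that kL x(2)[of r] unfolding right_ann_def by blast
    then show ?thesis using x(1) unfolding left_ann_def by blast
  qed
  ultimately have "x \<in> ?L" by simp
  then obtain s where "s \<in> carrier R" "x = s \<otimes> k" by blast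
  then show ?thesis by (rule that)
next
  case False
  then obtain M where M: "maximal_right_ideal R M" "k \<notin> M"
    using simple_mod_zeroD(1)[OF k] unfolding jacobson_radical_def by blast
  note MD = right_idealD[OF maximal_right_idealD(1)[OF M(1)]]
  have kc: "k \<in> carrier R" by (rule simple_mod_zeroD(1)[OF k])
  have "k \<otimes> \<one> \<in> (\<otimes>) k ` carrier R" by blast
  then have "\<not> (\<otimes>) k ` carrier R \<subseteq> M" using kc M(2) by auto
  then have "(\<otimes>) k ` carrier R <+> M = carrier R"
    using kc by (intro maximal_right_idealD(4)[OF M(1)] right_ideal_image) auto
  then have "\<one> \<in> (\<otimes>) k ` carrier R <+> M" by simp
  then obtain s m where sm: "s \<in> carrier R" "m \<in> M" "\<one> = k \<otimes> s \<oplus> m"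
    unfolding mem_set_add by blast
  have mc: "m \<in> carrier R" using sm MD by blast
  have "m = \<one> \<ominus> k \<otimes> s" using sm mc kc by (simp add: a_minus_def a_comm[of _ m] a_assoc r_neg)
  then have "m \<otimes> k = k \<ominus> k \<otimes> s \<otimes> k" using sm(1) kc by (simp add: a_minus_def l_distr l_minus)
  also have "\<dots> = k \<otimes> (\<one> \<ominus> s \<otimes> k)" using sm(1) kc by (simp add: a_minus_def r_distr r_minus m_assoc)
  finally have eq: "m \<otimes> k = k \<otimes> (\<one> \<ominus> s \<otimes> k)" .
  \<comment> \<open>Otherwise \<open>k\<close> is a right multiple of \<open>m \<otimes> k\<close>,
    which lies in \<open>M\<close>. Hence \<open>k = k \<otimes> s \<otimes> k\<close>, and the
    hypothesis on \<open>x\<close> applies to \<open>\<one> \<ominus> s \<otimes> k\<close>.\<close>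
  have "k \<otimes> (\<one> \<ominus> s \<otimes> k) = \<zero>"
  proof (rule ccontr)
    assume "k \<otimes> (\<one> \<ominus> s \<otimes> k) \<noteq> \<zero>"
    then obtain t where "t \<in> carrier R" "k = k \<otimes> (\<one> \<ominus> s \<otimes> k) \<otimes> t"
      using simple_mod_zeroD(3)[OF k, of "\<one> \<ominus> s \<otimes> k"] sm(1) kc by auto
    moreover have "m \<otimes> k \<in> M" using MD sm kc by blast
    ultimately have "k \<in> M" using MD(5)[of "m \<otimes> k" t] eq by simp
    then show False using M by blast
  qed
  then have "x \<otimes> (\<one> \<ominus> s \<otimes> k) = \<zero>" using x sm(1) kc by auto
  then have "x \<ominus> (x \<otimes> s) \<otimes> k = \<zero>" using x(1) sm(1) kc by (simp add: a_minus_def r_distr r_minus m_assoc)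
  then have "x = (x \<otimes> s) \<otimes> k" using x(1) sm(1) kc by (simp add: add_minus_cancel)
  then show ?thesis by (rule that[rotated]) (use x(1) sm(1) in auto)
qed

text \<open>Let \<open>c\<close> generate \<open>C\<close> over \<open>A\<close> and let
  \<open>k\<close> annihilate \<open>A\<close> but not \<open>c\<close>. Then
  \<open>k \<otimes> c\<close> is simple, and it is killed by the same \<open>r\<close> as
  \<open>c\<close> is modulo \<open>A\<close>. By mininjectivity \<open>x \<otimes> c\<close> is a
  left multiple of \<open>k \<otimes> c\<close> for every \<open>x\<close> annihilating
  \<open>A\<close>, and subtracting that multiple of \<open>k\<close> from \<open>x\<close> leaves
  an annihilator of \<open>C\<close>.\<close>

lemma left_ann_cover:
  assumes dual: "left_small_dual R"
    and A: "right_ideal R A" and C: "right_ideal R C" and AC: "A \<subseteq> C"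
    and cover: "\<And>D. right_ideal R D \<Longrightarrow> A \<subseteq> D \<Longrightarrow> D \<subseteq> C \<Longrightarrow> D = A \<or> D = C"
  shows "len_le (left_ideal R) (left_ann R C) (left_ann R A) 1"
proof (rule len_le_cover)
  fix K assume K: "left_ideal R K" "left_ann R C \<subseteq> K" "K \<subseteq> left_ann R A"
  note AD = right_idealD[OF A] and CD = right_idealD[OF C] and KD = left_idealD[OF K(1)]
  have "left_ann R A \<subseteq> K" if ne: "K \<noteq> left_ann R C"
  proof
    fix x assume "x \<in> left_ann R A"
    then have xc: "x \<in> carrier R" and xA: "\<And>a. a \<in> A \<Longrightarrow> x \<otimes> a = \<zero>" by (auto simp: left_ann_def)
    obtain k where k: "k \<in> K" "k \<notin> left_ann R C" using ne K(2) by blast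
    have kA: "\<And>a. a \<in> A \<Longrightarrow> k \<otimes> a = \<zero>" using k K by (auto simp: left_ann_def)
    have kc: "k \<in> carrier R" using KD k by blast
    then obtain c where c: "c \<in> C" "k \<otimes> c \<noteq> \<zero>" using k by (auto simp: left_ann_def)
    have cA: "c \<notin> A" using kA c by blast
    have cc: "c \<in> carrier R" using CD c by blast
    have key: "\<exists>s\<in>carrier R. c \<ominus> c \<otimes> r \<otimes> s \<in> A" if "r \<in> carrier R" "c \<otimes> r \<notin> A" for r
      using simple_modI_cover[OF A C c(1) cA cover AC] that unfolding simple_mod_def by blast
    have cover_eq: "k \<otimes> c = k \<otimes> c \<otimes> r \<otimes> s"
      if "r \<in> carrier R" "s \<in> carrier R" "c \<ominus> c \<otimes> r \<otimes> s \<in> A" for r s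
    proof -
      have "k \<otimes> (c \<ominus> c \<otimes> r \<otimes> s) = \<zero>" using kA that by blast
      then have "k \<otimes> c \<ominus> k \<otimes> c \<otimes> r \<otimes> s = \<zero>"
        using kc cc that by (simp add: a_minus_def r_distr r_minus m_assoc)
      then show ?thesis using kc cc that by (simp add: add_minus_cancel)
    qed
    have simple: "simple_mod {\<zero>} (k \<otimes> c)"
      unfolding simple_mod_zero_iff
    proof (intro conjI ballI impI)
      fix r assume r: "r \<in> carrier R" "k \<otimes> c \<otimes> r \<noteq> \<zero>"
      then have "c \<otimes> r \<notin> A" using kA[of "c \<otimes> r"] kc cc by (auto simp: m_assoc)
      then show "\<exists>s\<in>carrier R. k \<otimes> c = k \<otimes> c \<otimes> r \<otimes> s" using key cover_eq r by blast
    qed (use c kc cc in auto)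
    have "x \<otimes> c \<otimes> r = \<zero>" if r: "r \<in> carrier R" "k \<otimes> c \<otimes> r = \<zero>" for r
    proof -
      have "c \<otimes> r \<in> A"
      proof (rule ccontr)
        assume "c \<otimes> r \<notin> A"
        then obtain s where "s \<in> carrier R" "k \<otimes> c = k \<otimes> c \<otimes> r \<otimes> s" using key cover_eq r by blast
        then show False using c r by simp
      qed
      then show ?thesis using xA xc cc r by (simp add: m_assoc)
    qed
    then obtain s where s: "s \<in> carrier R" "x \<otimes> c = s \<otimes> (k \<otimes> c)"
      using left_small_dual_mininjective[OF dual simple, of "x \<otimes> c"] xc cc by blast
    have "x \<ominus> s \<otimes> k \<in> left_ann R C"
      unfolding left_ann_def
    proof (intro CollectI conjI ballI)
      show "x \<ominus> s \<otimes> k \<in> carrier R" using xc s kc by simp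
      fix d assume "d \<in> C"
      then obtain a r where ar: "a \<in> A" "r \<in> carrier R" "d = a \<oplus> c \<otimes> r"
        using simple_mod_cover[OF A C c(1) cA cover AC] by blast
      have ac: "a \<in> carrier R" using ar AD by blast
      have *: "(x \<ominus> s \<otimes> k) \<otimes> a = \<zero>"
        using xA[OF ar(1)] kA[OF ar(1)] xc s(1) kc ac by (simp add: a_minus_def l_distr l_minus m_assoc)
      have "(x \<ominus> s \<otimes> k) \<otimes> c = \<zero>"
        using s xc kc cc by (simp add: a_minus_def l_distr l_minus m_assoc r_neg)
      then have "(x \<ominus> s \<otimes> k) \<otimes> (c \<otimes> r) = \<zero>"
        using xc s(1) kc cc ar(2) by (simp add: m_assoc[symmetric])
      then show "(x \<ominus> s \<otimes> k) \<otimes> d = \<zero>"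
        using * ar xc s(1) kc cc ac by (simp add: r_distr)
    qed
    then have "x \<ominus> s \<otimes> k \<in> K" using K by blast
    moreover have "s \<otimes> k \<in> K" using KD k s by blast
    ultimately have "(x \<ominus> s \<otimes> k) \<oplus> s \<otimes> k \<in> K" using KD by blast
    then show "x \<in> K" using xc s(1) kc by (simp add: a_minus_def a_assoc l_neg)
  qed
  then show "K = left_ann R C \<or> K = left_ann R A" using K by blast
qed

lemma len_le_left_add:
  assumes "left_ideal R B" "A \<subseteq> B" "B \<subseteq> C" "len_le (left_ideal R) A B m"
    "len_le (left_ideal R) B C n" "left_ideal R C"
  shows "len_le (left_ideal R) A C (m + n)"
  using ring.len_le_add[OF ring_opp', of B A C m n] assms by simp

text \<open>Induction on the length: a \<open>C\<close> of least rank strictly above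
  \<open>A\<close> covers \<open>A\<close>, and by \<open>left_ann_cover\<close> this cover costs at
  most one step on the left.\<close>

lemma len_le_left_ann:
  assumes dual: "left_small_dual R" and B: "right_ideal R B"
  shows "right_ideal R A \<Longrightarrow> A \<subseteq> B \<Longrightarrow> len_le (right_ideal R) A B n \<Longrightarrow>
    len_le (left_ideal R) (left_ann R B) (left_ann R A) n"
proof (induction n arbitrary: A)
  case 0
  then obtain f where f: "rank_fun (right_ideal R) A B 0 f" by (auto simp: len_le_def)
  have "A = B"
  proof (rule ccontr)
    assume "A \<noteq> B"
    then have "f A < f B" using rank_funD(2)[OF f \<open>right_ideal R A\<close> B] 0 by blast
    then show False using rank_funD(1)[OF f B] 0 by auto
  qed
  then show ?case by (intro len_le_trivial) auto
next
  case (Suc n)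
  then obtain f where f: "rank_fun (right_ideal R) A B (Suc n) f" by (auto simp: len_le_def)
  show ?case
  proof (cases "A = B")
    case True
    then show ?thesis by (intro len_le_trivial) auto
  next
    case False
    then have "\<exists>C. (right_ideal R C \<and> A \<subset> C \<and> C \<subseteq> B) \<and>
        (\<forall>D. right_ideal R D \<and> A \<subset> D \<and> D \<subseteq> B \<longrightarrow> f C \<le> f D)"
      using ex_has_least_nat[of "\<lambda>C. right_ideal R C \<and> A \<subset> C \<and> C \<subseteq> B" B f] B Suc.prems by blast
    then obtain C where C: "right_ideal R C" "A \<subset> C" "C \<subseteq> B"
      and least: "\<And>D. right_ideal R D \<Longrightarrow> A \<subset> D \<Longrightarrow> D \<subseteq> B \<Longrightarrow> f C \<le> f D" by blast
    have cover: "D = A \<or> D = C" if "right_ideal R D" "A \<subseteq> D" "D \<subseteq> C" for D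
    proof (rule ccontr)
      assume "\<not> ?thesis"
      then have "f C \<le> f D" "f D < f C"
        using least[of D] rank_funD(2)[OF f, of D C] that C by auto
      then show False by simp
    qed
    have pos: "f A < f D" if "right_ideal R D" "C \<subseteq> D" "D \<subseteq> B" for D
      using rank_funD(2)[OF f Suc.prems(1), of D] that C by blast
    \<comment> \<open>Above \<open>C\<close> every rank exceeds \<open>f A\<close>, so the truncated
      subtraction stays strictly monotone.\<close>
    have "rank_fun (right_ideal R) C B n (\<lambda>D. f D - 1)"
      unfolding rank_fun_def
    proof (intro conjI allI impI)
      fix D assume "right_ideal R D \<and> C \<subseteq> D \<and> D \<subseteq> B"
      then show "f D - 1 \<le> n" using rank_funD(1)[OF f, of D] C by force
    next
      fix D E assume *: "right_ideal R D \<and> right_ideal R E \<and> C \<subseteq> D \<and> D \<subset> E \<and> E \<subseteq> B"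
      then have "f A < f D" using pos[of D] by auto
      moreover have "f D < f E" using * rank_funD(2)[OF f, of D E] C by auto
      ultimately show "f D - 1 < f E - 1" by linarith
    qed
    then have "len_le (left_ideal R) (left_ann R B) (left_ann R C) n"
      using Suc.IH[of C] C by (auto simp: len_le_def)
    moreover have "len_le (left_ideal R) (left_ann R C) (left_ann R A) 1"
      using left_ann_cover[OF dual Suc.prems(1) C(1) _ cover] C(2) by auto
    ultimately have "len_le (left_ideal R) (left_ann R B) (left_ann R A) (n + 1)"
      using left_ann_antimono[of C B] left_ann_antimono[of A C] C Suc.prems(1) right_idealD(1)
      by (intro len_le_left_add[of "left_ann R C"] left_ideal_left_ann) auto
    then show ?thesis by simp
  qed
qed

lemma len_le_right_ann:
  assumes "right_small_dual R" "left_ideal R B" "left_ideal R A" "A \<subseteq> B" "len_le (left_ideal R) A B n"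
  shows "len_le (right_ideal R) (right_ann R B) (right_ann R A) n"
  using ring.len_le_left_ann[OF ring_opp', of B A n] assms by simp

text \<open>
  Passing to the left and back to the right annihilator does not increase the length, so a right
  ideal of finite length has the same length as the annihilator it generates.
\<close>

lemma finite_length_right_dual:
  assumes dual: "small_dual R" and fin: "len_le (right_ideal R) {\<zero>} (carrier R) N"
  shows "right_dual R"
  unfolding right_dual_def
proof (intro allI impI)
  fix I assume I: "right_ideal R I"
  have I0: "{\<zero>} \<subseteq> I" and IR: "I \<subseteq> carrier R" using right_idealD[OF I] by auto
  \<comment> \<open>The least bound is the exact length, so that a bound by \<open>n - 1\<close>
    will be contradictory.\<close>
  define n where "n = (LEAST n. len_le (right_ideal R) {\<zero>} I n)"
  have n: "len_le (right_ideal R) {\<zero>} I n"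
    unfolding n_def by (rule LeastI[of _ N]) (rule len_le_subinterval[OF fin _ IR], simp)
  let ?L = "left_ann R I" and ?I = "right_ann R (left_ann R I)"
  have "len_le (left_ideal R) ?L (carrier R) n"
    using len_le_left_ann[OF _ I _ I0 n] dual by (simp add: small_dual_def left_ann_zero)
  then have "len_le (right_ideal R) {\<zero>} ?I n"
    using len_le_right_ann[of "carrier R" ?L n] dual left_ideal_left_ann[OF IR] left_ann_subset
    by (simp add: small_dual_def right_ann_carrier)
  then obtain f where f: "rank_fun (right_ideal R) {\<zero>} ?I n f" by (auto simp: len_le_def)
  have I': "right_ideal R ?I" using left_ann_subset by (intro right_ideal_right_ann)
  have sub: "I \<subseteq> ?I" using subset_right_left_ann[OF IR] .
  have "?I = I"
  proof (rule ccontr)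
    assume "?I \<noteq> I"
    then have less: "f I < f ?I" using rank_funD(2)[OF f I I'] sub I0 by blast
    moreover have le: "f ?I \<le> n" using rank_funD(1)[OF f I'] sub I0 by auto
    ultimately have "n \<noteq> 0" "f I \<le> n - 1" by auto
    \<comment> \<open>A strictly larger closure uses up one of the \<open>n\<close> steps above
      \<open>I\<close>, leaving at most \<open>n - 1\<close> below it.\<close>
    have "rank_fun (right_ideal R) {\<zero>} I (n - 1) f"
      unfolding rank_fun_def
    proof (intro conjI allI impI)
      fix D assume D: "right_ideal R D \<and> {\<zero>} \<subseteq> D \<and> D \<subseteq> I"
      have "f D \<le> f I"
      proof (cases "D = I")
        case False
        then have "D \<subset> I" using D by blast
        then show ?thesis using rank_funD(2)[OF f, of D I] I D sub by auto
      qed simp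
      then show "f D \<le> n - 1" using \<open>f I \<le> n - 1\<close> by simp
    next
      fix D E assume "right_ideal R D \<and> right_ideal R E \<and> {\<zero>} \<subseteq> D \<and> D \<subset> E \<and> E \<subseteq> I"
      then show "f D < f E" using rank_funD(2)[OF f, of D E] sub by auto
    qed
    then have "n \<le> n - 1" unfolding n_def by (intro Least_le) (auto simp: len_le_def)
    then show False using \<open>n \<noteq> 0\<close> by simp
  qed
  then show "right_annihilator R I" using right_annihilator_iff[OF IR] by simp
qed

lemma finite_length_left_of_right:
  assumes "small_dual R" "len_le (right_ideal R) {\<zero>} (carrier R) n"
  shows "len_le (left_ideal R) {\<zero>} (carrier R) n"
  using len_le_left_ann[of "carrier R" "{\<zero>}" n] assms
  by (simp add: small_dual_def left_ann_carrier left_ann_zero)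

lemma finite_length_quasi_Frobenius:
  assumes dual: "small_dual R" and fin: "len_le (right_ideal R) {\<zero>} (carrier R) n"
  shows "quasi_Frobenius R"
  unfolding quasi_Frobenius_def
proof (intro conjI)
  show "right_artinian R"
    unfolding right_artinian_def
    by (rule dcc_on_mono[OF len_le_dcc[OF fin]]) (auto dest: right_idealD)
  show "right_dual R" using finite_length_right_dual[OF assms] .
  show "left_dual R"
    using ring.finite_length_right_dual[OF ring_opp', of n] finite_length_left_of_right[OF assms] dual
    by simp
qed

end

section \<open>Complements modulo the radical\<close>

context ring
begin

lemma carrier_subset_right_ideal: "right_ideal R I \<Longrightarrow> \<one> \<in> I \<Longrightarrow> I = carrier R"
  using right_idealD(1,5)[of I] l_one by (metis subsetI subset_antisym)

lemma not_subset_J: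
  assumes "right_ideal R K" "\<not> K \<subseteq> J"
  shows "\<exists>M. maximal_right_ideal R M \<and> \<not> K \<subseteq> M \<and> K <+> M = carrier R"
proof -
  obtain M where "maximal_right_ideal R M" "\<not> K \<subseteq> M"
    using assms right_idealD(1)[OF assms(1)] unfolding jacobson_radical_def by blast
  then show ?thesis using maximal_right_idealD(4) assms(1) by blast
qed

lemma len_le_maximal: "maximal_right_ideal R M \<Longrightarrow> len_le (right_ideal R) M (carrier R) 1"
  by (rule len_le_cover) (auto simp: maximal_right_ideal_def)

text \<open>A minimal \<open>K\<close> with finite length above it lies in every maximal right
  ideal, since intersecting \<open>K\<close> with one more costs at most one step.\<close>

lemma dcc_above_J_finite_length:
  assumes dcc: "dcc_on (\<lambda>D. right_ideal R D \<and> J \<subseteq> D \<and> D \<subseteq> carrier R)"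
  shows "\<exists>n. len_le (right_ideal R) J (carrier R) n"
proof -
  let ?Q = "\<lambda>K. right_ideal R K \<and> J \<subseteq> K \<and> (\<exists>n. len_le (right_ideal R) K (carrier R) n)"
  have "?Q (carrier R)" using J_subset_carrier len_le_trivial[of "carrier R" "carrier R"] by auto
  then obtain K where K: "?Q K" and min: "\<And>Z. ?Q Z \<Longrightarrow> Z \<subseteq> K \<Longrightarrow> Z = K"
    using dcc_on_minimal[OF dcc, of ?Q "carrier R"] right_idealD(1) by metis
  have "K \<subseteq> J"
  proof (rule ccontr)
    assume "\<not> K \<subseteq> J"
    then obtain M where M: "maximal_right_ideal R M" "\<not> K \<subseteq> M" using not_subset_J K by blast
    note Mr = maximal_right_idealD(1)[OF M(1)]
    obtain n where "len_le (right_ideal R) K (carrier R) n" using K by blast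
    then have "len_le (right_ideal R) (K \<inter> M) (carrier R) (1 + n)"
      using K by (intro len_le_Int Mr len_le_maximal[OF M(1)]) auto
    then have "?Q (K \<inter> M)" using K right_ideal_Int Mr J_subset_maximal[OF M(1)] by blast
    then have "K \<inter> M = K" using min by blast
    then show False using M(2) by blast
  qed
  then show ?thesis using K by (metis subset_antisym)
qed

text \<open>A minimal supplement \<open>C\<close> works: if a maximal \<open>M\<close> does not
  contain \<open>I \<inter> C\<close>, then \<open>C \<inter> M\<close> is still a supplement of
  \<open>I\<close> by the modular law.\<close>

lemma complement_mod_J:
  assumes fin: "len_le (right_ideal R) J (carrier R) n"
    and I: "right_ideal R I" "J \<subseteq> I"
  obtains C where "right_ideal R C" "J \<subseteq> C" "I <+> C = carrier R" "I \<inter> C = J"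
proof -
  let ?Q = "\<lambda>C. right_ideal R C \<and> J \<subseteq> C \<and> I <+> C = carrier R"
  have "I <+> carrier R = carrier R"
    using right_idealD(1)[OF right_ideal_set_add[OF I(1) right_ideal_carrier]]
      set_add_upper2[OF I(1) right_ideal_carrier] by blast
  then have "?Q (carrier R)" using J_subset_carrier by auto
  then obtain C where C: "?Q C" and min: "\<And>Z. ?Q Z \<Longrightarrow> Z \<subseteq> C \<Longrightarrow> Z = C"
    using dcc_on_minimal[OF len_le_dcc[OF fin], of ?Q "carrier R"] right_idealD(1) by metis
  have "I \<inter> C \<subseteq> J"
  proof (rule ccontr)
    assume nJ: "\<not> I \<inter> C \<subseteq> J"
    have IC: "right_ideal R (I \<inter> C)" using I C right_ideal_Int by blast
    obtain M where M: "maximal_right_ideal R M" "\<not> I \<inter> C \<subseteq> M" "(I \<inter> C) <+> M = carrier R"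
      using not_subset_J[OF IC nJ] by blast
    note Mr = maximal_right_idealD(1)[OF M(1)]
    have CM: "right_ideal R (C \<inter> M)" using C right_ideal_Int Mr by blast
    have ICM: "right_ideal R (I <+> (C \<inter> M))" by (rule right_ideal_set_add[OF I(1) CM])
    have "C = ((I \<inter> C) <+> M) \<inter> C" using M(3) right_idealD(1)[of C] C by auto
    also have "\<dots> = (I \<inter> C) <+> (M \<inter> C)" using modular_law[OF IC Mr] C by blast
    also have "\<dots> \<subseteq> I <+> (C \<inter> M)" by (rule set_add_mono) auto
    finally have "I <+> C \<subseteq> I <+> (C \<inter> M)"
      using set_add_upper1[OF I(1) CM] by (intro set_add_least ICM)
    then have "I <+> (C \<inter> M) = carrier R" using C right_idealD(1)[OF ICM] by blast
    then have "?Q (C \<inter> M)" using CM J_subset_maximal[OF M(1)] C by blast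
    then have "C \<inter> M = C" using min by blast
    then show False using M(2) by blast
  qed
  then show thesis using that C I by blast
qed

text \<open>A complement of \<open>I\<close> modulo \<open>J\<close> splits
  \<open>\<one> = u \<oplus> e\<close> with \<open>u \<in> I\<close>, and left multiplication by
  \<open>e\<close> carries \<open>I\<close> into \<open>J\<close>. So \<open>s \<otimes> e\<close>
  annihilates \<open>I\<close> whenever \<open>s\<close> annihilates \<open>J\<close>, and the
  double annihilator condition for \<open>J\<close> puts \<open>e \<otimes> x\<close> into
  \<open>J\<close>.\<close>

lemma above_J_closed:
  assumes fin: "len_le (right_ideal R) J (carrier R) n" and dual: "right_small_dual R"
    and I: "right_ideal R I" "J \<subseteq> I"
  shows "right_ann R (left_ann R I) = I"
proof
  have IR: "I \<subseteq> carrier R" using right_idealD(1)[OF I(1)] .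
  then show "I \<subseteq> right_ann R (left_ann R I)" by (rule subset_right_left_ann)
  obtain C where C: "right_ideal R C" "J \<subseteq> C" "I <+> C = carrier R" "I \<inter> C = J"
    using complement_mod_J[OF fin I] by blast
  have "\<one> \<in> I <+> C" using C by simp
  then obtain u e where ue: "u \<in> I" "e \<in> C" "\<one> = u \<oplus> e" unfolding mem_set_add by blast
  note ID = right_idealD[OF I(1)] and CD = right_idealD[OF C(1)]
  have uc: "u \<in> carrier R" "e \<in> carrier R" using ID CD ue by auto
  have split: "x = u \<otimes> x \<oplus> e \<otimes> x" if "x \<in> carrier R" for x
    using that uc ue(3) l_distr[of u e x] l_one by metis
  have eI: "e \<otimes> i \<in> J" if "i \<in> I" for i
  proof -
    have ic: "i \<in> carrier R" using ID that by blast
    have "e \<otimes> i = (u \<otimes> i \<oplus> e \<otimes> i) \<ominus> u \<otimes> i" using ic uc by (simp add: add_minus_cancel)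
    also have "\<dots> = i \<ominus> u \<otimes> i" using split[OF ic, symmetric] by simp
    also have "\<dots> \<in> I" using ID(7)[OF that ID(5)[OF ue(1) ic]] .
    finally have "e \<otimes> i \<in> I" .
    then show ?thesis using C(4) CD ue ic by blast
  qed
  show "right_ann R (left_ann R I) \<subseteq> I"
  proof
    fix x assume x: "x \<in> right_ann R (left_ann R I)"
    then have xc: "x \<in> carrier R" by (simp add: right_ann_def)
    have "s \<otimes> (e \<otimes> x) = \<zero>" if s: "s \<in> left_ann R J" for s
    proof -
      have sc: "s \<in> carrier R" using s by (simp add: left_ann_def)
      have "s \<otimes> e \<otimes> i = \<zero>" if "i \<in> I" for i
        using s eI[OF that] sc uc ID(2)[OF that] by (simp add: left_ann_def m_assoc)
      then have "s \<otimes> e \<in> left_ann R I" using sc uc by (simp add: left_ann_def)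
      then have "s \<otimes> e \<otimes> x = \<zero>" using x unfolding right_ann_def by blast
      then show ?thesis using sc uc xc by (simp add: m_assoc)
    qed
    then have "e \<otimes> x \<in> right_ann R (left_ann R J)" using uc xc by (simp add: right_ann_def)
    then have "e \<otimes> x \<in> I" using right_small_dualD[OF dual right_ideal_J] I by auto
    then show "x \<in> I" using split[OF xc] ID(4,5) ue xc by metis
  qed
qed

text \<open>Among the right ideals generated over \<open>J\<close> by finitely many simple elements
  take a maximal one. A complement larger than \<open>J\<close> would contain one further simple
  element.\<close>

lemma simple_mod_J_generate:
  assumes fin: "len_le (right_ideal R) J (carrier R) n"
  shows "\<exists>X. finite X \<and> (\<forall>k\<in>X. simple_mod J k) \<and> rhull (J \<union> X) = carrier R"
proof -
  define Q where "Q = (\<lambda>I. \<exists>X. finite X \<and> (\<forall>k\<in>X. simple_mod J k) \<and> I = rhull (J \<union> X))"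
  have sub: "X \<subseteq> carrier R" if "\<forall>k\<in>X. simple_mod J k" for X
    using that by (auto simp: simple_mod_def)
  have QP: "right_ideal R I \<and> J \<subseteq> I \<and> I \<subseteq> carrier R" if Q: "Q I" for I
  proof -
    obtain X where X: "\<forall>k\<in>X. simple_mod J k" "I = rhull (J \<union> X)" using Q unfolding Q_def by blast
    then have "J \<union> X \<subseteq> carrier R" using sub J_subset_carrier by simp
    then have "right_ideal R I" using X(2) right_ideal_rhull by simp
    then show ?thesis using X(2) rhull_upper[of "J \<union> X"] right_idealD(1) by auto
  qed
  have "Q J" unfolding Q_def by (intro exI[of _ "{}"]) (simp add: rhull_ideal right_ideal_J)
  then obtain I where I: "Q I" and max: "\<And>Z. Q Z \<Longrightarrow> I \<subseteq> Z \<Longrightarrow> Z = I"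
    using acc_on_maximal[OF len_le_acc[OF fin], of Q J, OF _ QP] by blast
  obtain X where X: "finite X" "\<forall>k\<in>X. simple_mod J k" "I = rhull (J \<union> X)" using I unfolding Q_def by blast
  have II: "right_ideal R I" "J \<subseteq> I" using QP[OF I] by auto
  obtain C where C: "right_ideal R C" "J \<subseteq> C" "I <+> C = carrier R" "I \<inter> C = J"
    using complement_mod_J[OF fin II] by blast
  have "C \<subseteq> J"
  proof (rule ccontr)
    assume nC: "\<not> C \<subseteq> J"
    let ?P = "\<lambda>D. right_ideal R D \<and> J \<subset> D \<and> D \<subseteq> C"
    have "?P C" using C nC by blast
    then obtain E where E: "?P E" and min: "\<And>Z. ?P Z \<Longrightarrow> Z \<subseteq> E \<Longrightarrow> Z = E"
      using dcc_on_minimal[OF len_le_dcc[OF fin], of ?P C] right_idealD(1) by (metis psubset_imp_subset)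
    obtain k where k: "k \<in> E" "k \<notin> J" using E by blast
    have "D = J \<or> D = E" if "right_ideal R D" "J \<subseteq> D" "D \<subseteq> E" for D
      using min[of D] that E by blast
    then have "simple_mod J k" using E k by (intro simple_modI_cover[OF right_ideal_J, of E]) auto
    then have "Q (rhull (J \<union> insert k X))" using X unfolding Q_def by (intro exI[of _ "insert k X"]) auto
    moreover have "I \<subseteq> rhull (J \<union> insert k X)" unfolding X(3) by (rule rhull_mono) auto
    ultimately have "rhull (J \<union> insert k X) = I" using max by blast
    then have "k \<in> I" using rhull_upper[of "J \<union> insert k X"] by auto
    then show False using C(4) E k by blast
  qed
  then have "I <+> C \<subseteq> I" using II by (intro set_add_least) auto
  then have "I = carrier R" using C(3) right_idealD(1)[OF II(1)] by blast
  then show ?thesis using X by auto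
qed

section \<open>The socle of a semilocal small dual ring\<close>

text \<open>By \<open>left_ann_cover\<close> the left annihilator of the simple right ideal of
  \<open>k\<close> is the whole ring or a maximal left ideal, and either contains
  \<open>J\<close>.\<close>

lemma J_mult_simple:
  assumes dual: "left_small_dual R" and k: "simple_mod {\<zero>} k" and j: "j \<in> J"
  shows "j \<otimes> k = \<zero>"
proof -
  let ?I = "(\<otimes>) k ` carrier R"
  note kc = simple_mod_zeroD(1)[OF k]
  have min: "minimal_right_ideal R ?I" using simple_mod_minimal_right_ideal[OF k] .
  then have I: "right_ideal R ?I" by (simp add: minimal_right_ideal_def)
  have 0: "{\<zero>} \<subseteq> ?I" using right_idealD(3)[OF I] by blast
  have L: "left_ideal R (left_ann R ?I)" using right_idealD(1)[OF I] by (rule left_ideal_left_ann)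
  have len: "len_le (left_ideal R) (left_ann R ?I) (left_ann R {\<zero>}) 1"
    using min 0 by (intro left_ann_cover dual I right_ideal_zero) (auto simp: minimal_right_ideal_def)
  have memI: "k \<in> ?I" using kc by (intro image_eqI[of _ _ \<one>]) auto
  have "j \<in> left_ann R ?I"
  proof (cases "left_ann R ?I = carrier R")
    case False
    have "maximal_right_ideal (opp R) (left_ann R ?I)"
      unfolding maximal_right_ideal_def ideal_notions_opp opp_simps
    proof (intro conjI allI impI L False)
      fix K assume K: "left_ideal R K \<and> left_ann R ?I \<subseteq> K"
      obtain f where f: "rank_fun (left_ideal R) (left_ann R ?I) (carrier R) 1 f"
        using len by (auto simp: len_le_def left_ann_zero)
      have KR: "K \<subseteq> carrier R" using left_idealD(1) K by blast
      show "K = left_ann R ?I \<or> K = carrier R"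
      proof (rule ccontr)
        assume "\<not> ?thesis"
        then have "f (left_ann R ?I) < f K" "f K < f (carrier R)"
          using K KR rank_funD(2)[OF f L, of K] rank_funD(2)[OF f, of K "carrier R"] by auto
        moreover have "f (carrier R) \<le> 1" using rank_funD(1)[OF f, of "carrier R"] K KR by auto
        ultimately show False by linarith
      qed
    qed
    then have "J \<subseteq> left_ann R ?I" using ring.J_subset_maximal[OF ring_opp'] by simp
    then show ?thesis using j by blast
  qed (use j in auto)
  then show ?thesis using memI by (auto simp: left_ann_def)
qed

text \<open>For \<open>x\<close> annihilating \<open>J\<close> from the left,
  \<open>x \<otimes> k\<close> is zero or simple whenever \<open>k\<close> is simple modulo
  \<open>J\<close>, and simple elements are killed by \<open>J\<close> from the left. Such
  \<open>k\<close> generate the ring over \<open>J\<close>.\<close>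

lemma left_ann_J_subset_right_ann_J:
  assumes fin: "len_le (right_ideal R) J (carrier R) n" and dual: "left_small_dual R"
  shows "left_ann R J \<subseteq> right_ann R J"
proof
  fix x assume x: "x \<in> left_ann R J"
  then have xc: "x \<in> carrier R" and xJ: "\<And>j. j \<in> J \<Longrightarrow> x \<otimes> j = \<zero>" by (auto simp: left_ann_def)
  obtain X where X: "\<forall>k\<in>X. simple_mod J k" "rhull (J \<union> X) = carrier R"
    using simple_mod_J_generate[OF fin] by blast
  let ?I = "{r \<in> carrier R. x \<otimes> r \<in> right_ann R J}"
  have I: "right_ideal R ?I"
    using right_ideal_right_ann[OF J_subset_carrier] xc by (rule right_ideal_left_mult_preimage)
  have "J \<subseteq> ?I" using xJ by (auto simp: right_ann_def)
  moreover have "k \<in> ?I" if "k \<in> X" for k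
  proof -
    have k: "simple_mod J k" using X that by blast
    then have kc: "k \<in> carrier R" by (simp add: simple_mod_def)
    have "j \<otimes> (x \<otimes> k) = \<zero>" if j: "j \<in> J" for j
    proof (cases "x \<otimes> k = \<zero>")
      case False
      have "simple_mod {\<zero>} (x \<otimes> k)"
        unfolding simple_mod_zero_iff
      proof (intro conjI ballI impI False)
        fix r assume r: "r \<in> carrier R" "x \<otimes> k \<otimes> r \<noteq> \<zero>"
        then have "k \<otimes> r \<notin> J" using xJ xc kc by (auto simp: m_assoc)
        then obtain s where s: "s \<in> carrier R" "k \<ominus> k \<otimes> r \<otimes> s \<in> J"
          using k r by (auto simp: simple_mod_def)
        then have "x \<otimes> (k \<ominus> k \<otimes> r \<otimes> s) = \<zero>" using xJ by blast
        then have "x \<otimes> k \<ominus> x \<otimes> k \<otimes> r \<otimes> s = \<zero>"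
          using xc kc r s(1) by (simp add: a_minus_def r_distr r_minus m_assoc)
        then have "x \<otimes> k = x \<otimes> k \<otimes> r \<otimes> s" using xc kc r s(1) by (simp add: add_minus_cancel)
        then show "\<exists>s\<in>carrier R. x \<otimes> k = x \<otimes> k \<otimes> r \<otimes> s" using s by blast
      qed (use xc kc in auto)
      then show ?thesis using J_mult_simple[OF dual] j by blast
    qed (use j in simp)
    then show ?thesis using xc kc by (simp add: right_ann_def)
  qed
  ultimately have "rhull (J \<union> X) \<subseteq> ?I" by (intro rhull_least I) auto
  then have "\<one> \<in> ?I" using X(2) by auto
  then show "x \<in> right_ann R J" using xc by simp
qed

end

text \<open>Both bounds are carried, with the same \<open>n\<close>, so that the opposite ring is
  again an instance and each result has a mirror image.\<close>

locale semilocal_small_dual = ring R for R :: "('a, 'b) ring_scheme" (structure) +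
  fixes n :: nat
  assumes small_dual: "small_dual R"
    and fin_right: "len_le (right_ideal R) (jacobson_radical R) (carrier R) n"
    and fin_left: "len_le (left_ideal R) (jacobson_radical R) (carrier R) n"
begin

lemma semilocal_small_dual_opp: "semilocal_small_dual (opp R) n"
  using small_dual fin_left fin_right
  by (intro semilocal_small_dual.intro ring_opp' semilocal_small_dual_axioms.intro) simp_all

lemma left_dual: "left_small_dual R" and right_dual: "right_small_dual R"
  using small_dual by (auto simp: small_dual_def)

lemma left_ann_J: "left_ann R J = right_ann R J"
  using left_ann_J_subset_right_ann_J[OF fin_right left_dual]
    ring.left_ann_J_subset_right_ann_J[OF ring_opp', of n] fin_left right_dual by auto

lemma below_J_right_closed: "right_ideal R I \<Longrightarrow> I \<subseteq> J \<Longrightarrow> right_ann R (left_ann R I) = I"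
  using right_small_dualD[OF right_dual] .

lemma below_J_left_closed: "left_ideal R I \<Longrightarrow> I \<subseteq> J \<Longrightarrow> left_ann R (right_ann R I) = I"
  using left_small_dualD[OF left_dual] .

lemma above_J_right_closed: "right_ideal R I \<Longrightarrow> J \<subseteq> I \<Longrightarrow> right_ann R (left_ann R I) = I"
  using above_J_closed[OF fin_right right_dual] .

lemma above_J_left_closed: "left_ideal R I \<Longrightarrow> J \<subseteq> I \<Longrightarrow> left_ann R (right_ann R I) = I"
  using ring.above_J_closed[OF ring_opp', of n I] fin_left left_dual by simp

lemma finite_length_right_ann_J: "len_le (right_ideal R) {\<zero>} (right_ann R J) n"
  using len_le_right_ann[OF right_dual left_ideal_carrier left_ideal_J J_subset_carrier fin_left]
  by (simp add: right_ann_carrier)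

text \<open>If \<open>C\<close> meets \<open>right_ann R J\<close> trivially, then
  \<open>left_ann R (C \<inter> J) <+> J\<close> has zero right annihilator, so it is the whole
  ring. As \<open>J\<close> is small, \<open>left_ann R (C \<inter> J)\<close> already is, and
  \<open>C \<inter> J\<close> is zero. Then \<open>C\<close> annihilates \<open>J\<close> from the
  left, which by \<open>left_ann_J\<close> places it in \<open>right_ann R J\<close>.\<close>

lemma right_ann_J_essential: "essential_right R (right_ann R J) (carrier R)"
  unfolding essential_right_def
proof (intro conjI allI impI right_ideal_right_ann J_subset_carrier right_ann_subset right_ideal_carrier)
  fix C assume C: "right_ideal R C \<and> C \<subseteq> carrier R \<and> C \<noteq> {\<zero>}"
  then have Cr: "right_ideal R C" by blast
  note CD = right_idealD[OF Cr]
  show "right_ann R J \<inter> C \<noteq> {\<zero>}"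
  proof
    assume zero: "right_ann R J \<inter> C = {\<zero>}"
    let ?C = "C \<inter> J"
    have Cj: "right_ideal R ?C" using right_ideal_Int[OF Cr right_ideal_J] .
    have CjR: "?C \<subseteq> carrier R" using right_idealD(1)[OF Cj] .
    have L: "left_ideal R (left_ann R ?C)" using left_ideal_left_ann[OF CjR] .
    interpret O: ring "opp R" by simp
    have sum: "left_ideal R (left_ann R ?C <+> J)" "J \<subseteq> left_ann R ?C <+> J"
      using O.right_ideal_set_add[of "left_ann R ?C" J] O.set_add_upper2[of "left_ann R ?C" J]
        L left_ideal_J by auto
    have "right_ann R (left_ann R ?C <+> J) = right_ann R (left_ann R ?C) \<inter> right_ann R J"
      by (rule right_ann_set_add[OF L left_ideal_J])
    also have "\<dots> = ?C \<inter> right_ann R J" using below_J_right_closed[OF Cj] by auto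
    also have "\<dots> = {\<zero>}" using zero right_idealD(3)[OF Cj] by auto
    finally have "left_ann R ?C <+> J = carrier R"
      using above_J_left_closed[OF sum] by (simp add: left_ann_zero)
    moreover have "small_left_ideal R J"
      using ring.small_right_ideal_iff[OF ring_opp', of J] left_ideal_J by simp
    moreover have "J <+> left_ann R ?C = left_ann R ?C <+> J"
      by (rule set_add_comm) (use left_ann_subset J_subset_carrier in auto)
    ultimately have "left_ann R ?C = carrier R" using L unfolding small_left_ideal_def by auto
    then have "right_ann R (carrier R) = ?C" using below_J_right_closed[OF Cj] by auto
    then have CJ: "?C = {\<zero>}" by (simp add: right_ann_carrier)
    have "c \<in> left_ann R J" if c: "c \<in> C" for c
    proof -
      have "c \<otimes> j \<in> ?C" if "j \<in> J" for j
        using that c CD J_left_mult by auto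
      then show ?thesis using CJ CD(2)[OF c] by (auto simp: left_ann_def)
    qed
    then have "C \<subseteq> right_ann R J" using left_ann_J by blast
    then show False using zero C by blast
  qed
qed

end

section \<open>Powers of the radical\<close>

context ring
begin

text \<open>The power with exponent zero is the whole ring, so that the top layer of the filtration
  is the quotient by \<open>J\<close>.\<close>

primrec J_pow :: "nat \<Rightarrow> 'a set" where
  "J_pow 0 = carrier R"
| "J_pow (Suc n) = J_pow n \<cdot> J"

lemma J_pow_ideal: "ideal (J_pow n) R"
  by (induction n) (simp_all add: ideal_prod_is_ideal ideal_J oneideal)

lemma J_pow_right_ideal: "right_ideal R (J_pow n)" and J_pow_left_ideal: "left_ideal R (J_pow n)"
  using J_pow_ideal by (auto simp: ideal_iff)

lemma J_pow_Suc_subset: "J_pow (Suc n) \<subseteq> J_pow n" "J_pow (Suc n) \<subseteq> J"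
  using ideal_prod_inter[OF J_pow_ideal ideal_J] by auto

lemma J_subset_J_pow_1: "J \<subseteq> J_pow (Suc 0)"
proof
  fix x assume "x \<in> J"
  then have "\<one> \<otimes> x \<in> carrier R \<cdot> J" by (intro ideal_prod.prod) auto
  then show "x \<in> J_pow (Suc 0)" using \<open>x \<in> J\<close> by simp
qed

lemma ideal_prod_least:
  assumes "right_ideal R K" "\<And>i j. i \<in> A \<Longrightarrow> j \<in> B \<Longrightarrow> i \<otimes> j \<in> K"
  shows "A \<cdot> B \<subseteq> K"
proof
  fix x assume "x \<in> A \<cdot> B"
  then show "x \<in> K"
    by (induction rule: ideal_prod.induct) (use assms right_idealD(4)[OF assms(1)] in auto)
qed

text \<open>The powers stabilise at some \<open>I\<close> with \<open>I = I \<cdot> J\<close>. If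
  \<open>I\<close> were nonzero, a minimal left ideal in \<open>J\<close> not killed by
  \<open>I\<close> would consist of the multiples \<open>j \<otimes> y\<close> with
  \<open>j \<in> J\<close> of one of its own elements \<open>y\<close>. Then
  \<open>y = j \<otimes> y\<close> for some such \<open>j\<close>, and invertibility of
  \<open>\<one> \<ominus> j\<close> makes \<open>y\<close> zero.\<close>

lemma J_nilpotent_of_dcc:
  assumes dcc: "dcc_on (\<lambda>L. left_ideal R L \<and> L \<subseteq> J)"
  shows "\<exists>n. J_pow n = {\<zero>}"
proof -
  obtain N where N: "\<forall>n\<ge>N. J_pow (Suc n) = J_pow (Suc N)"
    using dcc[unfolded dcc_on_def, rule_format, of "\<lambda>n. J_pow (Suc n)"] J_pow_left_ideal J_pow_Suc_subset
    by blast
  define I where "I = J_pow (Suc N)"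
  have idem: "I = I \<cdot> J" using N[rule_format, of "Suc N"] by (simp add: I_def)
  have Ir: "right_ideal R I" unfolding I_def by (rule J_pow_right_ideal)
  have Ic: "\<And>i. i \<in> I \<Longrightarrow> i \<in> carrier R" using right_idealD(2)[OF Ir] .
  have "I = {\<zero>}"
  proof (rule ccontr)
    assume nz: "I \<noteq> {\<zero>}"
    define P where "P L \<longleftrightarrow> left_ideal R L \<and> L \<subseteq> J \<and> (\<exists>i\<in>I. \<exists>l\<in>L. i \<otimes> l \<noteq> \<zero>)" for L
    have "P J"
    proof (rule ccontr)
      assume "\<not> P J"
      then have "I \<cdot> J \<subseteq> {\<zero>}" unfolding P_def by (intro ideal_prod_least) (auto simp: left_ideal_J)
      then show False using nz idem right_idealD(3)[OF Ir] by auto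
    qed
    then obtain L where L: "P L" and min: "\<forall>Z. P Z \<longrightarrow> Z \<subseteq> L \<longrightarrow> Z = L"
      using dcc_on_minimal[OF dcc, of P J] by (auto simp: P_def)
    obtain i y where iy: "i \<in> I" "y \<in> L" "i \<otimes> y \<noteq> \<zero>" using L unfolding P_def by blast
    have Ll: "left_ideal R L" "L \<subseteq> J" using L by (auto simp: P_def)
    have yJ: "y \<in> J" and yc: "y \<in> carrier R" using iy Ll by auto
    let ?L = "(\<lambda>j. j \<otimes> y) ` J"
    have L': "left_ideal R ?L"
      using ring.right_ideal_image[OF ring_opp', of J y] left_ideal_J yc by simp
    have sub: "?L \<subseteq> L" using left_idealD(5)[OF Ll(1)] iy by auto
    have "P ?L"
    proof (rule ccontr)
      assume "\<not> P ?L"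
      then have z: "i \<otimes> (j \<otimes> y) = \<zero>" if "i \<in> I" "j \<in> J" for i j
        using that L' sub Ll unfolding P_def by blast
      \<comment> \<open>The elements \<open>x\<close> with \<open>x \<otimes> y = \<zero>\<close>
        need not form a right ideal, as \<open>ideal_prod_least\<close> requires; hence the middle
        factor \<open>r\<close>.\<close>
      let ?K = "{x \<in> carrier R. \<forall>r\<in>carrier R. x \<otimes> r \<otimes> y = \<zero>}"
      have K: "right_ideal R ?K"
      proof (rule right_idealI)
        show "x \<otimes> s \<in> ?K" if x: "x \<in> ?K" and s: "s \<in> carrier R" for x s
        proof -
          have "x \<otimes> s \<otimes> r \<otimes> y = \<zero>" if r: "r \<in> carrier R" for r
          proof -
            have "x \<otimes> (s \<otimes> r) \<otimes> y = \<zero>" using x s r by blast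
            then show ?thesis using x s r by (simp add: m_assoc)
          qed
          then show ?thesis using x s by simp
        qed
      qed (use yc in \<open>auto simp: l_distr\<close>)
      have "I \<cdot> J \<subseteq> ?K"
      proof (rule ideal_prod_least[OF K])
        fix i j assume ij: "i \<in> I" "j \<in> J"
        have "i \<otimes> j \<otimes> r \<otimes> y = \<zero>" if "r \<in> carrier R" for r
          using z[OF ij(1) right_idealD(5)[OF right_ideal_J ij(2) that]] Ic[OF ij(1)] ij(2) that yc
          by (simp add: m_assoc)
        then show "i \<otimes> j \<in> ?K" using Ic ij by simp
      qed
      then have "i \<otimes> \<one> \<otimes> y = \<zero>" using idem iy by blast
      then show False using iy Ic by simp
    qed
    then have "?L = L" using min sub by blast
    then obtain j where j: "j \<in> J" "y = j \<otimes> y" using iy by blast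
    obtain z where z: "z \<in> carrier R" "z \<otimes> (\<one> \<ominus> j) = \<one>" using J_one_minus_inverse[OF j(1)] by blast
    have "(\<one> \<ominus> j) \<otimes> y = y \<ominus> j \<otimes> y" using j(1) yc by (simp add: a_minus_def l_distr l_minus)
    also have "\<dots> = \<zero>" using j yc by (simp add: add_minus_cancel)
    finally have "z \<otimes> ((\<one> \<ominus> j) \<otimes> y) = \<zero>" using z by simp
    moreover have "z \<otimes> ((\<one> \<ominus> j) \<otimes> y) = y" using z j(1) yc by (simp add: m_assoc[symmetric])
    ultimately have "y = \<zero>" by simp
    then show False using iy Ic by simp
  qed
  then show ?thesis unfolding I_def by blast
qed

text \<open>Sending \<open>r\<close> to \<open>x \<otimes> r\<close> maps the ring onto the quotient
  of \<open>rhull (insert x C)\<close> by \<open>C\<close> and kills \<open>J\<close>, so taking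
  preimages embeds this interval into the one above \<open>J\<close>.\<close>

lemma len_le_rhull_insert:
  assumes fin: "len_le (right_ideal R) J (carrier R) n"
    and C: "right_ideal R C" and x: "x \<in> carrier R" "\<And>j. j \<in> J \<Longrightarrow> x \<otimes> j \<in> C"
  shows "len_le (right_ideal R) C (rhull (insert x C)) n"
proof (rule len_le_embed[OF fin, where g = "\<lambda>D. {r \<in> carrier R. x \<otimes> r \<in> D}"])
  fix D assume "right_ideal R D" "C \<subseteq> D" "D \<subseteq> rhull (insert x C)"
  then show "right_ideal R {r \<in> carrier R. x \<otimes> r \<in> D} \<and> J \<subseteq> {r \<in> carrier R. x \<otimes> r \<in> D} \<and>
      {r \<in> carrier R. x \<otimes> r \<in> D} \<subseteq> carrier R"
    using x right_ideal_left_mult_preimage[of D x] by auto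
next
  fix D E assume D: "right_ideal R D" "right_ideal R E" "C \<subseteq> D" "D \<subset> E" "E \<subseteq> rhull (insert x C)"
  obtain e where e: "e \<in> E" "e \<notin> D" using D by blast
  then obtain c r where cr: "c \<in> C" "r \<in> carrier R" "e = c \<oplus> x \<otimes> r"
    using D(5) rhull_insert[OF C x(1)] by blast
  have cc: "c \<in> carrier R" using cr right_idealD(2)[OF C] by blast
  have "x \<otimes> r = e \<ominus> c" using cr(2,3) x(1) cc by (simp add: add_minus_cancel)
  moreover have "c \<in> E" using cr D by blast
  ultimately have "x \<otimes> r \<in> E" using right_idealD(7)[OF D(2) e(1), of c] by simp
  moreover have "x \<otimes> r \<notin> D" using right_idealD(4)[OF D(1)] e cr D by blast
  ultimately show "{r \<in> carrier R. x \<otimes> r \<in> D} \<subset> {r \<in> carrier R. x \<otimes> r \<in> E}"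
    using cr(2) D(4) by blast
qed

lemma finite_length_finitely_generated:
  assumes fin: "len_le (right_ideal R) J (carrier R) n"
    and A: "right_ideal R A" and X: "finite X"
  shows "X \<subseteq> carrier R \<Longrightarrow> (\<And>x j. x \<in> X \<Longrightarrow> j \<in> J \<Longrightarrow> x \<otimes> j \<in> A) \<Longrightarrow>
    \<exists>m. len_le (right_ideal R) A (rhull (A \<union> X)) m"
  using X
proof induction
  case empty
  then show ?case using len_le_trivial[of A A] by (auto simp: rhull_ideal[OF A])
next
  case (insert x X)
  let ?C = "rhull (A \<union> X)"
  have sub: "A \<union> X \<subseteq> carrier R" "{x} \<subseteq> carrier R" using insert right_idealD(1)[OF A] by auto
  have C: "right_ideal R ?C" using sub by (intro right_ideal_rhull)
  have AC: "A \<subseteq> ?C" using rhull_upper[of "A \<union> X"] by auto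
  obtain m where m: "len_le (right_ideal R) A ?C m" using insert by auto
  have "len_le (right_ideal R) ?C (rhull (insert x ?C)) n"
    using insert AC by (intro len_le_rhull_insert[OF fin C]) auto
  moreover have "rhull (insert x ?C) = rhull (A \<union> insert x X)"
    using rhull_union[OF sub] by simp
  moreover have "?C \<subseteq> rhull (A \<union> insert x X)" by (rule rhull_mono) auto
  moreover have "right_ideal R (rhull (A \<union> insert x X))" using sub by (intro right_ideal_rhull) auto
  ultimately have "len_le (right_ideal R) A (rhull (A \<union> insert x X)) (m + n)"
    by (intro len_le_add[OF C AC _ m]) auto
  then show ?case by blast
qed

text \<open>Adding one element of \<open>B\<close> costs at most \<open>n\<close> further steps, so
  a maximal \<open>D\<close> of finite length over \<open>A\<close> absorbs all of
  \<open>B\<close>.\<close>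

lemma finite_length_acc:
  assumes fin: "len_le (right_ideal R) J (carrier R) n"
    and A: "right_ideal R A" and B: "right_ideal R B" and AB: "A \<subseteq> B"
    and BJ: "\<And>b j. b \<in> B \<Longrightarrow> j \<in> J \<Longrightarrow> b \<otimes> j \<in> A"
    and acc: "acc_on (\<lambda>D. right_ideal R D \<and> A \<subseteq> D \<and> D \<subseteq> B)"
  shows "\<exists>m. len_le (right_ideal R) A B m"
proof -
  define Q where "Q D \<longleftrightarrow> right_ideal R D \<and> A \<subseteq> D \<and> D \<subseteq> B \<and> (\<exists>m. len_le (right_ideal R) A D m)" for D
  have "Q A" using A AB len_le_trivial[of A A] by (auto simp: Q_def)
  then obtain D where D: "Q D" and max: "\<forall>Z. Q Z \<longrightarrow> D \<subseteq> Z \<longrightarrow> Z = D"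
    using acc_on_maximal[OF acc, of Q A] by (auto simp: Q_def)
  have Dr: "right_ideal R D" "A \<subseteq> D" "D \<subseteq> B" using D by (auto simp: Q_def)
  obtain m where m: "len_le (right_ideal R) A D m" using D by (auto simp: Q_def)
  have "B \<subseteq> D"
  proof
    fix b assume b: "b \<in> B"
    have bc: "b \<in> carrier R" using right_idealD(2)[OF B b] .
    have E: "right_ideal R (rhull (insert b D))"
      using bc right_idealD(1)[OF Dr(1)] by (intro right_ideal_rhull) auto
    have sub: "D \<subseteq> rhull (insert b D)" "b \<in> rhull (insert b D)" using rhull_upper[of "insert b D"] by auto
    have "len_le (right_ideal R) D (rhull (insert b D)) n"
      using BJ[OF b] Dr bc by (intro len_le_rhull_insert[OF fin]) auto
    then have "len_le (right_ideal R) A (rhull (insert b D)) (m + n)"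
      using len_le_add[OF Dr(1,2) sub(1) m _ E] by blast
    moreover have "rhull (insert b D) \<subseteq> B" using B b Dr by (intro rhull_least) auto
    ultimately have "Q (rhull (insert b D))" using E sub Dr by (auto simp: Q_def)
    then show "b \<in> D" using max sub by blast
  qed
  then show ?thesis using m Dr by (metis subset_antisym)
qed

lemma finite_length_layers:
  assumes layer: "\<And>k. \<exists>m. len_le (right_ideal R) (J_pow (Suc k)) (J_pow k) m"
  shows "\<exists>m. len_le (right_ideal R) (J_pow k) (carrier R) m"
proof (induction k)
  case 0
  then show ?case using len_le_trivial[of "carrier R" "carrier R"] by auto
next
  case (Suc k)
  obtain m where "len_le (right_ideal R) (J_pow k) (carrier R) m" using Suc by blast
  moreover obtain m' where "len_le (right_ideal R) (J_pow (Suc k)) (J_pow k) m'" using layer by blast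
  ultimately show ?case
    using len_le_add[OF J_pow_right_ideal J_pow_Suc_subset(1) right_idealD(1)[OF J_pow_right_ideal]]
    by blast
qed

lemma finite_length_nilpotent_acc:
  assumes fin: "len_le (right_ideal R) J (carrier R) n" and nil: "J_pow N = {\<zero>}"
    and acc: "acc_on (\<lambda>D. right_ideal R D \<and> D \<subseteq> J)"
  shows "\<exists>m. len_le (right_ideal R) {\<zero>} (carrier R) m"
proof -
  have "\<exists>m. len_le (right_ideal R) (J_pow (Suc k)) (J_pow k) m" for k
  proof (cases k)
    \<comment> \<open>The top layer is out of reach of \<open>acc\<close>, which concerns ideals
      inside \<open>J\<close>; there the length bound \<open>fin\<close> is used.\<close>
    case 0
    then show ?thesis using len_le_subinterval[OF fin J_subset_J_pow_1, of "carrier R"] by auto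
  next
    case (Suc l)
    show ?thesis
    proof (rule finite_length_acc[OF fin J_pow_right_ideal J_pow_right_ideal J_pow_Suc_subset(1)])
      show "b \<otimes> j \<in> J_pow (Suc k)" if "b \<in> J_pow k" "j \<in> J" for b j
        using ideal_prod.prod[OF that] by simp
      show "acc_on (\<lambda>D. right_ideal R D \<and> J_pow (Suc k) \<subseteq> D \<and> D \<subseteq> J_pow k)"
        using J_pow_Suc_subset(2)[of l] Suc by (intro acc_on_mono[OF acc]) blast
    qed
  qed
  from finite_length_layers[OF this, of N] show ?thesis unfolding nil .
qed

lemma quasi_Frobenius_of_chain_conditions:
  assumes "small_dual R" "len_le (right_ideal R) J (carrier R) n"
    "acc_on (\<lambda>D. right_ideal R D \<and> D \<subseteq> J)" "dcc_on (\<lambda>L. left_ideal R L \<and> L \<subseteq> J)"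
  shows "quasi_Frobenius R"
  using finite_length_nilpotent_acc[OF assms(2) _ assms(3)] J_nilpotent_of_dcc[OF assms(4)]
    finite_length_quasi_Frobenius[OF assms(1)] by blast

lemma right_ideal_right_socle: "right_ideal R (right_socle R)"
proof -
  let ?U = "\<Union>{I. minimal_right_ideal R I}"
  have U: "?U \<subseteq> carrier R" by (auto simp: minimal_right_ideal_def dest: right_idealD)
  have "x \<otimes> r \<in> right_socle R" if "x \<in> right_socle R" and r: "r \<in> carrier R" for x r
    using that(1) unfolding right_socle_def
  proof (induction rule: generate.induct)
    case one
    then show ?case using generate.one[of "add_monoid R" ?U] r by simp
  next
    case (incl h)
    then have "h \<otimes> r \<in> ?U" using r by (auto simp: minimal_right_ideal_def dest: right_idealD)
    then show ?case by (rule generate.incl)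
  next
    case (inv h)
    then have "h \<otimes> r \<in> ?U" using r by (auto simp: minimal_right_ideal_def dest: right_idealD)
    then have "inv\<^bsub>add_monoid R\<^esub> (h \<otimes> r) \<in> generate (add_monoid R) ?U" by (rule generate.inv)
    moreover have "\<ominus> (h \<otimes> r) = (\<ominus> h) \<otimes> r" using inv U r by (simp add: l_minus subset_iff)
    ultimately show ?case by (simp add: a_inv_def)
  next
    case (eng h1 h2)
    have "h1 \<in> carrier R" "h2 \<in> carrier R"
      using eng.hyps add.generate_in_carrier[OF U] by auto
    then show ?case using generate.eng[OF eng.IH] r by (simp add: l_distr)
  qed
  then show ?thesis
    unfolding right_ideal_def additive_subgroup_def
    using add.generate_is_subgroup[OF U] unfolding right_socle_def by blast
qed

lemma minimal_subset_right_socle: "minimal_right_ideal R I \<Longrightarrow> I \<subseteq> right_socle R"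
  unfolding right_socle_def by (auto intro: generate.incl)

lemma right_socle_least:
  assumes "right_ideal R K" "\<And>I. minimal_right_ideal R I \<Longrightarrow> I \<subseteq> K"
  shows "right_socle R \<subseteq> K"
  unfolding right_socle_def
  using assms by (intro add.generate_subgroup_incl)
    (auto simp: right_ideal_def additive_subgroup_def)

lemma right_socle_essential:
  assumes "right_artinian R"
  shows "essential_right R (right_socle R) (carrier R)"
  unfolding essential_right_def
proof (intro conjI allI impI right_ideal_right_socle right_ideal_carrier right_idealD(1))
  fix K assume K: "right_ideal R K \<and> K \<subseteq> carrier R \<and> K \<noteq> {\<zero>}"
  define P where "P D \<longleftrightarrow> right_ideal R D \<and> D \<noteq> {\<zero>} \<and> D \<subseteq> K" for D
  obtain I where I: "P I" and min: "\<forall>Z. P Z \<longrightarrow> Z \<subseteq> I \<longrightarrow> Z = I"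
    using dcc_on_minimal[OF assms[unfolded right_artinian_def], of P K] K by (auto simp: P_def)
  then have "minimal_right_ideal R I" unfolding minimal_right_ideal_def P_def by blast
  then have "I \<subseteq> right_socle R \<inter> K" using minimal_subset_right_socle I by (auto simp: P_def)
  then show "right_socle R \<inter> K \<noteq> {\<zero>}"
    using I right_idealD(3)[of I] by (auto simp: P_def)
qed

lemma semisimple_of_zero_radical:
  assumes J: "J = {\<zero>}" and fin: "len_le (right_ideal R) {\<zero>} (carrier R) n"
  shows "semisimple_artinian R"
  unfolding semisimple_artinian_def
proof
  obtain X where X: "\<forall>k\<in>X. simple_mod {\<zero>} k" "rhull ({\<zero>} \<union> X) = carrier R"
    using simple_mod_J_generate[of n] fin unfolding J by blast
  have "k \<in> right_socle R" if "k \<in> X" for k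
  proof -
    have k: "simple_mod {\<zero>} k" using X that by blast
    then have "k \<in> (\<otimes>) k ` carrier R"
      using simple_mod_zeroD(1) by (intro image_eqI[of _ _ \<one>]) auto
    then show ?thesis
      using minimal_subset_right_socle simple_mod_minimal_right_ideal[OF k] by blast
  qed
  then have "rhull ({\<zero>} \<union> X) \<subseteq> right_socle R"
    using right_idealD(3)[OF right_ideal_right_socle] by (intro rhull_least right_ideal_right_socle) auto
  then show "right_socle R = carrier R"
    using X(2) right_idealD(1)[OF right_ideal_right_socle] by auto
  show "right_artinian R"
    unfolding right_artinian_def
    by (rule dcc_on_mono[OF len_le_dcc[OF fin]]) (auto dest: right_idealD)
qed

text \<open>The only small ideal is zero, the annihilator of the whole ring. This is what allows the
  quotient by the radical to exchange left and right lengths.\<close>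

lemma small_dual_of_zero_radical:
  assumes J: "J = {\<zero>}"
  shows "small_dual R"
proof -
  have "right_annihilator R {\<zero>}" "left_annihilator R {\<zero>}"
    unfolding right_annihilator_def left_annihilator_def
    by (intro exI[of _ "carrier R"]; simp add: right_ann_carrier left_ann_carrier)+
  moreover have "I = {\<zero>}" if "small_right_ideal R I" for I
    using that right_idealD(3)[of I] unfolding small_right_ideal_iff J by auto
  moreover have "I = {\<zero>}" if "small_left_ideal R I" for I
    using that ring.small_right_ideal_iff[OF ring_opp', of I] left_idealD(3)[of I] J by auto
  ultimately show ?thesis
    unfolding small_dual_def right_small_dual_def left_small_dual_def by metis
qed

end

section \<open>Passing to the quotient by the radical\<close>

text \<open>An abstract surjection spares computations with cosets, and it remains one between the
  opposite rings.\<close>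

locale surj_ring_hom = ring_hom_ring R S h for R S h +
  assumes surj: "h ` carrier R = carrier S"
begin

lemma surj_ring_hom_opp: "surj_ring_hom (opp R) (opp S) h"
proof -
  have "h \<in> ring_hom (opp R) (opp S)"
    using homh by (auto simp: ring_hom_def)
  then show ?thesis
    using surj by (intro surj_ring_hom.intro ring_hom_ringI2 surj_ring_hom_axioms.intro) auto
qed

abbreviation Ker :: "'a set" where "Ker \<equiv> {x \<in> carrier R. h x = \<zero>\<^bsub>S\<^esub>}"

lemma right_ideal_image_hom:
  assumes I: "right_ideal R I"
  shows "right_ideal S (h ` I)"
proof (rule S.right_idealI)
  note ID = R.right_idealD[OF I]
  show "h ` I \<subseteq> carrier S" using ID(2) by auto
  show "\<zero>\<^bsub>S\<^esub> \<in> h ` I" using ID(3) by (intro image_eqI[of _ _ "\<zero>\<^bsub>R\<^esub>"]) auto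
  show "x \<oplus>\<^bsub>S\<^esub> y \<in> h ` I" if xy: "x \<in> h ` I" "y \<in> h ` I" for x y
  proof -
    obtain a b where "a \<in> I" "x = h a" "b \<in> I" "y = h b" using xy by blast
    moreover from this have "x \<oplus>\<^bsub>S\<^esub> y = h (a \<oplus>\<^bsub>R\<^esub> b)" using ID(2) by simp
    ultimately show ?thesis using ID(4) by blast
  qed
  show "x \<otimes>\<^bsub>S\<^esub> s \<in> h ` I" if xs: "x \<in> h ` I" "s \<in> carrier S" for x s
  proof -
    have "s \<in> h ` carrier R" using xs surj by simp
    then obtain a b where "a \<in> I" "x = h a" "b \<in> carrier R" "s = h b" using xs by blast
    moreover from this have "x \<otimes>\<^bsub>S\<^esub> s = h (a \<otimes>\<^bsub>R\<^esub> b)" using ID(2) by simp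
    ultimately show ?thesis using ID(5) by blast
  qed
qed

lemma right_ideal_vimage_hom:
  assumes K: "right_ideal S K"
  shows "right_ideal R {x \<in> carrier R. h x \<in> K}"
  using S.right_idealD[OF K] by (intro R.right_idealI) auto

lemma image_vimage_hom: "K \<subseteq> carrier S \<Longrightarrow> h ` {x \<in> carrier R. h x \<in> K} = K"
  unfolding surj[symmetric] by blast

lemma vimage_image_hom:
  assumes I: "right_ideal R I" "Ker \<subseteq> I"
  shows "{x \<in> carrier R. h x \<in> h ` I} = I"
proof
  note ID = R.right_idealD[OF I(1)]
  show "{x \<in> carrier R. h x \<in> h ` I} \<subseteq> I"
  proof
    fix x assume "x \<in> {x \<in> carrier R. h x \<in> h ` I}"
    then obtain y where y: "x \<in> carrier R" "y \<in> I" "h x = h y" by blast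
    have yc: "y \<in> carrier R" using ID(2) y by blast
    have "h (x \<ominus>\<^bsub>R\<^esub> y) = h x \<ominus>\<^bsub>S\<^esub> h y" using y(1) yc by (simp add: R.minus_eq S.minus_eq)
    then have "x \<ominus>\<^bsub>R\<^esub> y \<in> I" using y yc I(2) by (auto simp: S.add_minus_cancel)
    then have "(x \<ominus>\<^bsub>R\<^esub> y) \<oplus>\<^bsub>R\<^esub> y \<in> I" using ID(4) y by blast
    then show "x \<in> I" using y(1) yc by (simp add: R.add_minus_cancel)
  qed
qed (use R.right_idealD(2)[OF I(1)] in auto)

lemma len_le_image:
  assumes "len_le (right_ideal R) Ker (carrier R) n"
  shows "len_le (right_ideal S) {\<zero>\<^bsub>S\<^esub>} (carrier S) n"
proof (rule len_le_embed[OF assms, where g = "\<lambda>K. {x \<in> carrier R. h x \<in> K}"])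
  fix D E assume "D \<subset> E" "E \<subseteq> carrier S"
  moreover from this have "D \<subseteq> carrier S" by auto
  ultimately have "{x \<in> carrier R. h x \<in> D} \<noteq> {x \<in> carrier R. h x \<in> E}"
    using image_vimage_hom[of D] image_vimage_hom[of E] by (metis psubset_eq)
  then show "{x \<in> carrier R. h x \<in> D} \<subset> {x \<in> carrier R. h x \<in> E}" using \<open>D \<subset> E\<close> by blast
qed (auto intro: right_ideal_vimage_hom)

lemma len_le_vimage:
  assumes "len_le (right_ideal S) {\<zero>\<^bsub>S\<^esub>} (carrier S) n"
  shows "len_le (right_ideal R) Ker (carrier R) n"
proof (rule len_le_embed[OF assms, where g = "\<lambda>I. h ` I"])
  fix D assume "right_ideal R D" "Ker \<subseteq> D" "D \<subseteq> carrier R"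
  then show "right_ideal S (h ` D) \<and> {\<zero>\<^bsub>S\<^esub>} \<subseteq> h ` D \<and> h ` D \<subseteq> carrier S"
    using right_ideal_image_hom S.right_idealD(1,3) by blast
next
  fix D E assume *: "right_ideal R D" "right_ideal R E" "Ker \<subseteq> D" "D \<subset> E" "E \<subseteq> carrier R"
  then have "Ker \<subseteq> E" by blast
  have "h ` D \<noteq> h ` E"
  proof
    assume eq: "h ` D = h ` E"
    have "D = E"
      using trans[OF vimage_image_hom[OF *(1,3), unfolded eq, symmetric]
        vimage_image_hom[OF *(2) \<open>Ker \<subseteq> E\<close>]] .
    then show False using *(4) by blast
  qed
  moreover have "h ` D \<subseteq> h ` E" using *(4) by (intro image_mono) auto
  ultimately show "h ` D \<subset> h ` E" by (rule psubsetI[rotated])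
qed

lemma dcc_vimage:
  assumes "dcc_on (right_ideal S)"
  shows "dcc_on (\<lambda>D. right_ideal R D \<and> Ker \<subseteq> D \<and> D \<subseteq> carrier R)"
  unfolding dcc_on_def
proof (intro allI impI)
  fix C assume C: "(\<forall>n. right_ideal R (C n) \<and> Ker \<subseteq> C n \<and> C n \<subseteq> carrier R) \<and> (\<forall>n. C (Suc n) \<subseteq> C n)"
  have "(\<forall>n. right_ideal S (h ` C n)) \<and> (\<forall>n. h ` C (Suc n) \<subseteq> h ` C n)"
  proof (intro conjI allI)
    show "right_ideal S (h ` C n)" "h ` C (Suc n) \<subseteq> h ` C n" for n
      using right_ideal_image_hom[of "C n"] C image_mono[of "C (Suc n)" "C n"] by simp_all
  qed
  then have "\<exists>N. \<forall>n\<ge>N. h ` C n = h ` C N"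
    using mp[OF spec[OF assms[unfolded dcc_on_def], of "\<lambda>n. h ` C n"]] by simp
  then obtain N where N: "\<forall>n\<ge>N. h ` C n = h ` C N" by (elim exE)
  have eq: "{x \<in> carrier R. h x \<in> h ` C n} = C n" for n using C by (intro vimage_image_hom) auto
  have "C n = C N" if "n \<ge> N" for n
    using trans[OF eq[of n, unfolded N[rule_format, OF that], symmetric] eq[of N]] .
  then show "\<exists>N. \<forall>n\<ge>N. C n = C N" by blast
qed

text \<open>The kernel lies in every maximal right ideal \<open>M\<close>, so the image of
  \<open>M\<close> is again maximal and has \<open>M\<close> as its preimage.\<close>

lemma radical_image:
  assumes Ker: "Ker = jacobson_radical R"
  shows "jacobson_radical S = {\<zero>\<^bsub>S\<^esub>}"
proof
  show "{\<zero>\<^bsub>S\<^esub>} \<subseteq> jacobson_radical S"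
    using S.right_idealD(3)[OF S.right_ideal_J] by blast
  show "jacobson_radical S \<subseteq> {\<zero>\<^bsub>S\<^esub>}"
  proof
    fix y assume y: "y \<in> jacobson_radical S"
    then have "y \<in> h ` carrier R" using surj by simp
    then obtain x where x: "x \<in> carrier R" "y = h x" by blast
    have "x \<in> M" if M: "maximal_right_ideal R M" for M
    proof -
      note Mr = R.maximal_right_idealD(1,2)[OF M]
      have sub: "Ker \<subseteq> M" unfolding Ker by (rule R.J_subset_maximal[OF M])
      note Mv = vimage_image_hom[OF Mr(1) sub]
      have "K = h ` M \<or> K = carrier S" if K: "right_ideal S K" "h ` M \<subseteq> K" for K
      proof -
        let ?K = "{x \<in> carrier R. h x \<in> K}"
        have "right_ideal R ?K" using right_ideal_vimage_hom[OF K(1)] .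
        moreover have "M \<subseteq> ?K" using K R.right_idealD(1)[OF Mr(1)] by blast
        ultimately have "?K = M \<or> ?K = carrier R" using M unfolding maximal_right_ideal_def by blast
        moreover have "h ` ?K = K" using image_vimage_hom[OF S.right_idealD(1)[OF K(1)]] .
        ultimately show ?thesis using surj by auto
      qed
      moreover have "h ` M \<noteq> carrier S" using Mv Mr(2) surj by auto
      ultimately have "maximal_right_ideal S (h ` M)"
        using right_ideal_image_hom[OF Mr(1)] unfolding maximal_right_ideal_def by blast
      then have "h x \<in> h ` M" using S.J_subset_maximal y x by blast
      then show ?thesis using Mv x by blast
    qed
    then have "x \<in> Ker" unfolding Ker jacobson_radical_def using x(1) by blast
    then show "y \<in> {\<zero>\<^bsub>S\<^esub>}" using x by blast
  qed
qed

text \<open>The image has zero radical and is therefore small dual, so annihilators carry its finite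
  length from right to left ideals; the opposite homomorphism pulls the bound back.\<close>

lemma len_le_left_of_right:
  assumes Ker: "Ker = jacobson_radical R"
    and fin: "len_le (right_ideal R) (jacobson_radical R) (carrier R) n"
  shows "len_le (left_ideal R) (jacobson_radical R) (carrier R) n"
proof -
  have "len_le (right_ideal S) {\<zero>\<^bsub>S\<^esub>} (carrier S) n" using len_le_image fin Ker by simp
  then have "len_le (left_ideal S) {\<zero>\<^bsub>S\<^esub>} (carrier S) n"
    using S.finite_length_left_of_right S.small_dual_of_zero_radical radical_image[OF Ker] by blast
  then show ?thesis
    using surj_ring_hom.len_le_vimage[OF surj_ring_hom_opp, of n] Ker by simp
qed

end

context ring
begin

lemma surj_ring_hom_quotient:
  "surj_ring_hom R (R Quot J) ((+>) J)" "{x \<in> carrier R. J +> x = \<zero>\<^bsub>R Quot J\<^esub>} = J"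
proof -
  interpret I: ideal J R by (rule ideal_J)
  show "surj_ring_hom R (R Quot J) ((+>) J)"
    by (intro surj_ring_hom.intro I.rcos_ring_hom_ring surj_ring_hom_axioms.intro)
      (auto simp: FactRing_simps)
  show "{x \<in> carrier R. J +> x = \<zero>\<^bsub>R Quot J\<^esub>} = J"
    using I.a_rcos_const I.a_rcos_self by (auto simp: FactRing_def)
qed

lemma semilocal_iff: "semilocal R \<longleftrightarrow> (\<exists>n. len_le (right_ideal R) J (carrier R) n)"
proof -
  interpret h: surj_ring_hom R "R Quot J" "(+>) J" by (rule surj_ring_hom_quotient)
  note Ker = surj_ring_hom_quotient(2)
  show ?thesis
  proof
    assume "semilocal R"
    then have "dcc_on (right_ideal (R Quot J))"
      by (simp add: semilocal_def semisimple_artinian_def right_artinian_def)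
    then show "\<exists>n. len_le (right_ideal R) J (carrier R) n"
      using dcc_above_J_finite_length h.dcc_vimage unfolding Ker by blast
  next
    assume "\<exists>n. len_le (right_ideal R) J (carrier R) n"
    then obtain n where "len_le (right_ideal R) J (carrier R) n" by blast
    then show "semilocal R"
      unfolding semilocal_def
      using h.S.semisimple_of_zero_radical[OF h.radical_image[OF Ker], of n] h.len_le_image[of n] Ker by simp
  qed
qed

lemma len_le_J_left_of_right:
  "len_le (right_ideal R) J (carrier R) n \<Longrightarrow> len_le (left_ideal R) J (carrier R) n"
  using surj_ring_hom.len_le_left_of_right[OF surj_ring_hom_quotient] by blast

lemma len_le_J_right_of_left:
  "len_le (left_ideal R) J (carrier R) n \<Longrightarrow> len_le (right_ideal R) J (carrier R) n"
  using ring.len_le_J_left_of_right[OF ring_opp', of n] by simp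

lemma semilocal_small_dualI:
  "small_dual R \<Longrightarrow> len_le (right_ideal R) J (carrier R) n \<Longrightarrow> semilocal_small_dual R n"
  using len_le_J_left_of_right
  by (intro semilocal_small_dual.intro ring_axioms semilocal_small_dual_axioms.intro)

end

section \<open>Chain conditions imply quasi-Frobenius\<close>

context ring
begin

lemma right_ideal_of_right_annihilator: "right_annihilator R I \<Longrightarrow> right_ideal R I"
  using right_ideal_right_ann by (auto simp: right_annihilator_def)

lemma quasi_Frobenius_of_acc_annihilators:
  assumes dual: "small_dual R" and fin: "len_le (right_ideal R) J (carrier R) n"
    and acc: "acc_on (right_annihilator R)"
  shows "quasi_Frobenius R"
proof (rule quasi_Frobenius_of_chain_conditions[OF dual fin])
  show "acc_on (\<lambda>D. right_ideal R D \<and> D \<subseteq> J)"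
    using dual by (intro acc_on_mono[OF acc])
      (auto simp: small_dual_def right_small_dual_def small_right_ideal_iff)
  show "dcc_on (\<lambda>L. left_ideal R L \<and> L \<subseteq> J)"
  proof (rule dcc_on_antitone[OF acc, where f = "right_ann R" and g = "left_ann R"])
    show "right_annihilator R (right_ann R L)" if "left_ideal R L \<and> L \<subseteq> J" for L
      using that left_idealD(1) unfolding right_annihilator_def by blast
    show "left_ann R (right_ann R L) = L" if "left_ideal R L \<and> L \<subseteq> J" for L
      using that dual left_small_dualD by (auto simp: small_dual_def)
  qed (rule right_ann_antimono)
qed

text \<open>A chain is controlled by its traces on \<open>S\<close> and its sums with
  \<open>S\<close>: once both are constant, the modular law makes its members equal.\<close>

lemma acc_right_ideal_extension:
  assumes S: "right_ideal R S" and fin: "acc_on (\<lambda>D. right_ideal R D \<and> D \<subseteq> S)"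
    and acc: "acc_on (\<lambda>D. right_ideal R D \<and> S \<subseteq> D)"
  shows "acc_on (right_ideal R)"
  unfolding acc_on_def
proof (intro allI impI)
  fix C assume C: "(\<forall>n. right_ideal R (C n)) \<and> (\<forall>n. C n \<subseteq> C (Suc n))"
  then have Cr: "right_ideal R (C n)" for n by blast
  have mono: "C m \<subseteq> C n" if "m \<le> n" for m n using lift_Suc_mono_le[of C] C that by blast
  have "(\<forall>n. right_ideal R (C n \<inter> S) \<and> C n \<inter> S \<subseteq> S) \<and> (\<forall>n. C n \<inter> S \<subseteq> C (Suc n) \<inter> S)"
    using C right_ideal_Int[OF _ S] by blast
  then have "\<exists>N. \<forall>n\<ge>N. C n \<inter> S = C N \<inter> S"
    using mp[OF spec[OF fin[unfolded acc_on_def], of "\<lambda>n. C n \<inter> S"]] by simp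
  then obtain N where N: "\<forall>n\<ge>N. C n \<inter> S = C N \<inter> S" by (elim exE)
  have "(\<forall>n. right_ideal R (C n <+> S) \<and> S \<subseteq> C n <+> S) \<and> (\<forall>n. C n <+> S \<subseteq> C (Suc n) <+> S)"
    using right_ideal_set_add[OF Cr S] set_add_upper2[OF Cr S] C by (simp add: set_add_mono)
  then have "\<exists>N. \<forall>n\<ge>N. C n <+> S = C N <+> S"
    using mp[OF spec[OF acc[unfolded acc_on_def], of "\<lambda>n. C n <+> S"]] by simp
  then obtain M where M: "\<forall>n\<ge>M. C n <+> S = C M <+> S" by (elim exE)
  have "C n = C (max M N)" if n: "n \<ge> max M N" for n
  proof
    let ?m = "max M N"
    have add: "C n <+> S = C ?m <+> S"
      using trans[OF M[rule_format, of n] M[rule_format, of ?m, symmetric]] n by simp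
    have int: "C n \<inter> S = C ?m \<inter> S"
      using trans[OF N[rule_format, of n] N[rule_format, of ?m, symmetric]] n by simp
    show "C ?m \<subseteq> C n" using mono[OF n] .
    have "C n \<subseteq> (C ?m <+> S) \<inter> C n" using set_add_upper1[OF Cr S, of n] unfolding add by blast
    also have "\<dots> = C ?m <+> (S \<inter> C n)" by (rule modular_law[OF Cr S Cr mono[OF n]])
    also have "\<dots> \<subseteq> C ?m" using int by (intro set_add_least[OF Cr]) auto
    finally show "C n \<subseteq> C ?m" .
  qed
  then show "\<exists>N. \<forall>n\<ge>N. C n = C N" by blast
qed

end

context semilocal_small_dual
begin

text \<open>Every right ideal above \<open>right_ann R J\<close> is essential because
  \<open>right_ann R J\<close> is, and below it the length is finite. So all right ideals satisfy
  the ascending chain condition, right annihilators in particular.\<close>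

lemma quasi_Frobenius_of_acc_essential:
  assumes acc: "acc_on (\<lambda>I. essential_right R I (carrier R))"
  shows "quasi_Frobenius R"
proof -
  let ?S = "right_ann R J"
  have S: "right_ideal R ?S" by (rule right_ideal_right_ann[OF J_subset_carrier])
  have "acc_on (right_ideal R)"
  proof (rule acc_right_ideal_extension[OF S])
    show "acc_on (\<lambda>D. right_ideal R D \<and> D \<subseteq> ?S)"
      by (rule acc_on_mono[OF len_le_acc[OF finite_length_right_ann_J]]) (auto dest: right_idealD)
    have "essential_right R D (carrier R)" if D: "right_ideal R D" "?S \<subseteq> D" for D
      unfolding essential_right_def
    proof (intro conjI allI impI D right_ideal_carrier right_idealD(1))
      fix K assume K: "right_ideal R K \<and> K \<subseteq> carrier R \<and> K \<noteq> {\<zero>}"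
      then have "?S \<inter> K \<noteq> {\<zero>}" using right_ann_J_essential unfolding essential_right_def by blast
      moreover have "\<zero> \<in> ?S \<inter> K" using right_idealD(3) S K by blast
      ultimately show "D \<inter> K \<noteq> {\<zero>}" using D(2) by blast
    qed
    then show "acc_on (\<lambda>D. right_ideal R D \<and> ?S \<subseteq> D)" by (intro acc_on_mono[OF acc]) blast
  qed
  then have "acc_on (right_annihilator R)" by (rule acc_on_mono) (rule right_ideal_of_right_annihilator)
  then show ?thesis by (rule quasi_Frobenius_of_acc_annihilators[OF small_dual fin_right])
qed

end

context ring
begin

text \<open>
  If the right socle is essential, its left annihilator is the right singular ideal, which is nil
  under the ascending chain condition on right annihilators.
\<close>

lemma left_ann_right_socle_nil:
  assumes acc: "acc_on (right_annihilator R)"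
    and ess: "essential_right R (right_socle R) (carrier R)"
    and x: "x \<in> left_ann R (right_socle R)"
  shows "\<exists>n. x [^] (n::nat) = \<zero>"
proof -
  have xc: "x \<in> carrier R" using x by (simp add: left_ann_def)
  let ?C = "\<lambda>n::nat. right_ann R {x [^] n}"
  have "?C n \<subseteq> ?C (Suc n)" for n
  proof
    fix a assume "a \<in> ?C n"
    then have a: "a \<in> carrier R" "x [^] n \<otimes> a = \<zero>" by (auto simp: right_ann_def)
    have "x [^] Suc n \<otimes> a = x \<otimes> (x [^] n \<otimes> a)"
      using nat_pow_Suc2[OF xc, of n] xc a(1) by (simp only: m_assoc nat_pow_closed)
    then show "a \<in> ?C (Suc n)" using a xc unfolding right_ann_def by simp
  qed
  moreover have "right_annihilator R (?C n)" for n
    using xc unfolding right_annihilator_def by (intro exI[of _ "{x [^] n}"]) simp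
  ultimately have "\<exists>N. \<forall>n\<ge>N. ?C n = ?C N"
    using mp[OF spec[OF acc[unfolded acc_on_def], of ?C]] by simp
  then obtain N where N: "\<forall>n\<ge>N. ?C n = ?C N" by (elim exE)
  let ?y = "x [^] Suc N"
  have yc: "?y \<in> carrier R" using xc by simp
  \<comment> \<open>Thus \<open>?y\<close> and its square have the same right annihilator. A socle
    element \<open>?y \<otimes> r\<close> is killed by \<open>x\<close>, hence by \<open>?y\<close>;
    so the square kills \<open>r\<close>, and already \<open>?y\<close> does.\<close>
  have eq: "?C (Suc N + Suc N) = ?C (Suc N)"
    using trans[OF N[rule_format, of "Suc N + Suc N"] N[rule_format, of "Suc N", symmetric]] by simp
  have "?y = \<zero>"
  proof (rule ccontr)
    assume nz: "?y \<noteq> \<zero>"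
    let ?K = "(\<otimes>) ?y ` carrier R"
    have K: "right_ideal R ?K" using yc by (intro right_ideal_image) auto
    have "?y \<in> ?K" by (rule image_eqI[of _ _ \<one>]) (use yc in \<open>simp_all only: r_one one_closed\<close>)
    then have "?K \<noteq> {\<zero>}" using nz by blast
    then have "right_socle R \<inter> ?K \<noteq> {\<zero>}"
      using ess K right_idealD(1)[OF K] unfolding essential_right_def by blast
    moreover have "\<zero> \<in> right_socle R \<inter> ?K"
      using right_idealD(3)[OF K] right_idealD(3)[OF right_ideal_right_socle] by blast
    ultimately obtain z where z: "z \<in> right_socle R" "z \<in> ?K" "z \<noteq> \<zero>" by blast
    obtain r where r: "r \<in> carrier R" "z = ?y \<otimes> r" using z(2) by blast
    have zc: "z \<in> carrier R" using r yc by simp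
    have "x \<otimes> z = \<zero>" using x z by (auto simp: left_ann_def)
    then have "?y \<otimes> z = \<zero>" using xc zc by (simp add: m_assoc)
    then have "x [^] (Suc N + Suc N) \<otimes> r = \<zero>"
      using xc yc r nat_pow_mult[of x "Suc N" "Suc N"] m_assoc[of ?y ?y r] by simp
    then have "r \<in> ?C (Suc N + Suc N)" using r by (simp add: right_ann_def)
    then have "r \<in> ?C (Suc N)" unfolding eq .
    then show False using r z by (simp add: right_ann_def)
  qed
  then show ?thesis by blast
qed

text \<open>With \<open>\<one> = y \<oplus> m\<close> and \<open>m\<close> in a maximal left ideal
  \<open>M\<close>, induction gives \<open>\<one> \<ominus> y [^] k \<in> M\<close> for all
  \<open>k\<close>; nilpotence of \<open>y\<close> then puts \<open>\<one>\<close> into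
  \<open>M\<close>.\<close>

lemma nil_left_ideal_subset_J:
  assumes L: "left_ideal R L" and nil: "\<And>x. x \<in> L \<Longrightarrow> \<exists>n. x [^] (n::nat) = \<zero>"
  shows "L \<subseteq> J"
proof -
  interpret O: ring "opp R" by simp
  have "L \<subseteq> M" if M: "maximal_right_ideal (opp R) M" for M
  proof (rule ccontr)
    assume "\<not> L \<subseteq> M"
    note Ml = O.maximal_right_idealD(1)[OF M, unfolded ideal_notions_opp]
    have "L <+> M = carrier R" using O.maximal_right_idealD(4)[OF M, of L] L \<open>\<not> L \<subseteq> M\<close> by simp
    then have "\<one> \<in> L <+> M" by simp
    then obtain y m where ym: "y \<in> L" "m \<in> M" "\<one> = y \<oplus> m" unfolding mem_set_add by blast
    have yc: "y \<in> carrier R" "m \<in> carrier R" using ym left_idealD(2) L Ml by auto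
    have m: "\<one> \<ominus> y = m" using ym(3) yc by (simp add: add_minus_cancel)
    have "\<one> \<ominus> y [^] k \<in> M" for k :: nat
    proof (induction k)
      case 0
      have "\<one> \<ominus> \<one> = \<zero>" by (simp add: add_minus_cancel)
      then show ?case using left_idealD(3)[OF Ml] by simp
    next
      case (Suc k)
      have "\<one> \<ominus> y [^] Suc k = (\<one> \<ominus> y [^] k) \<oplus> y [^] k \<otimes> (\<one> \<ominus> y)"
        using yc by (simp add: a_minus_def r_distr r_minus a_assoc[symmetric])
          (simp add: a_assoc l_neg)
      then show ?case using Suc left_idealD(4,5)[OF Ml] ym yc unfolding m by simp
    qed
    moreover obtain n :: nat where "y [^] n = \<zero>" using nil ym by blast
    ultimately have "\<one> \<ominus> \<zero> \<in> M" by metis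
    then show False using O.maximal_right_idealD(3)[OF M] by (simp add: a_minus_def)
  qed
  then have "L \<subseteq> jacobson_radical (opp R)"
    using left_idealD(1)[OF L] unfolding jacobson_radical_def by auto
  then show ?thesis by simp
qed

text \<open>The left annihilator of a minimal right ideal contains \<open>J\<close> and lies at most
  one step below the ring. By the descending chain condition on left annihilators, a minimal
  \<open>K\<close> with finite length above it is contained in all of these, so it annihilates the
  socle; and the left annihilator of the socle is nil, hence inside \<open>J\<close>.\<close>

lemma semilocal_of_essential_socle:
  assumes dual: "left_small_dual R" and acc: "acc_on (right_annihilator R)"
    and ess: "essential_right R (right_socle R) (carrier R)"
  shows "\<exists>n. len_le (left_ideal R) J (carrier R) n"
proof -
  interpret O: ring "opp R" by simp
  let ?L = "left_ann R (right_socle R)"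
  have LJ: "?L \<subseteq> J"
    using left_ann_right_socle_nil[OF acc ess] right_idealD(1)[OF right_ideal_right_socle]
    by (intro nil_left_ideal_subset_J left_ideal_left_ann)
  have kill: "J \<subseteq> left_ann R I" if I: "minimal_right_ideal R I" for I
  proof
    fix j assume j: "j \<in> J"
    have "j \<otimes> k = \<zero>" if "k \<in> I" for k
      using J_mult_simple[OF dual minimal_right_ideal_simple_mod[OF I that] j] j
      by (cases "k = \<zero>") auto
    then show "j \<in> left_ann R I" using j by (simp add: left_ann_def)
  qed
  have dcc: "dcc_on (left_annihilator R)"
  proof (rule dcc_on_antitone[OF acc, where f = "right_ann R" and g = "left_ann R"])
    have sub: "L \<subseteq> carrier R" if "left_annihilator R L" for L
      using that left_ann_subset by (auto simp: left_annihilator_def)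
    show "right_annihilator R (right_ann R L)" if "left_annihilator R L" for L
      using sub[OF that] unfolding right_annihilator_def by blast
    show "left_ann R (right_ann R L) = L" if "left_annihilator R L" for L
      using sub[OF that] left_annihilator_iff that by blast
  qed (rule right_ann_antimono)
  define Q where "Q K \<longleftrightarrow> left_annihilator R K \<and> J \<subseteq> K \<and> (\<exists>n. len_le (left_ideal R) K (carrier R) n)" for K
  have "left_annihilator R (carrier R)"
    unfolding left_annihilator_def by (intro exI[of _ "{\<zero>}"]) (simp add: left_ann_zero)
  then have "Q (carrier R)"
    using J_subset_carrier len_le_trivial[of "carrier R" "carrier R"] by (auto simp: Q_def)
  then obtain K where K: "Q K" and min: "\<forall>Z. Q Z \<longrightarrow> Z \<subseteq> K \<longrightarrow> Z = K"
    using dcc_on_minimal[OF dcc, of Q "carrier R"] by (auto simp: Q_def)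
  obtain X where X: "X \<subseteq> carrier R" "K = left_ann R X" using K by (auto simp: Q_def left_annihilator_def)
  have Kl: "left_ideal R K" using X left_ideal_left_ann by simp
  have KI: "K \<subseteq> left_ann R I" if I: "minimal_right_ideal R I" for I
  proof -
    have Ir: "right_ideal R I" using I by (simp add: minimal_right_ideal_def)
    have IR: "I \<subseteq> carrier R" using right_idealD(1)[OF Ir] .
    have "len_le (left_ideal R) (left_ann R I) (carrier R) 1"
      using left_ann_cover[OF dual right_ideal_zero Ir] I right_idealD(3)[OF Ir]
      by (auto simp: left_ann_zero minimal_right_ideal_def)
    moreover obtain n where "len_le (left_ideal R) K (carrier R) n" using K by (auto simp: Q_def)
    ultimately have "len_le (left_ideal R) (K \<inter> left_ann R I) (carrier R) (1 + n)"
      using O.len_le_Int[of "left_ann R I" K 1 n] Kl left_ideal_left_ann[OF IR] by simp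
    moreover have "left_annihilator R (K \<inter> left_ann R I)"
      unfolding left_annihilator_def
      using X IR by (intro exI[of _ "X \<union> I"]) (simp add: left_ann_Un)
    moreover have "J \<subseteq> K \<inter> left_ann R I" using K kill[OF I] by (simp add: Q_def)
    ultimately have "Q (K \<inter> left_ann R I)" unfolding Q_def by blast
    then have "K \<inter> left_ann R I = K" using min by blast
    then show ?thesis by blast
  qed
  have "K \<subseteq> ?L"
  proof
    fix x assume x: "x \<in> K"
    then have xc: "x \<in> carrier R" using left_idealD(2)[OF Kl] by blast
    have "right_socle R \<subseteq> {s \<in> carrier R. x \<otimes> s \<in> {\<zero>}}"
    proof (rule right_socle_least)
      show "right_ideal R {s \<in> carrier R. x \<otimes> s \<in> {\<zero>}}"
        using xc by (intro right_ideal_left_mult_preimage) auto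
      fix I assume I: "minimal_right_ideal R I"
      then have "I \<subseteq> carrier R" using right_idealD(1) by (auto simp: minimal_right_ideal_def)
      then show "I \<subseteq> {s \<in> carrier R. x \<otimes> s \<in> {\<zero>}}" using KI[OF I] x by (auto simp: left_ann_def)
    qed
    then show "x \<in> ?L" using xc by (auto simp: left_ann_def)
  qed
  then have "K = J" using LJ K by (auto simp: Q_def)
  then show ?thesis using K by (auto simp: Q_def)
qed

section \<open>Properties of quasi-Frobenius rings\<close>

lemma quasi_Frobenius_small_dual: "quasi_Frobenius R \<Longrightarrow> small_dual R"
  by (auto simp: quasi_Frobenius_def small_dual_def left_dual_def right_dual_def
      left_small_dual_def right_small_dual_def small_left_ideal_def small_right_ideal_def)

text \<open>Left duality turns the descending chain condition on right ideals into the ascending one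
  on left ideals. Hence finite length is obtained for the opposite ring and carried back by
  annihilators.\<close>

lemma quasi_Frobenius_finite_length:
  assumes QF: "quasi_Frobenius R"
  shows "\<exists>n. len_le (right_ideal R) {\<zero>} (carrier R) n"
proof -
  interpret O: ring "opp R" by simp
  have dcc: "dcc_on (right_ideal R)" and dual: "left_dual R"
    using QF by (auto simp: quasi_Frobenius_def right_artinian_def)
  have "dcc_on (\<lambda>D. right_ideal R D \<and> J \<subseteq> D \<and> D \<subseteq> carrier R)" by (rule dcc_on_mono[OF dcc]) blast
  then obtain n where "len_le (right_ideal R) J (carrier R) n" using dcc_above_J_finite_length by blast
  then have fin: "len_le (right_ideal (opp R)) O.J (carrier (opp R)) n"
    using len_le_J_left_of_right by simp
  have "dcc_on (\<lambda>L. left_ideal (opp R) L \<and> L \<subseteq> O.J)" by (rule dcc_on_mono[OF dcc]) simp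
  then obtain N where nil: "O.J_pow N = {\<zero>\<^bsub>opp R\<^esub>}" using O.J_nilpotent_of_dcc by blast
  have "acc_on (left_ideal R)"
  proof (rule acc_on_antitone[OF dcc, where f = "right_ann R" and g = "left_ann R"])
    show "right_ideal R (right_ann R L)" if "left_ideal R L" for L
      using right_ideal_right_ann left_idealD(1)[OF that] by blast
    show "left_ann R (right_ann R L) = L" if "left_ideal R L" for L
      using that dual left_annihilator_iff[OF left_idealD(1)[OF that]] by (simp add: left_dual_def)
  qed (rule right_ann_antimono)
  then have "acc_on (\<lambda>D. right_ideal (opp R) D \<and> D \<subseteq> O.J)" by (rule acc_on_mono) simp
  then obtain m where "len_le (right_ideal (opp R)) {\<zero>\<^bsub>opp R\<^esub>} (carrier (opp R)) m"
    using O.finite_length_nilpotent_acc[OF fin nil] by blast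
  then show ?thesis
    using O.finite_length_left_of_right[of m] quasi_Frobenius_small_dual[OF QF] by auto
qed

lemma seq_prod_J_pow: "(\<And>n. a n \<in> J) \<Longrightarrow> seq_prod R a n \<in> J_pow (Suc n)"
proof (induction n)
  case 0
  then show ?case using J_subset_J_pow_1 by auto
next
  case (Suc n)
  then have "seq_prod R a n \<otimes> a (Suc n) \<in> J_pow (Suc n) \<cdot> J" by (intro ideal_prod.prod) auto
  then show ?case by simp
qed

lemma quasi_Frobenius_properties:
  assumes QF: "quasi_Frobenius R"
  shows "small_dual R" "left_perfect R" "semilocal R" "acc_on (right_ideal R)"
    "essential_right R (right_socle R) (carrier R)"
proof -
  show dual: "small_dual R" by (rule quasi_Frobenius_small_dual[OF QF])
  obtain n where n: "len_le (right_ideal R) {\<zero>} (carrier R) n"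
    using quasi_Frobenius_finite_length[OF QF] by blast
  have "len_le (right_ideal R) J (carrier R) n"
    using right_idealD(3)[OF right_ideal_J] by (intro len_le_subinterval[OF n]) auto
  then show sl: "semilocal R" using semilocal_iff by blast
  have "len_le (left_ideal R) {\<zero>} (carrier R) n" using finite_length_left_of_right dual n by blast
  then have "dcc_on (\<lambda>L. left_ideal R L \<and> L \<subseteq> J)"
    using left_idealD(3) J_subset_carrier by (intro dcc_on_mono[OF len_le_dcc]) auto
  then obtain N where N: "J_pow N = {\<zero>}" using J_nilpotent_of_dcc by blast
  have "left_T_nilpotent R J"
    unfolding left_T_nilpotent_def
  proof (intro allI impI)
    fix a :: "nat \<Rightarrow> 'a" assume "\<forall>n. a n \<in> J"
    then have "seq_prod R a N \<in> J_pow N" using seq_prod_J_pow J_pow_Suc_subset(1) by blast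
    then show "\<exists>n. seq_prod R a n = \<zero>" using N by blast
  qed
  then show "left_perfect R" using sl by (simp add: left_perfect_def)
  show "acc_on (right_ideal R)"
    by (rule acc_on_mono[OF len_le_acc[OF n]]) (auto dest: right_idealD)
  show "essential_right R (right_socle R) (carrier R)"
    using QF by (intro right_socle_essential) (simp add: quasi_Frobenius_def)
qed

end

section \<open>Perfect rings\<close>

context semilocal_small_dual
begin

text \<open>In a semilocal ring this is the right socle, and by \<open>left_ann_J\<close> also the
  left one; it is handled purely as an annihilator.\<close>

abbreviation S :: "'a set" where "S \<equiv> left_ann R J"

lemma right_ideal_S: "right_ideal R S" and left_ideal_S: "left_ideal R S"
  using right_ideal_left_ann left_ideal_left_ann left_ideal_J J_subset_carrier by auto

lemma left_ann_S: "left_ann R S = J"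
  using below_J_left_closed[OF left_ideal_J] left_ann_J by simp

lemma right_ann_S: "right_ann R S = J"
  using below_J_right_closed[OF right_ideal_J] by simp

text \<open>
  Since \<open>left_ann R K \<inter> J\<close> is the left annihilator of $K + S$, this says that $K + S$ is a
  right annihilator.
\<close>

lemma annihilator_set_add_S:
  assumes K: "right_ideal R K" and SK: "S \<inter> J \<subseteq> K" and KJ: "K \<subseteq> J"
  shows "right_ann R (left_ann R K \<inter> J) \<subseteq> K <+> S"
proof -
  interpret O: ring "opp R" by simp
  have KS: "right_ideal R (K <+> S)" by (rule right_ideal_set_add[OF K right_ideal_S])
  have SJ: "right_ideal R (S <+> J)" by (rule right_ideal_set_add[OF right_ideal_S right_ideal_J])
  have lSJ: "left_ideal R (S <+> J)" using O.right_ideal_set_add[of S J] left_ideal_S left_ideal_J by simp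
  have J_SJ: "J \<subseteq> S <+> J" by (rule set_add_upper2[OF right_ideal_S right_ideal_J])
  have lKS: "left_ann R (K <+> S) = left_ann R K \<inter> J"
    using left_ann_set_add[OF K right_ideal_S] left_ann_S by simp
  let ?L = "right_ann R (left_ann R K \<inter> J)"
  have L: "right_ideal R ?L" by (rule right_ideal_right_ann) auto
  let ?K = "J \<inter> ?L"
  have K': "right_ideal R ?K" by (rule right_ideal_Int[OF right_ideal_J L])
  have "S \<subseteq> K <+> S" by (rule set_add_upper2[OF K right_ideal_S])
  also have "\<dots> \<subseteq> ?L"
    using subset_right_left_ann[OF right_idealD(1)[OF KS]] unfolding lKS .
  finally have SL: "S \<subseteq> ?L" .
  have "K <+> S \<subseteq> S <+> J"
    using KJ J_SJ set_add_upper1[OF right_ideal_S right_ideal_J] by (intro set_add_least[OF SJ]) auto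
  then have "?L \<subseteq> right_ann R (left_ann R (S <+> J))"
    using right_ann_antimono[OF left_ann_antimono] unfolding lKS[symmetric] by blast
  then have "?L \<subseteq> S <+> J" using above_J_right_closed[OF SJ J_SJ] by simp
  \<comment> \<open>Since \<open>?L\<close> lies between \<open>S\<close> and
    \<open>S <+> J\<close>, the modular law reduces the claim to
    \<open>J \<inter> ?L \<subseteq> K\<close>.\<close>
  then have "?L = (S <+> J) \<inter> ?L" by blast
  also have "\<dots> = S <+> ?K" by (rule modular_law[OF right_ideal_S right_ideal_J L SL])
  finally have L_eq: "?L = S <+> ?K" .
  \<comment> \<open>Here \<open>S \<inter> J \<subseteq> K\<close> enters: it bounds
    \<open>left_ann R K\<close> by \<open>S <+> J\<close>, which splits it into \<open>S\<close>,
    killing \<open>J\<close>, and its part inside \<open>J\<close>, killing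
    \<open>?L\<close>.\<close>
  have "right_ann R (S <+> J) = J \<inter> S"
    using right_ann_set_add[OF left_ideal_S left_ideal_J] right_ann_S left_ann_J by simp
  then have "left_ann R (J \<inter> S) = S <+> J" using above_J_left_closed[OF lSJ J_SJ] by simp
  then have lK_sub: "left_ann R K \<subseteq> S <+> J" using left_ann_antimono[OF SK] by (simp add: Int_commute)
  have lK: "left_ideal R (left_ann R K)" by (rule left_ideal_left_ann[OF right_idealD(1)[OF K]])
  have S_lK: "S \<subseteq> left_ann R K" by (rule left_ann_antimono[OF KJ])
  have "left_ann R K = (S <+> J) \<inter> left_ann R K" using lK_sub by blast
  also have "\<dots> = S <+> (J \<inter> left_ann R K)"
    using O.modular_law[of S J "left_ann R K"] left_ideal_S left_ideal_J lK S_lK by simp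
  finally have lK_eq: "left_ann R K = S <+> (J \<inter> left_ann R K)" .
  have lK': "left_ideal R (left_ann R ?K)" by (rule left_ideal_left_ann[OF right_idealD(1)[OF K']])
  have "S \<subseteq> left_ann R ?K" by (rule left_ann_antimono) auto
  moreover have "J \<inter> left_ann R K \<subseteq> left_ann R ?K"
  proof -
    have "J \<inter> left_ann R K \<subseteq> left_ann R ?L"
      using subset_left_right_ann[of "J \<inter> left_ann R K"] J_subset_carrier
      by (simp add: Int_commute le_infI1)
    also have "\<dots> \<subseteq> left_ann R ?K" by (rule left_ann_antimono) auto
    finally show ?thesis .
  qed
  ultimately have "S <+> (J \<inter> left_ann R K) \<subseteq> left_ann R ?K"
    using O.set_add_least[of "left_ann R ?K" S "J \<inter> left_ann R K"] lK' by simp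
  then have "left_ann R K \<subseteq> left_ann R ?K" using lK_eq by simp
  then have "right_ann R (left_ann R ?K) \<subseteq> K"
    using right_ann_antimono below_J_right_closed[OF K KJ] by blast
  then have "?K \<subseteq> K" using subset_right_left_ann[OF right_idealD(1)[OF K']] by blast
  then have "S <+> ?K \<subseteq> K <+> S"
    using set_add_upper1[OF K right_ideal_S] set_add_upper2[OF K right_ideal_S]
    by (intro set_add_least[OF KS]) auto
  then show ?thesis using L_eq by simp
qed

end

section \<open>Combinations of a sequence with coefficients on the right\<close>

context ring
begin

text \<open>Recursion over prefixes keeps linearity provable by plain induction. With
  \<open>x\<close> constantly \<open>\<one>\<close> it yields the sum of the coefficients.\<close>

primrec comb :: "(nat \<Rightarrow> 'a) \<Rightarrow> (nat \<Rightarrow> 'a) \<Rightarrow> nat \<Rightarrow> 'a" where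
  "comb x r 0 = \<zero>"
| "comb x r (Suc n) = comb x r n \<oplus> x n \<otimes> r n"

lemma comb_closed [simp]:
  "(\<And>i. x i \<in> carrier R) \<Longrightarrow> (\<And>i. r i \<in> carrier R) \<Longrightarrow> comb x r n \<in> carrier R"
  by (induction n) auto

lemma comb_add:
  assumes "\<And>i. x i \<in> carrier R" "\<And>i. r i \<in> carrier R" "\<And>i. s i \<in> carrier R"
  shows "comb x (\<lambda>i. r i \<oplus> s i) n = comb x r n \<oplus> comb x s n"
proof (induction n)
  case (Suc n)
  have c: "comb x r n \<in> carrier R" "comb x s n \<in> carrier R" using assms by auto
  show ?case using Suc c assms by (simp add: r_distr a_ac)
qed simp

lemma comb_mult:
  assumes "\<And>i. x i \<in> carrier R" "\<And>i. r i \<in> carrier R" "t \<in> carrier R"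
  shows "comb x (\<lambda>i. r i \<otimes> t) n = comb x r n \<otimes> t"
proof (induction n)
  case (Suc n)
  have c: "comb x r n \<in> carrier R" using assms by auto
  show ?case using Suc c assms by (simp add: l_distr m_assoc)
qed (use assms in simp)

lemma comb_delta:
  assumes "\<And>i. x i \<in> carrier R" "c \<in> carrier R"
  shows "comb x (\<lambda>j. if j = i then c else \<zero>) n = (if i < n then x i \<otimes> c else \<zero>)"
  using assms by (induction n) (auto simp: less_Suc_eq)

lemma comb_mem:
  assumes "right_ideal R I" "\<And>i. i < n \<Longrightarrow> x i \<otimes> r i \<in> I"
  shows "comb x r n \<in> I"
  using assms(2) right_idealD(3,4)[OF assms(1)] by (induction n) auto

text \<open>
  Elements \<open>b + \<Sum>i. x\<^sub>i r\<^sub>i\<close> with \<open>b \<in> B\<close> and \<open>P r\<close>: the partial sums are required to be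
  eventually constant, which avoids bookkeeping of finite supports.
\<close>

definition combs :: "(nat \<Rightarrow> 'a) \<Rightarrow> 'a set \<Rightarrow> ((nat \<Rightarrow> 'a) \<Rightarrow> bool) \<Rightarrow> 'a set" where
  "combs x B P = {v. \<exists>b\<in>B. \<exists>r. (\<forall>i. r i \<in> carrier R) \<and> P r \<and>
     (\<forall>\<^sub>F n in sequentially. v = b \<oplus> comb x r n)}"

lemma combsI:
  assumes "b \<in> B" "\<And>i. r i \<in> carrier R" "P r" "\<And>n. n \<ge> N \<Longrightarrow> v = b \<oplus> comb x r n"
  shows "v \<in> combs x B P"
  unfolding combs_def eventually_sequentially using assms by blast

lemma combsE:
  assumes "v \<in> combs x B P"
  obtains b r N where "b \<in> B" "\<And>i. r i \<in> carrier R" "P r" "\<And>n. n \<ge> N \<Longrightarrow> v = b \<oplus> comb x r n"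
proof -
  from assms obtain b r N where "b \<in> B" "\<forall>i. r i \<in> carrier R" "P r" "\<forall>n\<ge>N. v = b \<oplus> comb x r n"
    unfolding combs_def eventually_sequentially by blast
  then show thesis by (intro that[of b r N]) auto
qed

lemma combsD:
  assumes "v \<in> combs x B P"
  shows "\<exists>b r N. b \<in> B \<and> (\<forall>i. r i \<in> carrier R) \<and> P r \<and> (\<forall>n\<ge>N. v = b \<oplus> comb x r n)"
  using assms unfolding combs_def eventually_sequentially by blast

text \<open>Two conditions on the coefficients will be used: a coefficient sum in a right ideal
  \<open>M\<close>, and vanishing of an initial segment.\<close>

lemma right_ideal_combs:
  assumes x: "\<And>i. x i \<in> carrier R" and B: "right_ideal R B"
    and P: "P (\<lambda>_. \<zero>)"
    "\<And>r s. (\<And>i. r i \<in> carrier R) \<Longrightarrow> (\<And>i. s i \<in> carrier R) \<Longrightarrow> P r \<Longrightarrow> P s \<Longrightarrow> P (\<lambda>i. r i \<oplus> s i)"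
    "\<And>r t. (\<And>i. r i \<in> carrier R) \<Longrightarrow> P r \<Longrightarrow> t \<in> carrier R \<Longrightarrow> P (\<lambda>i. r i \<otimes> t)"
  shows "right_ideal R (combs x B P)" "B \<subseteq> combs x B P"
proof -
  note BD = right_idealD[OF B]
  have z: "comb x (\<lambda>_. \<zero>) n = \<zero>" for n using x by (induction n) auto
  show sub: "B \<subseteq> combs x B P"
  proof
    fix b assume b: "b \<in> B"
    show "b \<in> combs x B P"
      by (rule combsI[of b _ "\<lambda>_. \<zero>" _ 0]) (use b z P(1) BD(2)[OF b] in auto)
  qed
  show "right_ideal R (combs x B P)"
  proof (rule right_idealI)
    show "combs x B P \<subseteq> carrier R"
    proof
      fix v assume "v \<in> combs x B P"
      then obtain b r N where *: "b \<in> B" "\<And>i. r i \<in> carrier R" "P r" "\<And>n. n \<ge> N \<Longrightarrow> v = b \<oplus> comb x r n"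
        by (rule combsE) blast
      show "v \<in> carrier R" using *(4)[of N] BD(2)[OF *(1)] *(2) x by simp
    qed
    show "\<zero> \<in> combs x B P" using sub BD(3) by blast
    fix u assume "u \<in> combs x B P"
    then obtain b r N where u: "b \<in> B" "\<And>i. r i \<in> carrier R" "P r" "\<And>n. n \<ge> N \<Longrightarrow> u = b \<oplus> comb x r n"
      by (rule combsE) blast
    have bc: "b \<in> carrier R" using BD(2) u(1) .
    show "u \<oplus> v \<in> combs x B P" if v: "v \<in> combs x B P" for v
    proof -
      obtain c s M where v: "c \<in> B" "\<And>i. s i \<in> carrier R" "P s" "\<And>n. n \<ge> M \<Longrightarrow> v = c \<oplus> comb x s n"
        using v by (rule combsE) blast
      have cc: "c \<in> carrier R" using BD(2) v(1) .
      show ?thesis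
      proof (rule combsI[of "b \<oplus> c" _ "\<lambda>i. r i \<oplus> s i" _ "max N M"])
        show "P (\<lambda>i. r i \<oplus> s i)" using P(2) u(2,3) v(2,3) by blast
        show "u \<oplus> v = b \<oplus> c \<oplus> comb x (\<lambda>i. r i \<oplus> s i) n" if "n \<ge> max N M" for n
        proof -
          have "comb x r n \<in> carrier R" "comb x s n \<in> carrier R" using x u(2) v(2) by auto
          moreover have "u = b \<oplus> comb x r n" "v = c \<oplus> comb x s n" using u(4) v(4) that by auto
          ultimately show ?thesis using bc cc comb_add[of x r s n] x u(2) v(2) by (simp add: a_ac)
        qed
      qed (use u v BD in auto)
    qed
    show "u \<otimes> t \<in> combs x B P" if t: "t \<in> carrier R" for t
    proof (rule combsI[of "b \<otimes> t" _ "\<lambda>i. r i \<otimes> t" _ N])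
      show "P (\<lambda>i. r i \<otimes> t)" using P(3) u(2,3) t by blast
      show "u \<otimes> t = b \<otimes> t \<oplus> comb x (\<lambda>i. r i \<otimes> t) n" if "n \<ge> N" for n
      proof -
        have "comb x r n \<in> carrier R" using x u(2) by auto
        then show ?thesis
          unfolding u(4)[OF that] using bc t comb_mult[of x r t n] x u(2) by (simp add: l_distr)
      qed
    qed (use u t BD in auto)
  qed
qed

end

text \<open>\<open>M\<close> is a maximal right ideal, described elementwise, and each
  \<open>x i\<close> generates modulo \<open>B\<close> a copy of the quotient by \<open>M\<close>.
  Since no \<open>x i\<close> is generated by its predecessors, these simple modules are
  independent. The locale is set up to be refuted.\<close>

locale independent_sequence = semilocal_small_dual +
  fixes B M :: "'a set" and x :: "nat \<Rightarrow> 'a"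
  assumes B: "right_ideal R B" "S \<inter> J \<subseteq> B" "B \<subseteq> J"
    and M: "right_ideal R M" "\<one> \<notin> M"
      "\<And>r. r \<in> carrier R \<Longrightarrow> r \<notin> M \<Longrightarrow> \<exists>s\<in>carrier R. \<one> \<ominus> r \<otimes> s \<in> M"
    and x: "\<And>i. x i \<in> J" "\<And>i r. r \<in> M \<Longrightarrow> x i \<otimes> r \<in> B" "\<And>i. x i \<notin> rhull (B \<union> x ` {..<i})"
begin

lemma x_closed [simp]: "x i \<in> carrier R"
  using x(1) by simp

lemma M_closed: "r \<in> M \<Longrightarrow> r \<in> carrier R"
  using right_idealD(2)[OF M(1)] .

lemma coefficients_mem:
  assumes r: "\<And>i. r i \<in> carrier R"
  shows "comb x r m \<in> B \<Longrightarrow> i < m \<Longrightarrow> r i \<in> M"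
proof (induction m)
  case (Suc n)
  note BD = right_idealD[OF B(1)]
  let ?H = "rhull (B \<union> x ` {..<n})"
  have H: "right_ideal R ?H" using BD(1) by (intro right_ideal_rhull) auto
  have sub: "B \<union> x ` {..<n} \<subseteq> ?H" by (rule rhull_upper)
  have cc: "comb x r n \<in> carrier R" using r by simp
  have c: "comb x r n \<in> ?H"
    using sub r right_idealD(5)[OF H] by (intro comb_mem[OF H]) auto
  have "(comb x r n \<oplus> x n \<otimes> r n) \<ominus> comb x r n \<in> ?H"
    using right_idealD(7)[OF H] Suc.prems(1) sub c by auto
  then have xr: "x n \<otimes> r n \<in> ?H" using cc r by (simp add: add_minus_cancel)
  have rn: "r n \<in> M"
  proof (rule ccontr)
    assume "r n \<notin> M"
    then obtain s where s: "s \<in> carrier R" "\<one> \<ominus> r n \<otimes> s \<in> M" using M(3) r by blast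
    have "x n \<otimes> (\<one> \<ominus> r n \<otimes> s) \<in> ?H" using x(2)[OF s(2)] sub by blast
    moreover have "x n \<otimes> r n \<otimes> s \<in> ?H" using right_idealD(5)[OF H xr s(1)] .
    ultimately have "x n \<otimes> (\<one> \<ominus> r n \<otimes> s) \<oplus> x n \<otimes> r n \<otimes> s \<in> ?H" by (rule right_idealD(4)[OF H])
    moreover have "x n \<otimes> (\<one> \<ominus> r n \<otimes> s) \<oplus> x n \<otimes> r n \<otimes> s = x n"
      using s(1) r by (simp add: a_minus_def r_distr r_minus m_assoc a_assoc l_neg)
    ultimately show False using x(3) by simp
  qed
  have "(comb x r n \<oplus> x n \<otimes> r n) \<ominus> x n \<otimes> r n \<in> B"
    using BD(7) Suc.prems(1) x(2)[OF rn] by simp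
  then have "comb x r n \<in> B" using cc r by (simp add: add_minus_cancel)
  then show ?case using Suc rn by (cases "i = n") auto
qed simp

lemma coefficients_unique:
  assumes r: "\<And>i. r i \<in> carrier R" and s: "\<And>i. s i \<in> carrier R" and bc: "b \<in> B" "c \<in> B"
    and v: "\<And>n. n \<ge> N \<Longrightarrow> v = b \<oplus> comb x r n" "\<And>n. n \<ge> N' \<Longrightarrow> v = c \<oplus> comb x s n"
  shows "r i \<ominus> s i \<in> M"
proof -
  \<comment> \<open>Beyond both thresholds, and strictly above \<open>i\<close> because
    \<open>coefficients_mem\<close> asks for \<open>i < m\<close>.\<close>
  let ?n = "Suc (max i (max N N'))"
  have c: "b \<in> carrier R" "c \<in> carrier R" "comb x r ?n \<in> carrier R" "comb x s ?n \<in> carrier R"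
    using bc right_idealD(2)[OF B(1)] r s by (auto simp del: comb.simps)
  have sub: "comb x (\<lambda>i. r i \<ominus> s i) n = comb x r n \<ominus> comb x s n" for n
  proof -
    have "comb x (\<lambda>i. s i \<otimes> (\<ominus> \<one>)) n = comb x s n \<otimes> (\<ominus> \<one>)" using s by (intro comb_mult) auto
    then have "comb x (\<lambda>i. \<ominus> s i) n = \<ominus> comb x s n" using s by (simp add: r_minus)
    then show ?thesis using comb_add[of x r "\<lambda>i. \<ominus> s i" n] r s by (simp add: a_minus_def)
  qed
  have "b \<oplus> comb x r ?n = c \<oplus> comb x s ?n" using v(1)[of ?n] v(2)[of ?n] by simp
  then have "comb x r ?n = (c \<oplus> comb x s ?n) \<ominus> b" using c by (metis add_minus_cancel(2))
  then have "comb x r ?n \<ominus> comb x s ?n = ((c \<oplus> comb x s ?n) \<ominus> b) \<ominus> comb x s ?n" by simp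
  also have "\<dots> = c \<ominus> b"
  proof -
    have "((c \<oplus> comb x s ?n) \<ominus> b) \<ominus> comb x s ?n = (c \<ominus> b) \<oplus> comb x s ?n \<ominus> comb x s ?n"
      using c by (simp add: a_minus_def a_ac del: comb.simps)
    then show ?thesis using c add_minus_cancel(1)[of "c \<ominus> b" "comb x s ?n"] by simp
  qed
  finally have "comb x (\<lambda>i. r i \<ominus> s i) ?n = c \<ominus> b" unfolding sub .
  then have "comb x (\<lambda>i. r i \<ominus> s i) ?n \<in> B" using right_idealD(7)[OF B(1)] bc by simp
  then show ?thesis using r s by (intro coefficients_mem[where r = "\<lambda>i. r i \<ominus> s i" and m = ?n]) auto
qed

text \<open>Modulo \<open>B\<close> this is the hyperplane of coefficient sum zero in the direct sum
  of copies of the quotient by \<open>M\<close>. The condition is asked only eventually and modulo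
  \<open>M\<close>: late coefficients may be nonzero elements of \<open>M\<close>, so partial
  coefficient sums need not become constant.\<close>

definition K :: "'a set" where
  "K = combs x B (\<lambda>r. \<forall>\<^sub>F n in sequentially. comb (\<lambda>_. \<one>) r n \<in> M)"

definition tail :: "nat \<Rightarrow> 'a set" where
  "tail k = rhull (B \<union> x ` {k..})"

lemma right_ideal_K: "right_ideal R K" and B_subset_K: "B \<subseteq> K"
proof -
  let ?P = "\<lambda>r. \<forall>\<^sub>F n in sequentially. comb (\<lambda>_. \<one>) r n \<in> M"
  note MD = right_idealD[OF M(1)]
  have 0: "?P (\<lambda>_. \<zero>)" using MD(3) by (intro always_eventually allI comb_mem[OF M(1)]) auto
  have add: "?P (\<lambda>i. r i \<oplus> s i)"
    if rs: "\<And>i. r i \<in> carrier R" "\<And>i. s i \<in> carrier R" and P: "?P r" "?P s" for r s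
    using eventually_conj[OF P] MD(4) comb_add[of "\<lambda>_. \<one>" r s] rs by (auto elim!: eventually_mono)
  have mult: "?P (\<lambda>i. r i \<otimes> t)"
    if r: "\<And>i. r i \<in> carrier R" and P: "?P r" and t: "t \<in> carrier R" for r t
    using P MD(5)[OF _ t] comb_mult[of "\<lambda>_. \<one>" r t] r t by (auto elim!: eventually_mono)
  show "right_ideal R K" "B \<subseteq> K"
    unfolding K_def by (rule right_ideal_combs[OF x_closed B(1) 0 add mult]; assumption)+
qed

lemma K_subset_J: "K \<subseteq> J"
proof
  fix v assume "v \<in> K"
  then obtain b r N where *: "b \<in> B" "\<And>i. r i \<in> carrier R" "\<And>n. n \<ge> N \<Longrightarrow> v = b \<oplus> comb x r n"
    unfolding K_def by (rule combsE) blast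
  have "comb x r N \<in> J"
    using right_idealD(5)[OF right_ideal_J x(1) *(2)] by (intro comb_mem[OF right_ideal_J])
  then show "v \<in> J" using *(3)[of N] right_idealD(4)[OF right_ideal_J] B(3) *(1) by auto
qed

text \<open>The coefficients \<open>\<one>\<close> and \<open>\<ominus> \<one>\<close> cancel. These
  differences force an annihilator of \<open>K\<close> to take one value on all
  \<open>x i\<close>.\<close>

lemma difference_mem_K: "x i \<ominus> x (Suc i) \<in> K"
proof -
  let ?r = "\<lambda>j. if j = i then \<one> else \<zero>" and ?s = "\<lambda>j. if j = Suc i then \<ominus> \<one> else \<zero>"
  have c: "\<And>j. ?r j \<in> carrier R" "\<And>j. ?s j \<in> carrier R" by auto
  have comb: "comb y (\<lambda>j. ?r j \<oplus> ?s j) n = y i \<ominus> y (Suc i)"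
    if "n \<ge> Suc (Suc i)" "\<And>j. y j \<in> carrier R" for y n
    using comb_add[of y ?r ?s n, OF that(2) c] comb_delta[of y \<one> i n, OF that(2)]
      comb_delta[of y "\<ominus> \<one>" "Suc i" n, OF that(2)] that
    by (simp add: a_minus_def r_minus del: comb.simps)
  show ?thesis
    unfolding K_def
  proof (rule combsI[of \<zero> _ "\<lambda>j. ?r j \<oplus> ?s j" _ "Suc (Suc i)"])
    show "\<forall>\<^sub>F n in sequentially. comb (\<lambda>_. \<one>) (\<lambda>j. ?r j \<oplus> ?s j) n \<in> M"
      unfolding eventually_sequentially
    proof (intro exI allI impI)
      fix n assume "Suc (Suc i) \<le> n"
      then have "comb (\<lambda>_. \<one>) (\<lambda>j. ?r j \<oplus> ?s j) n = \<zero>"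
        using comb[of n "\<lambda>_. \<one>"] by (simp add: add_minus_cancel del: comb.simps)
      then show "comb (\<lambda>_. \<one>) (\<lambda>j. ?r j \<oplus> ?s j) n \<in> M" using right_idealD(3)[OF M(1)] by simp
    qed
    show "x i \<ominus> x (Suc i) = \<zero> \<oplus> comb x (\<lambda>j. ?r j \<oplus> ?s j) n" if "n \<ge> Suc (Suc i)" for n
      using comb[OF that, of x] by simp
  qed (use right_idealD(3)[OF B(1)] in auto)
qed

text \<open>The coefficient sum of \<open>x 0\<close> is \<open>\<one>\<close>, it is well defined
  modulo \<open>M\<close> by \<open>coefficients_unique\<close>, and
  \<open>\<one> \<notin> M\<close>.\<close>

lemma x0_not_in_K: "x 0 \<notin> K"
proof
  assume "x 0 \<in> K"
  then obtain b r N where r: "b \<in> B" "\<And>i. r i \<in> carrier R"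
      "\<forall>\<^sub>F n in sequentially. comb (\<lambda>_. \<one>) r n \<in> M" "\<And>n. n \<ge> N \<Longrightarrow> x 0 = b \<oplus> comb x r n"
    unfolding K_def by (rule combsE) blast
  let ?d = "\<lambda>j. if j = 0 then \<one> else \<zero>"
  have dc: "\<And>j. ?d j \<in> carrier R" by simp
  have "x 0 = \<zero> \<oplus> comb x ?d n" if "n \<ge> 1" for n
    using comb_delta[of x \<one> 0 n] that by simp
  then have d: "?d i \<ominus> r i \<in> M" for i
    using coefficients_unique[of ?d r \<zero> b 1 "x 0" N i] r dc right_idealD(3)[OF B(1)] by blast
  have "comb (\<lambda>_. \<one>) (\<lambda>i. ?d i \<ominus> r i) n \<in> M" for n
    using d M_closed by (intro comb_mem[OF M(1)]) auto
  moreover obtain n where n: "n \<ge> 1" "comb (\<lambda>_. \<one>) r n \<in> M"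
    using eventually_conj[OF r(3) eventually_ge_at_top[of 1]]
    by (auto simp: eventually_sequentially)
  ultimately have "comb (\<lambda>_. \<one>) (\<lambda>i. ?d i \<ominus> r i) n \<oplus> comb (\<lambda>_. \<one>) r n \<in> M"
    using right_idealD(4)[OF M(1)] by blast
  moreover have "comb (\<lambda>_. \<one>) (\<lambda>i. ?d i \<ominus> r i) n \<oplus> comb (\<lambda>_. \<one>) r n = comb (\<lambda>_. \<one>) ?d n"
  proof -
    have eq: "(\<lambda>i. (?d i \<ominus> r i) \<oplus> r i) = ?d" using r(2) dc by (intro ext add_minus_cancel(3)) auto
    show ?thesis
      using comb_add[of "\<lambda>_. \<one>" "\<lambda>i. ?d i \<ominus> r i" r n, unfolded eq] r(2) dc by simp
  qed
  moreover have "comb (\<lambda>_. \<one>) ?d n = \<one>" using comb_delta[of "\<lambda>_. \<one>" \<one> 0 n] n(1) by simp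
  ultimately show False using M(2) by simp
qed

lemma right_ideal_tail: "right_ideal R (tail k)"
  unfolding tail_def using right_idealD(1)[OF B(1)] by (intro right_ideal_rhull) auto

lemma tail_subset_J: "tail k \<subseteq> J"
  unfolding tail_def using B(3) x(1) by (intro rhull_least right_ideal_J) auto

lemma tail_subset_combs: "tail k \<subseteq> combs x B (\<lambda>r. \<forall>i<k. r i = \<zero>)"
  unfolding tail_def
proof (intro rhull_least)
  show R: "right_ideal R (combs x B (\<lambda>r. \<forall>i<k. r i = \<zero>))"
    by (rule right_ideal_combs) (use B in auto)
  have "x i \<in> combs x B (\<lambda>r. \<forall>i<k. r i = \<zero>)" if "i \<ge> k" for i
  proof (rule combsI[of \<zero> _ "\<lambda>j. if j = i then \<one> else \<zero>" _ "Suc i"])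
    show "x i = \<zero> \<oplus> comb x (\<lambda>j. if j = i then \<one> else \<zero>) n" if "n \<ge> Suc i" for n
      using comb_delta[of x \<one> i n] that by simp
  qed (use that right_idealD(3)[OF B(1)] in auto)
  moreover have "B \<subseteq> combs x B (\<lambda>r. \<forall>i<k. r i = \<zero>)"
    by (rule right_ideal_combs) (use B in auto)
  ultimately show "B \<union> x ` {k..} \<subseteq> combs x B (\<lambda>r. \<forall>i<k. r i = \<zero>)" by auto
qed

text \<open>Write \<open>v\<close> with the first \<open>N\<close> terms. As \<open>v\<close> also
  lies in \<open>tail N\<close>, where these coefficients vanish, uniqueness puts them into
  \<open>M\<close> and their terms into \<open>B\<close>.\<close>

lemma Inter_tail_subset:
  assumes v: "\<And>k. v \<in> tail k"
  shows "v \<in> B"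
proof -
  obtain b r N where r: "b \<in> B" "\<forall>i. r i \<in> carrier R" "\<forall>n\<ge>N. v = b \<oplus> comb x r n"
    using combsD[OF subsetD[OF tail_subset_combs v[of 0]]] by (elim exE conjE)
  obtain c s N' where s: "c \<in> B" "\<forall>i. s i \<in> carrier R" "\<forall>i<N. s i = \<zero>" "\<forall>n\<ge>N'. v = c \<oplus> comb x s n"
    using combsD[OF subsetD[OF tail_subset_combs v[of N]]] by (elim exE conjE)
  have "r i \<in> M" if "i < N" for i
    using coefficients_unique[of r s b c N v N' i] r s that
    by (simp add: a_minus_def)
  then have "comb x r N \<in> B" by (intro comb_mem[OF B(1)] x(2))
  then show ?thesis using r(3)[rule_format, of N] right_idealD(4)[OF B(1) r(1)] by simp
qed

text \<open>The summand from \<open>S\<close> is a difference of elements of \<open>J\<close>, so it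
  lies in \<open>S \<inter> J\<close>, which \<open>A\<close> contains.\<close>

lemma mem_of_mem_add_S:
  assumes A: "right_ideal R A" "B \<subseteq> A" "A \<subseteq> J" and v: "v \<in> J" "v \<in> A <+> S"
  shows "v \<in> A"
proof -
  obtain a s where as: "a \<in> A" "s \<in> S" "v = a \<oplus> s" using v(2) unfolding mem_set_add by blast
  have ac: "a \<in> J" "a \<in> carrier R" using as(1) A(3) by auto
  have sc: "s \<in> carrier R" using as(2) left_ann_subset by blast
  have "s = v \<ominus> a" using as(3) ac sc by (simp add: add_minus_cancel)
  then have "s \<in> J" using right_idealD(7)[OF right_ideal_J v(1) ac(1)] by simp
  then have "s \<in> A" using as(2) B(2) A(2) by blast
  then show ?thesis using as right_idealD(4)[OF A(1)] by blast
qed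

text \<open>
  The left annihilators of the tails form an ascending chain whose union is again an annihilator.
  Since the tails intersect in \<open>B\<close>, this union contains the annihilator of \<open>K\<close>, so that
  every element annihilating \<open>K\<close> annihilates all \<open>x\<^sub>i\<close>.
\<close>

lemma ann_K_subset: 
  assumes y: "y \<in> left_ann R K" "y \<in> J"
  obtains k where "\<And>i. i \<ge> k \<Longrightarrow> y \<otimes> x i = \<zero>"
proof -
  let ?Q = "\<Union>k. left_ann R (tail k) \<inter> J"
  have mono: "left_ann R (tail k) \<subseteq> left_ann R (tail l)" if "k \<le> l" for k l
    unfolding tail_def using that by (intro left_ann_antimono rhull_mono) auto
  have tl: "left_ideal R (left_ann R (tail k))" for k
    using right_ideal_tail right_idealD(1) by (intro left_ideal_left_ann) blast
  have Q: "left_ideal R ?Q"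
  proof (rule left_idealI)
    show "\<zero> \<in> ?Q" using left_idealD(3)[OF tl] left_idealD(3)[OF left_ideal_J] by blast
    show "u \<oplus> v \<in> ?Q" if uv: "u \<in> ?Q" "v \<in> ?Q" for u v
    proof -
      obtain k l where kl: "u \<in> left_ann R (tail k)" "v \<in> left_ann R (tail l)" "u \<in> J" "v \<in> J"
        using uv by blast
      then have "u \<in> left_ann R (tail (max k l))" "v \<in> left_ann R (tail (max k l))"
        using mono[of k "max k l"] mono[of l "max k l"] by auto
      then have "u \<oplus> v \<in> left_ann R (tail (max k l)) \<inter> J"
        using left_idealD(4)[OF tl] left_idealD(4)[OF left_ideal_J] kl by blast
      then show ?thesis by blast
    qed
    show "r \<otimes> u \<in> ?Q" if u: "u \<in> ?Q" and r: "r \<in> carrier R" for u r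
      using u left_idealD(5)[OF tl _ r] left_idealD(5)[OF left_ideal_J _ r] by blast
  qed auto
  have yc: "y \<in> carrier R" using y by simp
  have "y \<otimes> z = \<zero>" if z: "z \<in> right_ann R ?Q" for z
  proof -
    have ztail: "z \<in> tail k <+> S" for k
    proof -
      have "S \<inter> J \<subseteq> tail k" unfolding tail_def using B(2) rhull_upper[of "B \<union> x ` {k..}"] by blast
      moreover have "z \<in> right_ann R (left_ann R (tail k) \<inter> J)"
        using z right_ann_antimono[of "left_ann R (tail k) \<inter> J" ?Q] by blast
      ultimately show ?thesis
        using annihilator_set_add_S[OF right_ideal_tail _ tail_subset_J] by blast
    qed
    \<comment> \<open>One decomposition, taken from \<open>tail 0\<close>, serves for all
      \<open>k\<close>: its part \<open>v\<close> lies in \<open>J\<close>, and within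
      \<open>J\<close> adding \<open>S\<close> to a tail gains nothing.\<close>
    obtain v s where vs: "v \<in> tail 0" "s \<in> S" "z = v \<oplus> s" using ztail[of 0] unfolding mem_set_add by blast
    have vJ: "v \<in> J" using vs(1) tail_subset_J by blast
    have vc: "v \<in> carrier R" using vJ by simp
    have sc: "s \<in> carrier R" using vs(2) left_ann_subset by blast
    have "v \<in> tail k" for k
    proof (rule mem_of_mem_add_S[OF right_ideal_tail _ tail_subset_J vJ])
      show "B \<subseteq> tail k" unfolding tail_def using rhull_upper[of "B \<union> x ` {k..}"] by blast
      have R: "right_ideal R (tail k <+> S)" by (rule right_ideal_set_add[OF right_ideal_tail right_ideal_S])
      have "z \<ominus> s \<in> tail k <+> S"
        using right_idealD(7)[OF R ztail] set_add_upper2[OF right_ideal_tail right_ideal_S] vs(2) by blast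
      then show "v \<in> tail k <+> S" using vs(3) vc sc by (simp add: add_minus_cancel)
    qed
    then have "v \<in> K" using Inter_tail_subset B_subset_K by blast
    then have "y \<otimes> v = \<zero>" using y(1) by (auto simp: left_ann_def)
    moreover have "y \<otimes> s = \<zero>" using vs(2) y(2) left_ann_J by (auto simp: right_ann_def)
    ultimately show ?thesis using vs(3) yc vc sc by (simp add: r_distr)
  qed
  then have "y \<in> left_ann R (right_ann R ?Q)" using yc by (simp add: left_ann_def)
  \<comment> \<open>Small duality is applied to the whole ascending union; membership in it means
    annihilating a single tail.\<close>
  also have "\<dots> = ?Q" by (rule below_J_left_closed[OF Q]) auto
  finally obtain k where k: "y \<in> left_ann R (tail k)" by blast
  have "x i \<in> tail k" if "i \<ge> k" for i
    unfolding tail_def using rhull_upper[of "B \<union> x ` {k..}"] that by auto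
  then show thesis using that[of k] k by (auto simp: left_ann_def)
qed

text \<open>An element of \<open>J\<close> annihilating \<open>K\<close> takes one value on all
  \<open>x i\<close>, and this value is zero far out. So \<open>annihilator_set_add_S\<close> puts
  \<open>x 0\<close> into \<open>K <+> S\<close>, and membership in \<open>J\<close> puts it into
  \<open>K\<close>.\<close>

lemma contradiction: False
proof -
  have "x 0 \<in> K <+> S"
  proof -
    have "y \<otimes> x 0 = \<zero>" if y: "y \<in> left_ann R K \<inter> J" for y
    proof -
      have yc: "y \<in> carrier R" using y by simp
      have step: "y \<otimes> x i = y \<otimes> x (Suc i)" for i
      proof -
        have "y \<otimes> (x i \<ominus> x (Suc i)) = \<zero>" using y difference_mem_K by (auto simp: left_ann_def)
        then have "y \<otimes> x i \<ominus> y \<otimes> x (Suc i) = \<zero>" using yc by (simp add: a_minus_def r_distr r_minus)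
        then show ?thesis using yc by (simp add: add_minus_cancel)
      qed
      have "y \<otimes> x 0 = y \<otimes> x i" for i
        by (induction i) (use step in auto)
      moreover obtain k where "\<And>i. i \<ge> k \<Longrightarrow> y \<otimes> x i = \<zero>" using ann_K_subset y by blast
      ultimately show ?thesis by (metis order_refl)
    qed
    then have "x 0 \<in> right_ann R (left_ann R K \<inter> J)" by (simp add: right_ann_def)
    moreover have "S \<inter> J \<subseteq> K" using B(2) B_subset_K by blast
    ultimately show ?thesis using annihilator_set_add_S[OF right_ideal_K _ K_subset_J] by blast
  qed
  then have "x 0 \<in> K" using mem_of_mem_add_S[OF right_ideal_K B_subset_K K_subset_J x(1)] by blast
  then show False using x0_not_in_K by blast
qed

end

section \<open>Finite generation of the radical\<close>

context semilocal_small_dual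
begin

text \<open>If no finite set sufficed, elements \<open>g (F i) \<otimes> k\<close> could be chosen
  forever outside the right ideal generated over \<open>B\<close> by the earlier ones. With
  \<open>?M\<close>, the annihilator of \<open>k\<close> modulo \<open>J\<close>, they form an
  \<open>independent_sequence\<close>.\<close>

lemma finite_mod_simple:
  assumes B: "right_ideal R B" "S \<inter> J \<subseteq> B" "B \<subseteq> J" and JB: "\<And>a b. a \<in> J \<Longrightarrow> b \<in> J \<Longrightarrow> a \<otimes> b \<in> B"
    and k: "simple_mod J k"
  shows "\<exists>X. finite X \<and> X \<subseteq> J \<and> (\<forall>y\<in>J. y \<otimes> k \<in> rhull (B \<union> X))"
proof (rule ccontr)
  assume "\<not> ?thesis"
  then have "\<forall>X. finite X \<and> X \<subseteq> J \<longrightarrow> (\<exists>y\<in>J. y \<otimes> k \<notin> rhull (B \<union> X))" by blast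
  then obtain g where g: "\<forall>X. finite X \<and> X \<subseteq> J \<longrightarrow> g X \<in> J \<and> g X \<otimes> k \<notin> rhull (B \<union> X)"
    by metis
  have kc: "k \<in> carrier R" using k by (simp add: simple_mod_def)
  define F where "F = rec_nat {} (\<lambda>_ X. insert (g X \<otimes> k) X)"
  have F_simps: "F 0 = {}" "F (Suc i) = insert (g (F i) \<otimes> k) (F i)" for i by (simp_all add: F_def)
  define x where "x i = g (F i) \<otimes> k" for i
  have F: "finite (F i) \<and> F i \<subseteq> J" for i
    using g right_idealD(5)[OF right_ideal_J _ kc] by (induction i) (auto simp: F_simps)
  have F_eq: "F i = x ` {..<i}" for i by (induction i) (auto simp: F_simps x_def lessThan_Suc)
  let ?M = "{r \<in> carrier R. k \<otimes> r \<in> J}"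
  have "independent_sequence R n B ?M x"
  proof (intro independent_sequence.intro semilocal_small_dual_axioms independent_sequence_axioms.intro B)
    show "right_ideal R ?M" by (rule right_ideal_left_mult_preimage[OF right_ideal_J kc])
    show "\<one> \<notin> ?M" using k by (simp add: simple_mod_def)
    show "\<exists>s\<in>carrier R. \<one> \<ominus> r \<otimes> s \<in> ?M" if r: "r \<in> carrier R" "r \<notin> ?M" for r
    proof -
      obtain s where s: "s \<in> carrier R" "k \<ominus> k \<otimes> r \<otimes> s \<in> J" using k r by (auto simp: simple_mod_def)
      have "k \<otimes> (\<one> \<ominus> r \<otimes> s) = k \<ominus> k \<otimes> r \<otimes> s"
        using kc r(1) s(1) by (simp add: a_minus_def r_distr r_minus m_assoc)
      then show ?thesis using s r(1) by (intro bexI[of _ s]) auto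
    qed
    show "x i \<in> J" for i unfolding x_def using g F right_idealD(5)[OF right_ideal_J _ kc] by blast
    show "x i \<otimes> r \<in> B" if "r \<in> ?M" for i r
    proof -
      have gi: "g (F i) \<in> J" using g F by blast
      then have "g (F i) \<otimes> (k \<otimes> r) \<in> B" using JB that by blast
      then show ?thesis unfolding x_def using gi kc that by (simp add: m_assoc)
    qed
    show "x i \<notin> rhull (B \<union> x ` {..<i})" for i
      using g F[of i] unfolding F_eq[symmetric] by (simp add: x_def)
  qed
  then show False by (rule independent_sequence.contradiction)
qed

text \<open>Finitely many simple elements \<open>k\<close> generate the ring over \<open>J\<close>,
  and products of two radical elements fall into \<open>B\<close>. So modulo \<open>B\<close> the
  radical is generated by the products \<open>y \<otimes> k\<close>, which
  \<open>finite_mod_simple\<close> controls for each \<open>k\<close>.\<close>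

lemma finite_mod_J_square:
  assumes B: "right_ideal R B" "S \<inter> J \<subseteq> B" "B \<subseteq> J" and JB: "\<And>a b. a \<in> J \<Longrightarrow> b \<in> J \<Longrightarrow> a \<otimes> b \<in> B"
  shows "\<exists>X. finite X \<and> X \<subseteq> J \<and> J \<subseteq> rhull (B \<union> X)"
proof -
  obtain Y where Y: "finite Y" "\<forall>k\<in>Y. simple_mod J k" "rhull (J \<union> Y) = carrier R"
    using simple_mod_J_generate[OF fin_right] by blast
  have "\<forall>k\<in>Y. \<exists>X. finite X \<and> X \<subseteq> J \<and> (\<forall>y\<in>J. y \<otimes> k \<in> rhull (B \<union> X))"
    using Y(2) finite_mod_simple[OF B JB] by blast
  then obtain f where f: "\<forall>k\<in>Y. finite (f k) \<and> f k \<subseteq> J \<and> (\<forall>y\<in>J. y \<otimes> k \<in> rhull (B \<union> f k))"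
    by (auto dest: bchoice)
  let ?X = "\<Union>k\<in>Y. f k"
  have X: "finite ?X" "?X \<subseteq> J" using Y(1) f by auto
  let ?H = "rhull (B \<union> ?X)"
  have "B \<union> ?X \<subseteq> carrier R" using X(2) B(3) by auto
  then have H: "right_ideal R ?H" by (rule right_ideal_rhull)
  have "y \<in> ?H" if y: "y \<in> J" for y
  proof -
    have yc: "y \<in> carrier R" using y by simp
    have BH: "B \<subseteq> ?H" using rhull_upper[of "B \<union> ?X"] by blast
    have "rhull (J \<union> Y) \<subseteq> {r \<in> carrier R. y \<otimes> r \<in> ?H}"
    proof (rule rhull_least)
      show "right_ideal R {r \<in> carrier R. y \<otimes> r \<in> ?H}" by (rule right_ideal_left_mult_preimage[OF H yc])
      have "y \<otimes> k \<in> ?H" if "k \<in> Y" for k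
      proof -
        have "rhull (B \<union> f k) \<subseteq> ?H" using that by (intro rhull_mono) auto
        then show ?thesis using f that y by blast
      qed
      moreover have "k \<in> carrier R" if "k \<in> Y" for k using Y(2) that by (simp add: simple_mod_def)
      ultimately show "J \<union> Y \<subseteq> {r \<in> carrier R. y \<otimes> r \<in> ?H}" using JB[OF y] BH by auto
    qed
    then have "\<one> \<in> {r \<in> carrier R. y \<otimes> r \<in> ?H}" using Y(3) by auto
    then show ?thesis using yc by simp
  qed
  then show ?thesis using X by blast
qed

end

section \<open>Nakayama and Koenig arguments from T-nilpotence\<close>

context ring
begin

lemma finitely_generated_of_acc:
  assumes acc: "acc_on (\<lambda>D. right_ideal R D \<and> {\<zero>} \<subseteq> D \<and> D \<subseteq> I)" and I: "right_ideal R I"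
  shows "\<exists>X. finite X \<and> X \<subseteq> I \<and> rhull X = I"
proof -
  define Q where "Q D \<longleftrightarrow> (\<exists>X. finite X \<and> X \<subseteq> I \<and> D = rhull X)" for D
  have QP: "right_ideal R D \<and> {\<zero>} \<subseteq> D \<and> D \<subseteq> I" if D: "Q D" for D
  proof -
    obtain X where X: "X \<subseteq> I" "D = rhull X" using D unfolding Q_def by blast
    have "right_ideal R D" unfolding X(2) using X(1) right_idealD(1)[OF I] by (intro right_ideal_rhull) auto
    then show ?thesis using rhull_least[OF I X(1)] X(2) right_idealD(3) by auto
  qed
  have "Q (rhull {})" unfolding Q_def by blast
  then obtain D where D: "Q D" and max: "\<forall>Z. Q Z \<longrightarrow> D \<subseteq> Z \<longrightarrow> Z = D"
    using acc_on_maximal[OF acc, of Q "rhull {}", OF _ QP] by blast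
  obtain X where X: "finite X" "X \<subseteq> I" "D = rhull X" using D unfolding Q_def by blast
  have "i \<in> D" if i: "i \<in> I" for i
  proof -
    have "Q (rhull (insert i X))" unfolding Q_def using X i by blast
    moreover have "D \<subseteq> rhull (insert i X)" unfolding X(3) by (rule rhull_mono) auto
    ultimately have "rhull (insert i X) = D" using max by blast
    then show ?thesis using rhull_upper[of "insert i X"] by blast
  qed
  then have "I \<subseteq> D" by blast
  moreover have "D \<subseteq> I" using QP[OF D] by blast
  ultimately have "rhull X = I" using X(3) by simp
  then show ?thesis using X(1,2) by blast
qed

text \<open>Dependent choice prolongs products on the left while \<open>P\<close> persists, and
  T-nilpotence in the opposite ring makes one of them zero. Both applications take a
  \<open>P\<close> that fails at \<open>\<zero>\<close>.\<close>

lemma T_nilpotent_escape: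
  assumes nil: "left_T_nilpotent (opp R) J" and P: "P \<one>"
    and step: "\<And>p. p \<in> carrier R \<Longrightarrow> P p \<Longrightarrow> \<exists>a\<in>J. P (a \<otimes> p)"
  shows "P \<zero>"
proof -
  \<comment> \<open>A state pairs the factor just attached with the product so far; starting at
    \<open>(a, a)\<close> makes the first product equal to the first factor.\<close>
  define A where "A z \<longleftrightarrow> fst z \<in> J \<and> snd z \<in> carrier R \<and> P (snd z)" for z
  obtain a where a: "a \<in> J" "P (a \<otimes> \<one>)" using step[OF one_closed P] by blast
  have ex: "\<exists>w. A w \<and> snd w = fst w \<otimes> snd z" if z: "A z" for z
  proof -
    obtain b where "b \<in> J" "P (b \<otimes> snd z)" using z step[of "snd z"] unfolding A_def by blast
    then show ?thesis using z by (intro exI[of _ "(b, b \<otimes> snd z)"]) (simp add: A_def)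
  qed
  have "\<exists>f. \<forall>n. (A (f n) \<and> (n = 0 \<longrightarrow> f n = (a, a))) \<and> snd (f (Suc n)) = fst (f (Suc n)) \<otimes> snd (f n)"
  proof (rule dependent_nat_choice)
    show "\<exists>z. A z \<and> ((0::nat) = 0 \<longrightarrow> z = (a, a))"
      using a by (intro exI[of _ "(a, a)"]) (simp add: A_def)
    show "\<exists>w. (A w \<and> (Suc n = 0 \<longrightarrow> w = (a, a))) \<and> snd w = fst w \<otimes> snd z"
      if "A z \<and> (n = 0 \<longrightarrow> z = (a, a))" for n z
      using ex[of z] that by blast
  qed
  then obtain f where f: "\<forall>n. (A (f n) \<and> (n = 0 \<longrightarrow> f n = (a, a))) \<and> snd (f (Suc n)) = fst (f (Suc n)) \<otimes> snd (f n)"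
    by (elim exE)
  have prod: "seq_prod (opp R) (\<lambda>n. fst (f n)) n = snd (f n)" for n
  proof (induction n)
    case 0
    have "f 0 = (a, a)" using f by blast
    then show ?case by simp
  next
    case (Suc n)
    then show ?case using f by simp
  qed
  have "\<forall>n. fst (f n) \<in> J" using f unfolding A_def by blast
  then obtain n where "seq_prod (opp R) (\<lambda>n. fst (f n)) n = \<zero>"
    using spec[OF nil[unfolded left_T_nilpotent_def], of "\<lambda>n. fst (f n)"] by auto
  then have "snd (f n) = \<zero>" unfolding prod .
  moreover have "P (snd (f n))" using f unfolding A_def by blast
  ultimately show ?thesis by simp
qed

text \<open>\<open>P p\<close> says that some radical element carries \<open>p\<close> outside
  \<open>Y\<close>. If this failed for all \<open>a \<otimes> p\<close>, then
  \<open>J \<cdot> J\<close> would carry \<open>p\<close> into \<open>Y\<close>, and by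
  \<open>J_le\<close> so would \<open>J\<close>.\<close>

lemma T_nilpotent_Nakayama:
  assumes nil: "left_T_nilpotent (opp R) J"
    and Y: "right_ideal R Y" and J_le: "J \<subseteq> Y <+> (J \<cdot> J)"
  shows "J \<subseteq> Y"
proof (rule ccontr)
  assume nsub: "\<not> J \<subseteq> Y"
  define P where "P p \<longleftrightarrow> p \<in> carrier R \<and> (\<exists>x\<in>J. x \<otimes> p \<notin> Y)" for p
  have "P \<one>" using nsub unfolding P_def by auto
  moreover have "\<exists>a\<in>J. P (a \<otimes> p)" if p: "p \<in> carrier R" "P p" for p
  proof (rule ccontr)
    assume "\<not> ?thesis"
    then have *: "x \<otimes> (a \<otimes> p) \<in> Y" if "a \<in> J" "x \<in> J" for a x
      using that p(1) unfolding P_def by auto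
    have JJ: "u \<in> carrier R \<and> u \<otimes> p \<in> Y" if "u \<in> J \<cdot> J" for u
      using that
    proof (induction rule: ideal_prod.induct)
      case (prod i j)
      then show ?case using *[of j i] p(1) by (simp add: m_assoc)
    next
      case (sum u v)
      then show ?case using right_idealD(4)[OF Y] p(1) by (simp add: l_distr)
    qed
    have "x \<otimes> p \<in> Y" if x: "x \<in> J" for x
    proof -
      obtain y u where yu: "y \<in> Y" "u \<in> J \<cdot> J" "x = y \<oplus> u"
        using J_le x unfolding subset_iff mem_set_add by blast
      have "y \<otimes> p \<in> Y" using right_idealD(5)[OF Y yu(1) p(1)] .
      then show ?thesis
        using JJ[OF yu(2)] right_idealD(2,4)[OF Y] yu p(1) by (simp add: l_distr)
    qed
    then show False using p unfolding P_def by blast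
  qed
  ultimately have "P \<zero>" by (rule T_nilpotent_escape[OF nil])
  then show False using right_idealD(3)[OF Y] unfolding P_def by auto
qed

primrec words :: "'a set \<Rightarrow> nat \<Rightarrow> 'a set" where
  "words X 0 = {\<one>}"
| "words X (Suc n) = {x \<otimes> w | x w. x \<in> X \<and> w \<in> words X n}"

lemma words_closed: "X \<subseteq> carrier R \<Longrightarrow> words X n \<subseteq> carrier R"
  by (induction n) auto

lemma finite_words: "finite X \<Longrightarrow> finite (words X n)"
proof (induction n)
  case (Suc n)
  have "words X (Suc n) = (\<lambda>(x, w). x \<otimes> w) ` (X \<times> words X n)" by auto
  then show ?case using Suc by simp
qed simp

text \<open>The recursion prepends letters, whereas generating the powers of \<open>J\<close> and
  branching in Koenig's argument split off the last letter.\<close>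

lemma words_Suc2:
  assumes X: "X \<subseteq> carrier R"
  shows "words X (Suc n) = {w \<otimes> x | w x. w \<in> words X n \<and> x \<in> X}"
proof (induction n)
  case 0
  have "{x \<otimes> \<one> | x. x \<in> X} = {\<one> \<otimes> x | x. x \<in> X}" using X by (metis l_one r_one subsetD)
  then show ?case by auto
next
  case (Suc n)
  have c: "x \<in> carrier R" if "x \<in> X" for x using X that by blast
  have wc: "w \<in> carrier R" if "w \<in> words X n" for w using words_closed[OF X] that by blast
  show ?case
  proof (intro equalityI subsetI)
    fix u assume "u \<in> words X (Suc (Suc n))"
    then obtain x w' where "x \<in> X" "w' \<in> words X (Suc n)" "u = x \<otimes> w'" unfolding words.simps(2)[of X "Suc n"] by blast
    moreover from this obtain w y where "w \<in> words X n" "y \<in> X" "w' = w \<otimes> y" unfolding Suc by blast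
    ultimately have "u = (x \<otimes> w) \<otimes> y" "x \<otimes> w \<in> words X (Suc n)" "y \<in> X" using c wc by (auto simp: m_assoc)
    then show "u \<in> {w \<otimes> x | w x. w \<in> words X (Suc n) \<and> x \<in> X}" by blast
  next
    fix u assume "u \<in> {w \<otimes> x | w x. w \<in> words X (Suc n) \<and> x \<in> X}"
    then obtain w' y where *: "w' \<in> words X (Suc n)" "y \<in> X" "u = w' \<otimes> y" by blast
    then obtain x w where xw: "x \<in> X" "w \<in> words X n" "w' = x \<otimes> w" by auto
    have "w \<otimes> y \<in> words X (Suc n)" using xw * Suc by blast
    moreover have "u = x \<otimes> (w \<otimes> y)" using * xw c wc by (simp add: m_assoc)
    ultimately show "u \<in> words X (Suc (Suc n))" using xw(1) unfolding words.simps(2)[of X "Suc n"] by blast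
  qed
qed

text \<open>\<open>J\<close> is two-sided, so multiplying \<open>w \<otimes> r\<close> by radical
  elements gives only products of the word \<open>w\<close> with radical elements, and the longer
  words \<open>w \<otimes> x\<close> generate these.\<close>

lemma J_pow_subset_words:
  assumes X: "X \<subseteq> J" "J \<subseteq> rhull X"
  shows "J_pow n \<subseteq> rhull (words X n)"
proof (induction n)
  case 0
  have "right_ideal R (rhull {\<one>})" by (rule right_ideal_rhull) auto
  then have "rhull {\<one>} = carrier R" using carrier_subset_right_ideal rhull_upper[of "{\<one>}"] by blast
  then show ?case by simp
next
  case (Suc n)
  have Xc: "X \<subseteq> carrier R" using X(1) by auto
  let ?H = "rhull (words X (Suc n))"
  have H: "right_ideal R ?H" by (rule right_ideal_rhull[OF words_closed[OF Xc]])
  let ?Q = "{u \<in> carrier R. \<forall>j\<in>J. u \<otimes> j \<in> ?H}"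
  have Q: "right_ideal R ?Q"
  proof (rule right_idealI)
    show "u \<otimes> r \<in> ?Q" if u: "u \<in> ?Q" and r: "r \<in> carrier R" for u r
    proof -
      have "u \<otimes> r \<otimes> j \<in> ?H" if j: "j \<in> J" for j
      proof -
        have "u \<otimes> (r \<otimes> j) \<in> ?H" using u J_left_mult[OF j r] by blast
        then show ?thesis using u r j by (simp add: m_assoc)
      qed
      then show ?thesis using u r by simp
    qed
  qed (use right_idealD(3,4)[OF H] in \<open>auto simp: l_distr\<close>)
  have "words X n \<subseteq> ?Q"
  proof
    fix w assume w: "w \<in> words X n"
    then have wc: "w \<in> carrier R" using words_closed[OF Xc] by blast
    have "rhull X \<subseteq> {r \<in> carrier R. w \<otimes> r \<in> ?H}"
    proof (rule rhull_least)
      show "right_ideal R {r \<in> carrier R. w \<otimes> r \<in> ?H}" by (rule right_ideal_left_mult_preimage[OF H wc])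
      have "w \<otimes> x \<in> words X (Suc n)" if "x \<in> X" for x using w that unfolding words_Suc2[OF Xc] by blast
      then show "X \<subseteq> {r \<in> carrier R. w \<otimes> r \<in> ?H}" using Xc rhull_upper by blast
    qed
    then show "w \<in> ?Q" using X(2) wc by blast
  qed
  then have "rhull (words X n) \<subseteq> ?Q" by (intro rhull_least[OF Q])
  then have "J_pow n \<cdot> J \<subseteq> ?H" using Suc by (intro ideal_prod_least[OF H]) blast
  then show ?case by simp
qed

lemma words_subset_J_pow:
  assumes "X \<subseteq> J"
  shows "words X n \<subseteq> J_pow n"
proof (induction n)
  case (Suc n)
  have "X \<subseteq> carrier R" using assms by auto
  then show ?case using Suc assms unfolding words_Suc2[OF \<open>X \<subseteq> carrier R\<close>] by (auto intro!: ideal_prod.prod)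
qed simp

text \<open>Koenig's lemma for the tree of nonzero words in the generators.\<close>

lemma T_nilpotent_finitely_generated_nilpotent:
  assumes nil: "left_T_nilpotent (opp R) J" and X: "finite X" "X \<subseteq> J" "J \<subseteq> rhull X"
  shows "\<exists>n. J_pow n = {\<zero>}"
proof -
  have Xc: "X \<subseteq> carrier R" using X(2) by auto
  have "\<exists>n. \<forall>w\<in>words X n. w = \<zero>"
  proof (rule ccontr)
    assume *: "\<not> ?thesis"
    \<comment> \<open>Some word of every length does not kill \<open>p\<close>: the subtree at
      \<open>p\<close> is infinitely deep.\<close>
    define P where "P p \<longleftrightarrow> (\<forall>n. \<exists>w\<in>words X n. w \<otimes> p \<noteq> \<zero>)" for p
    have "P \<one>" using * words_closed[OF Xc] unfolding P_def by (metis r_one subsetD)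
    moreover have "\<exists>a\<in>J. P (a \<otimes> p)" if p: "p \<in> carrier R" "P p" for p
    proof (rule ccontr)
      assume "\<not> ?thesis"
      then have "\<forall>x\<in>X. \<exists>n. \<forall>w\<in>words X n. w \<otimes> (x \<otimes> p) = \<zero>" using X(2) unfolding P_def by blast
      then obtain f where f: "\<forall>x\<in>X. \<forall>w\<in>words X (f x). w \<otimes> (x \<otimes> p) = \<zero>" by (auto dest: bchoice)
      have mono: "\<forall>w\<in>words X (k + m). w \<otimes> q = \<zero>"
        if q: "q \<in> carrier R" "\<forall>w\<in>words X k. w \<otimes> q = \<zero>" for k m q
      proof (induction m)
        case (Suc m)
        show ?case
        proof
          fix w assume "w \<in> words X (k + Suc m)"
          then obtain x w' where w': "x \<in> X" "w' \<in> words X (k + m)" "w = x \<otimes> w'" by auto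
          have "x \<in> carrier R" "w' \<in> carrier R" using w' Xc words_closed[OF Xc] by blast+
          then show "w \<otimes> q = \<zero>" using Suc w' q(1) by (simp add: m_assoc)
        qed
      qed (use q in simp)
      \<comment> \<open>Finiteness of \<open>X\<close> yields one length \<open>N\<close> at which
        all branches \<open>x \<otimes> p\<close> are dead; words of length \<open>Suc N\<close>
        then kill \<open>p\<close>.\<close>
      obtain N where N: "\<forall>x\<in>X. f x \<le> N" using X(1) by (meson finite_nat_set_iff_bounded_le finite_imageI image_eqI)
      have "w \<otimes> p = \<zero>" if w: "w \<in> words X (Suc N)" for w
      proof -
        obtain v x where vx: "v \<in> words X N" "x \<in> X" "w = v \<otimes> x" using w unfolding words_Suc2[OF Xc] by blast
        have c: "x \<in> carrier R" "v \<in> carrier R" using vx Xc words_closed[OF Xc] by blast+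
        have "v \<otimes> (x \<otimes> p) = \<zero>"
          using mono[of "x \<otimes> p" "f x" "N - f x"] f vx c N p(1) by auto
        then show ?thesis using vx(3) c p(1) by (simp add: m_assoc)
      qed
      then show False using p(2) unfolding P_def by blast
    qed
    ultimately have "P \<zero>" by (rule T_nilpotent_escape[OF nil])
    then show False using words_closed[OF Xc] unfolding P_def by (metis r_null subsetD)
  qed
  then obtain n where "words X n \<subseteq> {\<zero>}" by blast
  then have "J_pow n \<subseteq> {\<zero>}"
    using J_pow_subset_words[OF X(2,3), of n] rhull_least[OF right_ideal_zero] by blast
  then show ?thesis using right_idealD(3)[OF J_pow_right_ideal, of n] by blast
qed

end

context semilocal_small_dual
begin

lemma finite_length_of_perfect:
  assumes nil: "left_T_nilpotent (opp R) J"
  shows "\<exists>m. len_le (right_ideal R) {\<zero>} (carrier R) m"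
proof -
  have JJ: "right_ideal R (J \<cdot> J)" using ideal_prod_is_ideal[OF ideal_J ideal_J] by (simp add: ideal_iff)
  have JJ_J: "J \<cdot> J \<subseteq> J" using ideal_prod_inter[OF ideal_J ideal_J] by blast
  have T: "right_ideal R (S \<inter> J)" by (rule right_ideal_Int[OF right_ideal_S right_ideal_J])
  \<comment> \<open>\<open>S \<inter> J\<close> has to be part of \<open>?B\<close> for
    \<open>finite_mod_J_square\<close>; its finite length supplies generators \<open>Y\<close> that
    are added to \<open>X\<close> afterwards.\<close>
  have "acc_on (\<lambda>D. right_ideal R D \<and> {\<zero>} \<subseteq> D \<and> D \<subseteq> S \<inter> J)"
    using left_ann_J by (intro acc_on_mono[OF len_le_acc[OF finite_length_right_ann_J]]) auto
  then obtain Y where Y: "finite Y" "Y \<subseteq> S \<inter> J" "rhull Y = S \<inter> J"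
    using finitely_generated_of_acc[OF _ T] by blast
  let ?B = "(J \<cdot> J) <+> (S \<inter> J)"
  have B: "right_ideal R ?B" by (rule right_ideal_set_add[OF JJ T])
  have "?B \<subseteq> J" using JJ_J by (intro set_add_least right_ideal_J) auto
  moreover have "a \<otimes> b \<in> ?B" if "a \<in> J" "b \<in> J" for a b
    using ideal_prod.prod[OF that] set_add_upper1[OF JJ T] by blast
  ultimately obtain X where X: "finite X" "X \<subseteq> J" "J \<subseteq> rhull (?B \<union> X)"
    using finite_mod_J_square[OF B set_add_upper2[OF JJ T]] by blast
  let ?X = "X \<union> Y"
  have XJ: "?X \<subseteq> J" using X(2) Y(2) by blast
  then have Xc: "?X \<subseteq> carrier R" by auto
  have H: "right_ideal R (rhull ?X)" by (rule right_ideal_rhull[OF Xc])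
  have HJ: "right_ideal R (rhull ?X <+> (J \<cdot> J))" by (rule right_ideal_set_add[OF H JJ])
  have "rhull (?B \<union> X) \<subseteq> rhull ?X <+> (J \<cdot> J)"
  proof (rule rhull_least[OF HJ])
    have "S \<inter> J \<subseteq> rhull ?X" unfolding Y(3)[symmetric] by (rule rhull_mono) auto
    then have "?B \<subseteq> rhull ?X <+> (J \<cdot> J)"
      using set_add_upper1[OF H JJ] set_add_upper2[OF H JJ] by (intro set_add_least[OF HJ]) auto
    moreover have "X \<subseteq> rhull ?X" using rhull_upper[of ?X] by blast
    ultimately show "?B \<union> X \<subseteq> rhull ?X <+> (J \<cdot> J)" using set_add_upper1[OF H JJ] by blast
  qed
  then have J_X: "J \<subseteq> rhull ?X" using X(3) by (intro T_nilpotent_Nakayama[OF nil H]) blast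
  have fX: "finite ?X" using X Y by blast
  obtain N where N: "J_pow N = {\<zero>}"
    using T_nilpotent_finitely_generated_nilpotent[OF nil fX XJ J_X] by blast
  have "\<exists>m. len_le (right_ideal R) (J_pow (Suc k)) (J_pow k) m" for k
  proof -
    have "\<exists>m. len_le (right_ideal R) (J_pow (Suc k)) (rhull (J_pow (Suc k) \<union> words ?X k)) m"
    proof (rule finite_length_finitely_generated[OF fin_right J_pow_right_ideal finite_words[OF fX] words_closed[OF Xc]])
      fix w j assume "w \<in> words ?X k" "j \<in> J"
      then show "w \<otimes> j \<in> J_pow (Suc k)"
        using words_subset_J_pow[OF XJ, of k] by (auto intro: ideal_prod.prod)
    qed
    moreover have "J_pow k \<subseteq> rhull (J_pow (Suc k) \<union> words ?X k)"
      using J_pow_subset_words[OF XJ J_X, of k] rhull_mono[of "words ?X k"] by blast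
    ultimately show ?thesis using len_le_subinterval by blast
  qed
  from finite_length_layers[OF this, of N] show ?thesis unfolding N .
qed

end

text \<open>Left T-nilpotence lengthens products on the right, which suits left ideals. So the
  finite length is found in the opposite ring and brought back by annihilators.\<close>

lemma (in ring) quasi_Frobenius_of_perfect:
  assumes dual: "small_dual R" and perf: "left_perfect R"
  shows "quasi_Frobenius R"
proof -
  interpret O: ring "opp R" by simp
  obtain n where n: "len_le (right_ideal R) J (carrier R) n"
    using perf semilocal_iff by (auto simp: left_perfect_def)
  interpret semilocal_small_dual R n by (rule semilocal_small_dualI[OF dual n])
  have "left_T_nilpotent (opp (opp R)) (jacobson_radical (opp R))"
    using perf by (simp add: left_perfect_def)
  then obtain m where "len_le (left_ideal R) {\<zero>} (carrier R) m"
    using semilocal_small_dual.finite_length_of_perfect[OF semilocal_small_dual_opp] by auto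
  then have "len_le (right_ideal R) {\<zero>} (carrier R) m"
    using O.finite_length_left_of_right[of m] dual by simp
  then show ?thesis by (rule finite_length_quasi_Frobenius[OF dual])
qed

theorem theorem3p7:
  fixes R :: "('a, 'b) ring_scheme" (structure)
  assumes "ring R"
  shows
    "(quasi_Frobenius R \<longleftrightarrow>
        small_dual R \<and> left_perfect R) \<and>
     (quasi_Frobenius R \<longleftrightarrow>
        small_dual R \<and> acc_on (right_annihilator R) \<and>
        essential_right R (right_socle R) (carrier R)) \<and>
     (quasi_Frobenius R \<longleftrightarrow>
        small_dual R \<and> semilocal R \<and> acc_on (right_annihilator R)) \<and>
     (quasi_Frobenius R \<longleftrightarrow>
        small_dual R \<and> semilocal R \<and> acc_on (\<lambda>I. essential_right R I (carrier R)))"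
proof -
  interpret ring R by fact
  have annihilators: "quasi_Frobenius R" if "small_dual R" "semilocal R" "acc_on (right_annihilator R)"
    using quasi_Frobenius_of_acc_annihilators that semilocal_iff by blast
  have essential_socle: "quasi_Frobenius R"
    if "small_dual R" "acc_on (right_annihilator R)" "essential_right R (right_socle R) (carrier R)"
  proof -
    \<comment> \<open>The socle argument bounds the left ideals above \<open>J\<close>; the symmetry
      of semilocality moves the bound to the right.\<close>
    have "semilocal R"
      using semilocal_of_essential_socle[OF _ that(2,3)] that(1) len_le_J_right_of_left semilocal_iff
      unfolding small_dual_def by blast
    then show ?thesis using annihilators that by blast
  qed
  have essential: "quasi_Frobenius R"
    if dual: "small_dual R" and sl: "semilocal R" and acc: "acc_on (\<lambda>I. essential_right R I (carrier R))"
  proof -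
    obtain n where "len_le (right_ideal R) J (carrier R) n" using semilocal_iff sl by blast
    then interpret semilocal_small_dual R n by (rule semilocal_small_dualI[OF dual])
    show ?thesis by (rule quasi_Frobenius_of_acc_essential[OF acc])
  qed
  have acc: "acc_on (right_annihilator R)" "acc_on (\<lambda>I. essential_right R I (carrier R))"
    if "quasi_Frobenius R"
    by (rule acc_on_mono[OF quasi_Frobenius_properties(4)[OF that]];
        simp add: right_ideal_of_right_annihilator essential_right_def)+
  show ?thesis
    using quasi_Frobenius_of_perfect annihilators essential_socle essential acc
      quasi_Frobenius_properties by blast
qed

end
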